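(* Fix $R>0$ and for $f\in\mathrm{Zh}$ and $Z_1,Z_2\in\mathbb D^+_R\sqcup\mathbb D^-_R$ define $$(I_Rf)(Z_1,Z_2)=\frac{i}{2\pi^3}\int_{W\in U(2)_R}\frac{f(W)\,dV}{N(W-Z_1)\,N(W-Z_2)}.$$ (1) For every $f\in\mathrm{Zh}$, the restriction of $I_Rf$ to $\mathbb D^+_R\times\mathbb D^+_R$ is a polynomial in the entries of $Z_1,Z_2$ which is harmonic in $Z_1$ and in $Z_2$ separately (an element of $\mathcal H^+\otimes\mathcal H^+$); if $f\in\mathrm{Zh}^+$ then $(I_Rf)(Z,Z)=f(Z)$ for all $Z\in\mathbb D^+_R$; and if $f\in\mathrm{Zh}^-\oplus\mathrm{Zh}^0$ then $I_Rf\equiv0$ on $\mathbb D^+_R\times\mathbb D^+_R$. (2) For every $f\in\mathrm{Zh}$, the restriction of $I_Rf$ to $\mathbb D^-_R\times\mathbb D^-_R$ lies in $\mathcal H^-\otimes\mathcal H^-$ (a finite sum of products $\phi_1(Z_1)\phi_2(Z_2)$ with $\phi_1,\phi_2\in\mathcal H^-$); if $f\in\mathrm{Zh}^-$ then $(I_Rf)(Z,Z)=f(Z)$ for all $Z\in\mathbb D^-_R$; and if $f\in\mathrm{Zh}^0\oplus\mathrm{Zh}^+$ then $I_Rf\equiv0$ on $\mathbb D^-_R\times\mathbb D^-_R$.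
   Context: $\mathbb H_{\mathbb C}$ = complex $2\times2$ matrices $Z=(z_{ij})=\begin{pmatrix} z^0-iz^3&-iz^1-z^2\\-iz^1+z^2&z^0+iz^3\end{pmatrix}$, $N(Z)=\det Z$, $Z^*$ conjugate transpose. $U(2)_R=\{RZ: Z^*Z=1\}$; $\mathbb D^+_R=\{Z: ZZ^*<R^2\}$, $\mathbb D^-_R=\{Z: ZZ^*>R^2\}$ (matrix inequalities meaning $ZZ^*-R^2$ negative, resp. positive, definite). $dV=dz^0\wedge dz^1\wedge dz^2\wedge dz^3$, and $U(2)_R$ is oriented so that $\int_{U(2)_R}dV/N(Z)^2=-2\pi^3i$. $t^l_{nm}(Z)=\frac1{2\pi i}\oint (sz_{11}+z_{21})^{l-m}(sz_{12}+z_{22})^{l+m}s^{-l+n}\frac{ds}{s}$ for $l\in\{0,\frac12,1,\dots\}$, $m,n\in\mathbb Z+l$, $|m|,|n|\le l$. $\mathcal H^+=\operatorname{span}\{t^l_{nm}(Z)\}$, $\mathcal H^-=\operatorname{span}\{t^l_{nm}(Z)N(Z)^{-(2l+1)}\}$. $\mathrm{Zh}=\mathbb C[z_{11},z_{12},z_{21},z_{22},N(Z)^{-1}]$, with $\mathrm{Zh}^+,\mathrm{Zh}^-,\mathrm{Zh}^0$ the spans of $t^l_{nm}(Z)N(Z)^k$ with $k\ge0$, $k\le-(2l+2)$, $-(2l+1)\le k\le-1$ respectively; $\mathrm{Zh}=\mathrm{Zh}^-\oplus\mathrm{Zh}^0\oplus\mathrm{Zh}^+$. *)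

theory Defs
  imports "HOL-Analysis.Analysis"
begin

type_synonym mat2 = "complex^2^2"

definition NN :: "mat2 \<Rightarrow> complex" where
  "NN Z = Z$1$1 * Z$2$2 - Z$1$2 * Z$2$1"

definition cadj :: "mat2 \<Rightarrow> mat2" where
  "cadj Z = (\<chi> i j. cnj (Z$j$i))"

definition posdef2 :: "mat2 \<Rightarrow> bool" where
  "posdef2 A \<longleftrightarrow> (\<forall>v::complex^2. v \<noteq> 0 \<longrightarrow>
      0 < Re (\<Sum>i\<in>UNIV. \<Sum>j\<in>UNIV. cnj (v$i) * A$i$j * v$j))"

definition Dplus :: "real \<Rightarrow> mat2 set" where
  "Dplus R = {Z. posdef2 (mat (complex_of_real (R^2)) - Z ** cadj Z)}"

definition Dminus :: "real \<Rightarrow> mat2 set" where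
  "Dminus R = {Z. posdef2 (Z ** cadj Z - mat (complex_of_real (R^2)))}"

definition U2 :: "real \<Rightarrow> mat2 set" where
  "U2 R = {R *\<^sub>R Z | Z. cadj Z ** Z = mat 1}"

text \<open>Real coordinates z^0..z^3 (complex valued), indexed by 1,2,3,4(=0) of type 4.\<close>
definition zc :: "4 \<Rightarrow> mat2 \<Rightarrow> complex" where
  "zc k Z = (if k = 1 then (Z$1$1 + Z$2$2) / 2
             else if k = 2 then \<i> * (Z$1$2 + Z$2$1) / 2
             else if k = 3 then (Z$2$1 - Z$1$2) / 2
             else \<i> * (Z$1$1 - Z$2$2) / 2)"

text \<open>A.e. bijective parametrisation of U(2):
  [[a, - e^{i phi} cnj b],[b, e^{i phi} cnj a]], a = cos t e^{i alpha}, b = sin t e^{i beta}.\<close>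
definition uparam :: "real^4 \<Rightarrow> mat2" where
  "uparam p = (let a = complex_of_real (cos (p$1)) * cis (p$2);
                   b = complex_of_real (sin (p$1)) * cis (p$3);
                   e = cis (p$4)
               in vector [vector [a, - e * cnj b], vector [b, e * cnj a]])"

definition pbox_lo :: "real^4" where "pbox_lo = vector [0, 0, 0, 0]"
definition pbox_hi :: "real^4" where "pbox_hi = vector [pi/2, 2*pi, 2*pi, 2*pi]"

definition pdiff :: "(real^4 \<Rightarrow> complex) \<Rightarrow> real^4 \<Rightarrow> 4 \<Rightarrow> complex" where
  "pdiff g p j = vector_derivative (\<lambda>s. g (p + s *\<^sub>R axis j 1)) (at 0)"

text \<open>Pull-back of dz^0 ^ dz^1 ^ dz^2 ^ dz^3 along the parametrisation of U(2)_R,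
  integrated over the parameter box (one fixed orientation).\<close>
definition rawU2int :: "real \<Rightarrow> (mat2 \<Rightarrow> complex) \<Rightarrow> complex" where
  "rawU2int R g = integral (cbox pbox_lo pbox_hi)
     (\<lambda>p. g (R *\<^sub>R uparam p) *
          det (\<chi> k j. pdiff (\<lambda>q. zc k (R *\<^sub>R uparam q)) p j))"

text \<open>Orientation chosen so that the integral of dV/N(Z)^2 equals -2 pi^3 i.\<close>
definition orientU2 :: "real \<Rightarrow> complex" where
  "orientU2 R = (if rawU2int R (\<lambda>W. inverse (NN W ^ 2)) = - 2 * of_real (pi^3) * \<i>
                 then 1 else -1)"

definition U2int :: "real \<Rightarrow> (mat2 \<Rightarrow> complex) \<Rightarrow> complex" where
  "U2int R g = orientU2 R * rawU2int R g"

definition IR :: "real \<Rightarrow> (mat2 \<Rightarrow> complex) \<Rightarrow> mat2 \<Rightarrow> mat2 \<Rightarrow> complex" where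
  "IR R f Z1 Z2 = \<i> / (2 * of_real (pi^3)) *
     U2int R (\<lambda>W. f W / (NN (W - Z1) * NN (W - Z2)))"

text \<open>Matrix coefficients t^l_{nm}, with l2 = 2l, mm = l - m, nn = l - n;
  the contour integral over |s|=1 written as (1/2pi) int_0^{2pi} dtheta.\<close>
definition tlnm :: "nat \<Rightarrow> nat \<Rightarrow> nat \<Rightarrow> mat2 \<Rightarrow> complex" where
  "tlnm l2 mm nn Z = complex_of_real (1 / (2*pi)) *
     integral {0..2*pi} (\<lambda>\<theta>. (cis \<theta> * Z$1$1 + Z$2$1) ^ mm *
        (cis \<theta> * Z$1$2 + Z$2$2) ^ (l2 - mm) * (cis \<theta>) powi (- int nn))"

definition cspan :: "(mat2 \<Rightarrow> complex) set \<Rightarrow> (mat2 \<Rightarrow> complex) set" where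
  "cspan S = {f. \<exists>F c. finite F \<and> F \<subseteq> S \<and> f = (\<lambda>Z. \<Sum>g\<in>F. c g * g Z)}"

definition fsum :: "(mat2 \<Rightarrow> complex) set \<Rightarrow> (mat2 \<Rightarrow> complex) set \<Rightarrow> (mat2 \<Rightarrow> complex) set" where
  "fsum A B = {(\<lambda>Z. f Z + g Z) | f g. f \<in> A \<and> g \<in> B}"

definition Hplus :: "(mat2 \<Rightarrow> complex) set" where
  "Hplus = cspan {tlnm l2 mm nn | l2 mm nn. mm \<le> l2 \<and> nn \<le> l2}"

definition Hminus :: "(mat2 \<Rightarrow> complex) set" where
  "Hminus = cspan {(\<lambda>Z. tlnm l2 mm nn Z * NN Z powi (- (int l2 + 1))) | l2 mm nn.
                     mm \<le> l2 \<and> nn \<le> l2}"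

definition Zh :: "(mat2 \<Rightarrow> complex) set" where
  "Zh = cspan {(\<lambda>Z. Z$1$1 ^ a * Z$1$2 ^ b * Z$2$1 ^ c * Z$2$2 ^ d * NN Z powi k)
               | a b c d k. True}"

definition ZhPlus :: "(mat2 \<Rightarrow> complex) set" where
  "ZhPlus = cspan {(\<lambda>Z. tlnm l2 mm nn Z * NN Z powi k) | l2 mm nn k.
                     mm \<le> l2 \<and> nn \<le> l2 \<and> 0 \<le> k}"

definition ZhMinus :: "(mat2 \<Rightarrow> complex) set" where
  "ZhMinus = cspan {(\<lambda>Z. tlnm l2 mm nn Z * NN Z powi k) | l2 mm nn k.
                     mm \<le> l2 \<and> nn \<le> l2 \<and> k \<le> - (int l2 + 2)}"

definition ZhZero :: "(mat2 \<Rightarrow> complex) set" where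
  "ZhZero = cspan {(\<lambda>Z. tlnm l2 mm nn Z * NN Z powi k) | l2 mm nn k.
                     mm \<le> l2 \<and> nn \<le> l2 \<and> - (int l2 + 1) \<le> k \<and> k \<le> -1}"

end

theory Submission
  imports Defs "HOL-Computational_Algebra.Polynomial"
begin

text \<open>Up to normalisation \<open>dV / N(W)\<^sup>2\<close> is Haar measure on \<open>U(2)\<^sub>R\<close>, so \<open>I\<^sub>R f\<close> is the Haar average
  of \<open>f(W) N(W)\<^sup>2 / (N(W - Z\<^sub>1) N(W - Z\<^sub>2))\<close>. Writing \<open>B(W, Z)\<close> for the polarisation of \<open>N\<close>,
  one has \<open>N(W - Z) = N(W) - B(W, Z) + N(Z)\<close>, and \<open>1 / N(W - Z)\<close> is a geometric-type series whose
  terms \<open>h\<^sub>p(W, Z)\<close> are characters of symmetric powers of the matrix \<open>Z adj(W)\<close>, hence finite sums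
  of products of matrix coefficients. The scalar circle action leaves only the terms with one fixed
  \<open>p + q\<close>, so \<open>I\<^sub>R f\<close> is a finite sum of products.

  Everything else follows from a single moment formula: for a linear form \<open>L\<^sub>A(W) = \<Sum> a\<^sub>i\<^sub>j w\<^sub>i\<^sub>j\<close> the
  average of \<open>L\<^sub>A(W)\<^bsup>2M\<^esup> N(W)\<^bsup>-M\<^esup>\<close> is the \<open>M\<close>-th Catalan number times \<open>(det A)\<^bsup>M\<^esup>\<close>. Adding
  \<open>t x y\<^sup>T\<close> to \<open>A\<close> changes \<open>det A\<close> by a term linear in \<open>t\<close>, so comparing powers of \<open>t\<close> gives the averages
  of \<open>(x\<^sup>T W y)\<^sup>n B(W, Z)\<^sup>m N(W)\<^bsup>-M\<^esup>\<close>: they vanish for \<open>n > m\<close>, which is the vanishing statement,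
  and on the diagonal the explicit values add up to \<open>f(Z)\<close> by a finite difference identity.\<close>

subsection \<open>The Haar integral in coordinates\<close>

text \<open>The thresholds in the decomposition of Zh are degree counts. Let f = t N^k with t
  homogeneous of degree n = 2l. Inside, 1 / N(W - Z) is expanded in powers of 1 / N(W), and the
  circle action selects p + q = n + 2k; outside, it is expanded in powers of 1 / N(Z), and p + q = -
  n - 2k - 4 is selected. The product h_p h_q contains at most p + q factors B(W, Z_i), too few to
  pair with t when p + q < n. This means k < 0 in the first case and k > - (n + 2) in the second. In
  the complementary ranges p + q = n + 2e with e >= 0, and one and the same diagonal average gives
  t(Z) N(Z)^e; outside, the factor N(Z)^(-p-q-2) then restores the exponent k. Convergence is
  governed by the roots z of N(Z - z W), with W and Z exchanged outside. A left kernel vector u of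
  the singular matrix satisfies u^* Z = z u^* W, so |z| is a quotient of the lengths of u^* Z and
  u^* W. Compactness of the unit sphere keeps it below a constant less than 1, uniformly in
  W.\<close>

lemma det_4:
  "det (A::'a::comm_ring_1^4^4) =
     A$1$1 * (A$2$2 * (A$3$3 * A$4$4 - A$3$4 * A$4$3) - A$2$3 * (A$3$2 * A$4$4 - A$3$4 * A$4$2)
              + A$2$4 * (A$3$2 * A$4$3 - A$3$3 * A$4$2))
   - A$1$2 * (A$2$1 * (A$3$3 * A$4$4 - A$3$4 * A$4$3) - A$2$3 * (A$3$1 * A$4$4 - A$3$4 * A$4$1)
              + A$2$4 * (A$3$1 * A$4$3 - A$3$3 * A$4$1))
   + A$1$3 * (A$2$1 * (A$3$2 * A$4$4 - A$3$4 * A$4$2) - A$2$2 * (A$3$1 * A$4$4 - A$3$4 * A$4$1)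
              + A$2$4 * (A$3$1 * A$4$2 - A$3$2 * A$4$1))
   - A$1$4 * (A$2$1 * (A$3$2 * A$4$3 - A$3$3 * A$4$2) - A$2$2 * (A$3$1 * A$4$3 - A$3$3 * A$4$1)
              + A$2$3 * (A$3$1 * A$4$2 - A$3$2 * A$4$1))"
proof -
  have f1234: "finite {2::4, 3, 4}" "1 \<notin> {2::4, 3, 4}" by auto
  have f234: "finite {3::4, 4}" "2 \<notin> {3::4, 4}" by auto
  have f34: "finite {4::4}" "3 \<notin> {4::4}" by auto
  show ?thesis
    unfolding det_def UNIV_4
    unfolding sum_over_permutations_insert[OF f1234]
    unfolding sum_over_permutations_insert[OF f234]
    unfolding sum_over_permutations_insert[OF f34]
    unfolding permutes_sing
    by (simp add: sign_swap_id permutation_swap_id sign_compose permutation_compose sign_id 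
        swap_id_eq) (simp add: algebra_simps)
qed

lemma vector_4: "(vector [a,b,c,d] :: 'a::zero^4) $ 1 = a" "(vector [a,b,c,d] :: 'a^4) $ 2 = b"
   "(vector [a,b,c,d] :: 'a^4) $ 3 = c" "(vector [a,b,c,d] :: 'a^4) $ 4 = d"
  unfolding vector_def by simp_all

text \<open>Fubini in all four coordinates at once: Lebesgue measure on the space is the image of
  the product measure indexed by \<open>Basis\<close>, and the indicator of the box is itself a
  product, so it can be shared out among the factors.\<close>

lemma integral_cbox_prod:
  fixes f :: "4 \<Rightarrow> real \<Rightarrow> complex" and a b :: "real^4"
  assumes cont: "\<And>i. continuous_on UNIV (f i)"
  shows "integral (cbox a b) (\<lambda>p. \<Prod>i\<in>UNIV. f i (p$i)) = (\<Prod>i\<in>UNIV. integral {a$i..b$i} (f i))"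
proof -
  let ?B = "Basis :: (real^4) set"
  define h where "h = (\<lambda>(b'::real^4) x. indicator {a \<bullet> b'..b \<bullet> b'} x *\<^sub>R f (axis_index b') x)"
  have bij: "bij_betw (\<lambda>i::4. axis i (1::real)) UNIV ?B"
    by (auto simp: bij_betw_def inj_on_def axis_eq_axis Basis_vec_def)
  have ai: "axis_index (axis i (1::real) :: real^4) = i" for i :: 4
    by (metis axis_eq_axis axis_index axis_in_Basis_iff one_neq_zero real_inner_1_right zero_neq_one insertI1 Basis_real_def)
  have contp: "continuous_on (cbox a b) (\<lambda>p. \<Prod>i\<in>UNIV. f i (p$i))"
    by (intro continuous_intros continuous_on_compose2[OF cont]) auto
  have int1: "integrable lborel (h b')" for b'
  proof -
    have "set_integrable lborel {a \<bullet> b'..b \<bullet> b'} (f (axis_index b'))"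
      using borel_integrable_atLeastAtMost'[of "a \<bullet> b'" "b \<bullet> b'" "f (axis_index b')"] continuous_on_subset[OF cont] by blast
    then show ?thesis by (simp add: set_integrable_def h_def)
  qed
  have "integral (cbox a b) (\<lambda>p. \<Prod>i\<in>UNIV. f i (p$i)) = (LINT p:cbox a b|lborel. \<Prod>i\<in>UNIV. f i (p$i))"
    using set_borel_integral_eq_integral(2)[OF borel_integrable_compact[OF compact_cbox contp, folded set_integrable_def]] by simp
  also have "\<dots> = integral\<^sup>L lborel (\<lambda>p. \<Prod>b'\<in>Basis. h b' (p \<bullet> b'))"
    unfolding set_lebesgue_integral_def
  proof (intro Bochner_Integration.integral_cong refl)
    fix p :: "real^4"
    have "(\<Prod>b'\<in>Basis. h b' (p \<bullet> b')) = (\<Prod>i\<in>UNIV. indicator {a$i..b$i} (p$i) *\<^sub>R f i (p$i))"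
      by (subst prod.reindex_bij_betw[OF bij, symmetric]) (simp add: inner_axis ai h_def)
    also have "\<dots> = indicator (cbox a b) p *\<^sub>R (\<Prod>i\<in>UNIV. f i (p$i))"
    proof (cases "p \<in> cbox a b")
      case True
      then show ?thesis by (auto simp: mem_box_cart intro!: prod.cong)
    next
      case False
      then obtain i where "p $ i \<notin> {a$i..b$i}" by (auto simp: mem_box_cart)
      then have "(\<Prod>i\<in>UNIV. indicator {a$i..b$i} (p$i) *\<^sub>R f i (p$i)) = 0"
        by (intro prod_zero) (auto intro!: exI[of _ i])
      with False show ?thesis by simp
    qed
    finally show "indicator (cbox a b) p *\<^sub>R (\<Prod>i\<in>UNIV. f i (p$i)) = (\<Prod>b'\<in>Basis. h b' (p \<bullet> b'))" ..
  qed
  also have "\<dots> = integral\<^sup>L (\<Pi>\<^sub>M b\<in>?B. lborel) (\<lambda>g. \<Prod>b'\<in>Basis. h b' (g b'))"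
  proof -
    have m: "h b' \<in> borel_measurable borel" for b'
      using borel_measurable_integrable[OF int1[of b']] by simp
    have "integral\<^sup>L lborel (\<lambda>p. \<Prod>b'\<in>Basis. h b' (p \<bullet> b'))
        = integral\<^sup>L (\<Pi>\<^sub>M b\<in>?B. lborel) (\<lambda>g. \<Prod>b'\<in>Basis. h b' ((\<Sum>b\<in>?B. g b *\<^sub>R b) \<bullet> b'))"
      apply (subst lborel_eq)
      apply (subst integral_distr)
        apply measurable
       apply (rule measurable_compose[OF _ m])
       apply measurable
      done
    also have "\<dots> = integral\<^sup>L (\<Pi>\<^sub>M b\<in>?B. lborel) (\<lambda>g. \<Prod>b'\<in>Basis. h b' (g b'))"
      by (intro Bochner_Integration.integral_cong refl prod.cong) (simp add: inner_sum_left_Basis)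
    finally show ?thesis .
  qed
  also have "\<dots> = (\<Prod>b'\<in>Basis. integral\<^sup>L lborel (h b'))"
  proof -
    interpret product_sigma_finite "\<lambda>b::real^4. lborel :: real measure" by standard
    show ?thesis by (rule product_integral_prod) (auto intro: int1)
  qed
  also have "\<dots> = (\<Prod>i\<in>UNIV. (LINT x|lborel. indicator {a$i..b$i} x *\<^sub>R f i x))"
    by (subst prod.reindex_bij_betw[OF bij, symmetric]) (simp add: inner_axis ai h_def)
  also have "\<dots> = (\<Prod>i\<in>UNIV. integral {a$i..b$i} (f i))"
  proof (intro prod.cong refl)
    fix i
    have "set_integrable lborel {a $ i..b $ i} (f i)"
      by (rule borel_integrable_atLeastAtMost'[OF continuous_on_subset[OF cont]]) simp
    from set_borel_integral_eq_integral(2)[OF this]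
    show "(LINT x|lborel. indicator {a$i..b$i} x *\<^sub>R f i x) = integral {a$i..b$i} (f i)"
      by (simp add: set_lebesgue_integral_def)
  qed
  finally show ?thesis .
qed

section \<open>The Jacobian of the parametrisation\<close>

lemma scaleR_uparam_nth:
  "(R *\<^sub>R uparam p) $ 1 $ 1 = of_real R * (of_real (cos (p$1)) * cis (p$2))"
  "(R *\<^sub>R uparam p) $ 1 $ 2 = of_real R * (- (of_real (sin (p$1)) * cis (- (p$3))) * cis (p$4))"
  "(R *\<^sub>R uparam p) $ 2 $ 1 = of_real R * (of_real (sin (p$1)) * cis (p$3))"
  "(R *\<^sub>R uparam p) $ 2 $ 2 = of_real R * (of_real (cos (p$1)) * cis (- (p$2)) * cis (p$4))"
  by (simp_all add: uparam_def Let_def cis_cnj scaleR_conv_of_real[where 'a=complex])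

lemma of_real_sin_cos_1:
  "complex_of_real (cos x) * of_real (cos x) + of_real (sin x) * of_real (sin x) = 1"
  by (metis of_real_1 of_real_add of_real_mult power2_eq_square sin_cos_squared_add2)

lemma NN_scaleR_uparam: "NN (R *\<^sub>R uparam p) = of_real (R^2) * cis (p$4)"
proof -
  have "NN (R *\<^sub>R uparam p) = of_real (R^2) * cis (p$4) *
    (of_real (cos (p$1)) * of_real (cos (p$1)) * (cis (p$2) * cis (- (p$2)))
     + of_real (sin (p$1)) * of_real (sin (p$1)) * (cis (p$3) * cis (- (p$3))))"
    by (simp only: NN_def scaleR_uparam_nth power2_eq_square of_real_mult) (simp add: algebra_simps)
  then show ?thesis using of_real_sin_cos_1[of "p$1"] by (simp add: cis_mult)
qed

lemma has_vector_derivative_of_real_cos: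
  "((\<lambda>s. complex_of_real (cos (x + s * e))) has_vector_derivative - of_real (sin x * e)) (at 0)"
  unfolding of_real_minus[symmetric]
  by (rule has_vector_derivative_of_real)
    (auto intro!: derivative_eq_intros simp: has_real_derivative_iff_has_vector_derivative[symmetric])

lemma has_vector_derivative_of_real_sin:
  "((\<lambda>s. complex_of_real (sin (x + s * e))) has_vector_derivative of_real (cos x * e)) (at 0)"
  by (rule has_vector_derivative_of_real)
    (auto intro!: derivative_eq_intros simp: has_real_derivative_iff_has_vector_derivative[symmetric])

lemma has_vector_derivative_cis_affine:
  "((\<lambda>s. cis (x + s * e)) has_vector_derivative \<i> * of_real e * cis x) (at 0)"
proof -
  have "((\<lambda>z. exp (\<i> * (of_real x + z * of_real e))) has_field_derivative
      \<i> * of_real e * exp (\<i> * of_real x)) (at (of_real 0))"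
    by (auto intro!: derivative_eq_intros)
  from has_vector_derivative_real_field[OF this] show ?thesis
    by (simp add: cis_conv_exp o_def)
qed

lemma has_vector_derivative_cis_affine_minus:
  "((\<lambda>s. cis (- (x + s * e))) has_vector_derivative - \<i> * of_real e * cis (- x)) (at 0)"
  using has_vector_derivative_cis_affine[of "-x" "-e"] by simp

text \<open>The factor N(W)^2 cancels in dV / N(W)^2, which leaves the density sin cos of Haar
  measure in these coordinates.\<close>

lemma U2_jacobian:
  "det (\<chi> k j. pdiff (\<lambda>q. zc k (R *\<^sub>R uparam q)) p j)
     = - \<i> / 2 * NN (R *\<^sub>R uparam p) ^ 2 * of_real (sin (p$1) * cos (p$1))"
proof -
  \<comment> \<open>The phases and their inverses become independent symbols, so the determinant is
    a polynomial computation modulo a a' = 1, b b' = 1 and c^2 + s^2 = 1.\<close>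
  define c s a a' b b' e where abbr: "c = complex_of_real (cos (p$1))" "s = complex_of_real (sin (p$1))"
    "a = cis (p$2)" "a' = cis (- (p$2))" "b = cis (p$3)" "b' = cis (- (p$3))" "e = cis (p$4)"
  define d :: "4 \<Rightarrow> 4 \<Rightarrow> complex" where "d j i = of_real ((axis j 1 :: real^4) $ i)" for i j
  define D11 where "D11 j = of_real R * (c * (\<i> * d j 2 * a) - s * d j 1 * a)" for j
  define D12 where "D12 j = of_real R * (s * (\<i> * d j 3 * b') * e - c * d j 1 * b' * e - s * b' * (\<i> * d j 4 * e))" for j
  define D21 where "D21 j = of_real R * (s * (\<i> * d j 3 * b) + c * d j 1 * b)" for j
  define D22 where "D22 j = of_real R * (c * a' * (\<i> * d j 4 * e) - c * (\<i> * d j 2 * a') * e - s * d j 1 * a' * e)" for j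
  note dd = has_vector_derivative_of_real_cos has_vector_derivative_of_real_sin
    has_vector_derivative_cis_affine has_vector_derivative_cis_affine_minus
    has_vector_derivative_mult has_vector_derivative_minus has_vector_derivative_mult_right
  have 11: "((\<lambda>s. (R *\<^sub>R uparam (p + s *\<^sub>R axis j 1)) $ 1 $ 1) has_vector_derivative D11 j) (at 0)" for j
    unfolding scaleR_uparam_nth unfolding vector_add_component vector_scaleR_component real_scaleR_def D11_def d_def abbr
    by (rule has_vector_derivative_eq_rhs, (rule dd)+) (simp add: algebra_simps)
  have 12: "((\<lambda>s. (R *\<^sub>R uparam (p + s *\<^sub>R axis j 1)) $ 1 $ 2) has_vector_derivative D12 j) (at 0)" for j
    unfolding scaleR_uparam_nth unfolding vector_add_component vector_scaleR_component real_scaleR_def D12_def d_def abbr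
    by (rule has_vector_derivative_eq_rhs, (rule dd)+) (simp add: algebra_simps)
  have 21: "((\<lambda>s. (R *\<^sub>R uparam (p + s *\<^sub>R axis j 1)) $ 2 $ 1) has_vector_derivative D21 j) (at 0)" for j
    unfolding scaleR_uparam_nth unfolding vector_add_component vector_scaleR_component real_scaleR_def D21_def d_def abbr
    by (rule has_vector_derivative_eq_rhs, (rule dd)+) (simp add: algebra_simps)
  have 22: "((\<lambda>s. (R *\<^sub>R uparam (p + s *\<^sub>R axis j 1)) $ 2 $ 2) has_vector_derivative D22 j) (at 0)" for j
    unfolding scaleR_uparam_nth unfolding vector_add_component vector_scaleR_component real_scaleR_def D22_def d_def abbr
    by (rule has_vector_derivative_eq_rhs, (rule dd)+) (simp add: algebra_simps)
  have pd: "pdiff (\<lambda>q. zc k (R *\<^sub>R uparam q)) p j = 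
      (if k = 1 then (D11 j + D22 j) / 2
             else if k = 2 then \<i> * (D12 j + D21 j) / 2
             else if k = 3 then (D21 j - D12 j) / 2
             else \<i> * (D11 j - D22 j) / 2)" for k j
    unfolding pdiff_def zc_def
    by (rule vector_derivative_at)
      (auto simp del: vector_scaleR_component intro!: has_vector_derivative_divide has_vector_derivative_mult_right has_vector_derivative_add has_vector_derivative_diff 11 12 21 22)
  have rel: "a * a' = 1" "b * b' = 1" "c * c + s * s = 1"
    by (simp_all add: abbr cis_mult of_real_sin_cos_1)
  have N: "NN (R *\<^sub>R uparam p) = of_real R * of_real R * e"
    by (simp add: NN_scaleR_uparam abbr power2_eq_square)
  have ax: "d 1 1 = 1" "d 1 2 = 0" "d 1 3 = 0" "d 1 4 = 0" "d 2 1 = 0" "d 2 2 = 1" "d 2 3 = 0" "d 2 4 = 0"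
     "d 3 1 = 0" "d 3 2 = 0" "d 3 3 = 1" "d 3 4 = 0" "d 4 1 = 0" "d 4 2 = 0" "d 4 3 = 0" "d 4 4 = 1"
    by (simp_all add: d_def axis_def)
  have ii: "\<i> * (\<i> * x) = - x" for x by (simp add: mult.assoc[symmetric])
  \<comment> \<open>The passage from the matrix entries to the coordinates z^0, ..., z^3 is a
    constant change of rows; it contributes the factor 1/4.\<close>
  have rows: "det (\<chi> k j. pdiff (\<lambda>q. zc k (R *\<^sub>R uparam q)) p j) =
        det (\<chi> k j. if k = 1 then D11 j else if k = 2 then D12 j else if k = 3 then D21 j else D22 j) / 4"
      unfolding det_4 by (simp add: pd) (simp add: field_simps ii)
  have J: "det (\<chi> k j. if k = 1 then D11 j else if k = 2 then D12 j else if k = 3 then D21 j else D22 j)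
      = of_real R * of_real R * of_real R * of_real R * (- 2 * \<i>) * (s * c) * e * e * ((a * a') * (b * b') * (c * c + s * s))"
      unfolding det_4 by (simp add: D11_def D12_def D21_def D22_def ax) (simp add: algebra_simps ii)
  show ?thesis unfolding rows J rel N by (simp add: abbr power2_eq_square)
qed

text \<open>The density sin cos has total mass 4 pi^3 on the parameter box, so this is a probability
  average: Haar measure on the unitary group in coordinates.\<close>

definition avg :: "(real^4 \<Rightarrow> complex) \<Rightarrow> complex" where
  "avg g = integral (cbox pbox_lo pbox_hi) (\<lambda>p. g p * of_real (sin (p$1) * cos (p$1))) / (4 * of_real (pi^3))"

text \<open>Up to constants, all entries of \<open>R *\<^sub>R uparam p\<close> and all integer
  powers of its determinant have this form, and the form is closed under products.\<close>

definition trig_monom :: "nat \<Rightarrow> nat \<Rightarrow> int \<Rightarrow> int \<Rightarrow> int \<Rightarrow> real^4 \<Rightarrow> complex" where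
  "trig_monom i j m n k p = of_real (cos (p$1) ^ i * sin (p$1) ^ j) * cis (of_int m * p$2) * 
     cis (of_int n * p$3) * cis (of_int k * p$4)"

lemma continuous_trig_monom: "continuous_on UNIV (trig_monom i j m n k)"
  unfolding trig_monom_def cis_conv_exp by (intro continuous_intros)

lemma integral_cis_int:
  "integral {0..2*pi} (\<lambda>x. cis (of_int m * x)) = (if m = 0 then of_real (2 * pi) else 0)"
proof (cases "m = 0")
  case False
  have "((\<lambda>x. cis (of_int m * x)) has_integral 
      (cis (of_int m * (2*pi)) / (\<i> * of_int m) - cis (of_int m * 0) / (\<i> * of_int m))) {0..2*pi}"
  proof (rule fundamental_theorem_of_calculus)
    fix x assume "x \<in> {0..2*pi}"
    have "((\<lambda>z. exp (\<i> * of_int m * z) / (\<i> * of_int m)) has_field_derivative exp (\<i> * of_int m * of_real x)) (at (of_real x))"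
      using False by (auto intro!: derivative_eq_intros)
    from has_vector_derivative_real_field[OF this]
    show "((\<lambda>x. cis (of_int m * x) / (\<i> * of_int m)) has_vector_derivative cis (of_int m * x)) (at x within {0..2*pi})"
      by (simp add: cis_conv_exp o_def mult.assoc)
  qed simp
  moreover have "cis (of_int m * (2*pi)) = 1" 
    by (metis cis_multiple_2pi mult.commute Ints_of_int)
  ultimately show ?thesis using False by (simp add: has_integral_iff)
qed (simp add: scaleR_conv_of_real)

definition wallis :: "nat \<Rightarrow> nat \<Rightarrow> complex" where
  "wallis i j = integral {0..pi/2} (\<lambda>t. of_real (cos t ^ i * sin t ^ j))"

text \<open>The three circle integrals require zero frequencies. The factor 2 is (2 pi)^3 / (4
  pi^3), and the density sin cos raises both exponents by one.\<close>

lemma avg_trig_monom: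
  "avg (trig_monom i j m n k) = (if m = 0 \<and> n = 0 \<and> k = 0 then 2 * wallis (Suc i) (Suc j) else 0)"
proof -
  define f :: "4 \<Rightarrow> real \<Rightarrow> complex" where 
    "f l x = (if l = 1 then of_real (cos x ^ Suc i * sin x ^ Suc j) else if l = 2 then cis (of_int m * x)
       else if l = 3 then cis (of_int n * x) else cis (of_int k * x))" for l x
  have fs: "f 1 = (\<lambda>x. of_real (cos x ^ Suc i * sin x ^ Suc j))" "f 2 = (\<lambda>x. cis (of_int m * x))"
     "f 3 = (\<lambda>x. cis (of_int n * x))" "f 4 = (\<lambda>x. cis (of_int k * x))"
    by (simp_all add: f_def fun_eq_iff)
  have prod4: "prod g UNIV = g 1 * g 2 * g 3 * g 4" for g :: "4 \<Rightarrow> complex"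
    unfolding UNIV_4 by (simp add: mult.assoc)
  have "continuous_on UNIV (f 1)" "continuous_on UNIV (f 2)" "continuous_on UNIV (f 3)" "continuous_on UNIV (f 4)" 
    unfolding fs cis_conv_exp by (intro continuous_intros)+
  then have c: "continuous_on UNIV (f l)" for l
    using exhaust_4[of l] by blast
  have "integral (cbox pbox_lo pbox_hi) (\<lambda>p. trig_monom i j m n k p * of_real (sin (p$1) * cos (p$1)))
     = integral (cbox pbox_lo pbox_hi) (\<lambda>p. \<Prod>l\<in>UNIV. f l (p$l))"
    unfolding prod4 fs trig_monom_def by (simp add: mult_ac)
  also have "\<dots> = wallis (Suc i) (Suc j) * integral {0..2*pi} (\<lambda>x. cis (of_int m * x)) *
     integral {0..2*pi} (\<lambda>x. cis (of_int n * x)) * integral {0..2*pi} (\<lambda>x. cis (of_int k * x))"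
    unfolding integral_cbox_prod[OF c] unfolding prod4 fs
    by (simp add: pbox_lo_def pbox_hi_def vector_4 wallis_def)
  finally show ?thesis
    unfolding avg_def by (simp add: integral_cis_int power3_eq_cube)
qed

section \<open>Beta integrals of powers of cosine and sine\<close>

lemma wallis_integrable: "(\<lambda>t. complex_of_real (cos t ^ i * sin t ^ j)) integrable_on {0..pi/2}"
  by (intro integrable_continuous_interval continuous_intros)

lemma has_real_derivative_cos_sin_power:
  "((\<lambda>t. cos t ^ Suc m * sin t ^ Suc n) has_real_derivative
     real (Suc n) * (cos t ^ (m+2) * sin t ^ n) - real (Suc m) * (cos t ^ m * sin t ^ (n+2))) (at t within A)"
  by (rule DERIV_cong[OF DERIV_mult[OF DERIV_power_Suc[OF has_field_derivative_at_within[OF DERIV_cos]]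
        DERIV_power_Suc[OF has_field_derivative_at_within[OF DERIV_sin]]]])
    (simp add: algebra_simps)

text \<open>Integrate the derivative of cos^(2a+2) sin^(2b+2), a function that vanishes at both ends
  of the interval.\<close>

lemma wallis_Suc_right: "of_nat (Suc a) * wallis (2*a+1) (2*b+3) = of_nat (Suc b) * wallis (2*a+3) (2*b+1)"
proof -
  have 1: "((\<lambda>t. of_nat (2*Suc b) * complex_of_real (cos t ^ (2*a+3) * sin t ^ (2*b+1)) - of_nat (2*Suc a) * complex_of_real (cos t ^ (2*a+1) * sin t ^ (2*b+3)))
     has_integral (of_real (cos (pi/2) ^ (2*a+2) * sin (pi/2) ^ (2*b+2)) - of_real (cos 0 ^ (2*a+2) * sin 0 ^ (2*b+2)))) {0..pi/2}"
  proof (rule fundamental_theorem_of_calculus)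
    fix t assume "t \<in> {0..pi/2}"
    have "((\<lambda>t. cos t ^ (2*a+2) * sin t ^ (2*b+2)) has_real_derivative
       real (2*Suc b) * (cos t ^ (2*a+3) * sin t ^ (2*b+1)) - real (2*Suc a) * (cos t ^ (2*a+1) * sin t ^ (2*b+3))) (at t within {0..pi/2})"
    proof -
      have e: "2*x+2 = Suc (2*x+1)" "2*x+3 = 2*x+1+2" "2 * Suc x = Suc (2*x+1)" for x :: nat by simp_all
      show ?thesis unfolding e by (rule has_real_derivative_cos_sin_power)
    qed
    from has_vector_derivative_of_real[OF this]
    show "((\<lambda>x. complex_of_real (cos x ^ (2 * a + 2) * sin x ^ (2 * b + 2))) has_vector_derivative
          of_nat (2 * Suc b) * complex_of_real (cos t ^ (2*a+3) * sin t ^ (2*b+1)) - of_nat (2 * Suc a) * complex_of_real (cos t ^ (2*a+1) * sin t ^ (2*b+3)))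
          (at t within {0..pi/2})"
      unfolding of_real_diff of_real_mult[of "real _"] of_real_of_nat_eq .
  qed simp
  have 2: "((\<lambda>t. of_nat (2*Suc b) * complex_of_real (cos t ^ (2*a+3) * sin t ^ (2*b+1)) - of_nat (2*Suc a) * complex_of_real (cos t ^ (2*a+1) * sin t ^ (2*b+3)))
     has_integral (of_nat (2*Suc b) * wallis (2*a+3) (2*b+1) - of_nat (2*Suc a) * wallis (2*a+1) (2*b+3))) {0..pi/2}"
    unfolding wallis_def
    by (intro has_integral_diff has_integral_mult_right integrable_integral wallis_integrable)
  have "of_nat (2*Suc b) * wallis (2*a+3) (2*b+1) - of_nat (2*Suc a) * wallis (2*a+1) (2*b+3) = 0"
    using has_integral_unique[OF 2 1] by simp
  then show ?thesis
    unfolding of_nat_mult right_diff_distrib[symmetric] mult.assoc by (simp del: of_nat_Suc)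
qed

text \<open>This is the Beta value B(a + 1, b + 1). The induction on b trades two powers of sine for
  two of cosine, which raises a; hence a is kept arbitrary.\<close>

lemma wallis_odd: "2 * wallis (2*a+1) (2*b+1) = fact a * fact b / fact (a+b+1)"
proof (induction b arbitrary: a)
  case 0
  have "((\<lambda>t. complex_of_real (cos t ^ (2*a+1) * sin t ^ 1))
     has_integral (of_real (- (cos (pi/2) ^ (2*a+2)) / (2*a+2)) - of_real (- (cos 0 ^ (2*a+2)) / (2*a+2)))) {0..pi/2}"
  proof (rule fundamental_theorem_of_calculus)
    fix t assume "t \<in> {0..pi/2}"
    have "((\<lambda>t. - (cos t ^ Suc (2*a+1)) / (2*a+2)) has_real_derivative (cos t ^ (2*a+1) * sin t ^ 1)) (at t within {0..pi/2})"
      by (auto intro!: derivative_eq_intros simp del: power_Suc)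
    then have "((\<lambda>t. - (cos t ^ (2*a+2)) / (2*a+2)) has_real_derivative (cos t ^ (2*a+1) * sin t ^ 1)) (at t within {0..pi/2})"
      by simp
    from has_vector_derivative_of_real[OF this]
    show "((\<lambda>t. complex_of_real (- (cos t ^ (2*a+2)) / (2*a+2))) has_vector_derivative
          complex_of_real (cos t ^ (2*a+1) * sin t ^ 1)) (at t within {0..pi/2})" .
  qed simp
  then have "wallis (2*a+1) (2*0+1) = 1 / (2 * of_nat a + 2)"
    unfolding wallis_def by (simp add: has_integral_iff)
  moreover have "2 * of_nat a + 2 = 2 * (of_nat (Suc a) :: complex)" by simp
  ultimately show ?case by (simp del: of_nat_Suc)
next
  case (Suc b)
  have "of_nat (Suc a) * (2 * wallis (2*a+1) (2*Suc b+1)) = of_nat (Suc b) * (2 * wallis (2*Suc a+1) (2*b+1))"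
    using wallis_Suc_right[of a b] by (simp add: numeral_3_eq_3)
  also have "\<dots> = of_nat (Suc b) * (fact (Suc a) * fact b / fact (Suc a+b+1))"
    by (simp only: Suc.IH)
  also have "\<dots> = of_nat (Suc a) * (fact a * fact (Suc b) / fact (a+Suc b+1))"
    by (simp add: field_simps)
  finally show ?case
    unfolding mult_cancel_left by (simp del: of_nat_Suc)
qed

lemma avg_trig_monom_even:
  "avg (trig_monom (2*a) (2*b) 0 0 0) = fact a * fact b / fact (a+b+1)"
  using wallis_odd[of a b] by (simp add: avg_trig_monom)

lemma avg_1: "avg (\<lambda>p. 1) = 1"
  using avg_trig_monom_even[of 0 0] by (simp add: trig_monom_def[abs_def])

text \<open>The constants cancel: (i / (2 pi^3)) (- i / 2) (4 pi^3) = 1. The same Jacobian gives dV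
  / N(W)^2 the integral - 2 pi^3 i, so the parametrisation already has the prescribed orientation
  and the sign is 1.\<close>

lemma IR_eq_avg:
  assumes "R > 0"
  shows "IR R f Z1 Z2 = avg (\<lambda>p. let W = R *\<^sub>R uparam p in
      f W * NN W ^ 2 / (NN (W - Z1) * NN (W - Z2)))"
proof -
  have raw: "rawU2int R g = - \<i> / 2 * (4 * of_real (pi^3)) * avg (\<lambda>p. g (R *\<^sub>R uparam p) * NN (R *\<^sub>R uparam p) ^ 2)" for g
    unfolding rawU2int_def avg_def U2_jacobian integral_mult_right[symmetric]
    by (simp add: mult_ac)
  have nz: "NN (R *\<^sub>R uparam p) \<noteq> 0" for p 
    using assms by (simp add: NN_scaleR_uparam)
  have "rawU2int R (\<lambda>W. inverse (NN W ^ 2)) = - \<i> / 2 * (4 * of_real (pi^3))"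
    unfolding raw using nz by (simp add: avg_1)
  then have "orientU2 R = 1"
    by (simp add: orientU2_def)
  then show ?thesis
    unfolding IR_def U2int_def raw Let_def by (simp add: mult_ac)
qed

section \<open>Linearity of the average, and trigonometric polynomials graded by the circle
  action\<close>

lemma avg_add:
  assumes "continuous_on UNIV f" "continuous_on UNIV g"
  shows "avg (\<lambda>p. f p + g p) = avg f + avg g"
proof -
  have c: "(\<lambda>p. h p * of_real (sin (p$1) * cos (p$1))) integrable_on cbox pbox_lo pbox_hi" 
    if "continuous_on UNIV h" for h :: "real^4 \<Rightarrow> complex"
    by (intro integrable_continuous continuous_intros continuous_on_subset[OF that]) auto
  show ?thesis
    unfolding avg_def distrib_right integral_add[OF c[OF assms(1)] c[OF assms(2)]]
    by (simp add: add_divide_distrib)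
qed

lemma avg_cmult: "avg (\<lambda>p. c * f p) = c * avg f"
  by (simp add: avg_def mult.assoc)

lemma avg_0 [simp]: "avg (\<lambda>p. 0) = 0"
  by (simp add: avg_def)

lemma avg_sum:
  assumes "finite A" "\<And>i. i \<in> A \<Longrightarrow> continuous_on UNIV (f i)"
  shows "avg (\<lambda>p. \<Sum>i\<in>A. f i p) = (\<Sum>i\<in>A. avg (f i))"
  using assms
proof (induction A rule: finite_induct)
  case (insert a A)
  have "avg (\<lambda>p. f a p + (\<Sum>i\<in>A. f i p)) = avg (f a) + avg (\<lambda>p. \<Sum>i\<in>A. f i p)"
    by (intro avg_add continuous_on_sum insert.prems) auto
  with insert show ?case by simp
qed simp

text \<open>The degree records the behaviour under the scalar action of the circle:
  for functions of \<^term>\<open>uparam p\<close>, multiplication by a phase shifts the angles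
  by \<open>(1, 1, 2)\<close>.\<close>

inductive trigpoly :: "int \<Rightarrow> (real^4 \<Rightarrow> complex) \<Rightarrow> bool" where
  monom: "trigpoly (m + n + 2 * k) (\<lambda>p. c * trig_monom i j m n k p)"
| add: "trigpoly m f \<Longrightarrow> trigpoly m g \<Longrightarrow> trigpoly m (\<lambda>p. f p + g p)"

lemma trigpoly_continuous: "trigpoly m f \<Longrightarrow> continuous_on UNIV f"
  by (induction rule: trigpoly.induct) (auto intro!: continuous_intros continuous_trig_monom)

text \<open>If m + n + 2k is nonzero, then so is one of the three frequencies, and the integral over
  that angle vanishes. This is the concrete form of invariance under scalar unitary
  matrices.\<close>

lemma trigpoly_avg_eq_0: "trigpoly m f \<Longrightarrow> m \<noteq> 0 \<Longrightarrow> avg f = 0"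
proof (induction rule: trigpoly.induct)
  case (monom m n k c i j)
  then show ?case by (auto simp: avg_cmult avg_trig_monom)
next
  case (add m f g)
  then show ?case by (simp add: avg_add trigpoly_continuous)
qed

lemma trigpoly_0: "trigpoly m (\<lambda>p. 0)"
  using trigpoly.monom[of m 0 0 0 0 0] by simp

lemma trigpoly_const: "trigpoly 0 (\<lambda>p. c)"
  using trigpoly.monom[of 0 0 0 c 0 0] by (simp add: trig_monom_def)

lemma trig_monom_mult:
  "trig_monom i j m n k p * trig_monom i' j' m' n' k' p = trig_monom (i + i') (j + j') (m + m') (n + n') (k + k') p"
  by (simp add: trig_monom_def power_add cis_mult[symmetric] distrib_right)

lemma trigpoly_mult:
  assumes "trigpoly m f" "trigpoly n g"
  shows "trigpoly (m + n) (\<lambda>p. f p * g p)"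
  using assms(1)
proof (induction rule: trigpoly.induct)
  case (monom m1 n1 k1 c1 i1 j1)
  show ?case using assms(2)
  proof (induction rule: trigpoly.induct)
    case (monom m2 n2 k2 c2 i2 j2)
    show ?case 
      using trigpoly.monom[of "m1 + m2" "n1 + n2" "k1 + k2" "c1 * c2" "i1 + i2" "j1 + j2"]
      by (simp add: trig_monom_mult[symmetric] mult_ac distrib_left add_ac)
  next
    case (add m f g)
    then show ?case by (simp add: distrib_left trigpoly.add)
  qed
next
  case (add m f g)
  then show ?case by (simp add: distrib_right trigpoly.add)
qed

lemma trigpoly_cmult: "trigpoly m f \<Longrightarrow> trigpoly m (\<lambda>p. c * f p)"
  using trigpoly_mult[OF trigpoly_const] by fastforce

lemma trigpoly_power: "trigpoly m f \<Longrightarrow> trigpoly (int n * m) (\<lambda>p. f p ^ n)"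
proof (induction n)
  case (Suc n)
  then show ?case using trigpoly_mult[of m f "int n * m" "\<lambda>p. f p ^ n"] by (simp add: distrib_right)
qed (simp add: trigpoly_const)

lemma trigpoly_sum:
  assumes "finite A" "\<And>i. i \<in> A \<Longrightarrow> trigpoly m (f i)"
  shows "trigpoly m (\<lambda>p. \<Sum>i\<in>A. f i p)"
  using assms by (induction A rule: finite_induct) (auto simp: trigpoly_0 intro: trigpoly.add)

lemma trigpoly_scaleR_uparam:
  "trigpoly 1 (\<lambda>p. (R *\<^sub>R uparam p) $ i $ j)"
proof -
  have "trigpoly 1 (\<lambda>p. (R *\<^sub>R uparam p) $ 1 $ 1)"
    using trigpoly.monom[of 1 0 0 "of_real R" 1 0] by (simp add: scaleR_uparam_nth trig_monom_def del: vector_scaleR_component)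
  moreover have "trigpoly 1 (\<lambda>p. (R *\<^sub>R uparam p) $ 1 $ 2)"
    using trigpoly.monom[of 0 "-1" 1 "- of_real R" 0 1] by (simp add: scaleR_uparam_nth trig_monom_def del: vector_scaleR_component)
  moreover have "trigpoly 1 (\<lambda>p. (R *\<^sub>R uparam p) $ 2 $ 1)"
    using trigpoly.monom[of 0 1 0 "of_real R" 0 1] by (simp add: scaleR_uparam_nth trig_monom_def del: vector_scaleR_component)
  moreover have "trigpoly 1 (\<lambda>p. (R *\<^sub>R uparam p) $ 2 $ 2)"
    using trigpoly.monom[of "-1" 0 1 "of_real R" 1 0] by (simp add: scaleR_uparam_nth trig_monom_def del: vector_scaleR_component)
  ultimately show ?thesis
    using exhaust_2[of i] exhaust_2[of j] by auto
qed

lemma cis_powi: "cis x powi k = cis (of_int k * x)"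
  by (cases k) (auto simp: power_int_def Complex.DeMoivre cis_cnj algebra_simps)

lemma trigpoly_NN_powi:
  "trigpoly (2 * k) (\<lambda>p. NN (R *\<^sub>R uparam p) powi k)"
  using trigpoly.monom[of 0 0 k "of_real (R^2) powi k" 0 0] 
  by (simp add: NN_scaleR_uparam trig_monom_def power_int_mult_distrib cis_powi)

lemma NN_scaleR_uparam_nonzero: "R > 0 \<Longrightarrow> NN (R *\<^sub>R uparam p) \<noteq> 0"
  by (simp add: NN_scaleR_uparam)

subsection \<open>Moments of linear forms\<close>

definition lin :: "mat2 \<Rightarrow> mat2 \<Rightarrow> complex" where
  "lin A W = A$1$1 * W$1$1 + A$1$2 * W$1$2 + A$2$1 * W$2$1 + A$2$2 * W$2$2"

lemma trigpoly_lin: "trigpoly 1 (\<lambda>p. lin A (R *\<^sub>R uparam p))"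
  unfolding lin_def by (intro trigpoly.add trigpoly_cmult trigpoly_scaleR_uparam)

text \<open>Two entries of W carry a cosine and two a sine. One binomial expansion separates these
  groups and one more in each group isolates the entries, so that all frequencies become explicit.
  The power N(W)^(-M) cancels R^(2M).\<close>

lemma lin_power_expand:
  assumes "R > 0"
  shows "lin A (R *\<^sub>R uparam p) ^ (2*M) * NN (R *\<^sub>R uparam p) powi (- int M) =
   (\<Sum>i\<le>2*M. \<Sum>j\<le>i. \<Sum>k\<le>2*M-i. 
      (of_nat ((2*M) choose i) * of_nat (i choose j) * of_nat ((2*M-i) choose k) *
        A$1$1^j * A$2$2^(i-j) * A$2$1^k * (- A$1$2)^(2*M-i-k)) *
      trig_monom i (2*M-i) (2 * int j - int i) (2 * int k - int (2*M-i)) (int M - int j - int k) p)"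
proof -
  define c s a a' b b' e where abbr: "c = complex_of_real (cos (p$1))" "s = complex_of_real (sin (p$1))"
    "a = cis (p$2)" "a' = cis (- (p$2))" "b = cis (p$3)" "b' = cis (- (p$3))" "e = cis (p$4)"
  have "lin A (R *\<^sub>R uparam p) = of_real R * (c * (A$1$1 * a + A$2$2 * (a' * e)) + s * (A$2$1 * b + (- A$1$2) * (b' * e)))"
    unfolding lin_def scaleR_uparam_nth abbr by (simp add: algebra_simps)
  then have "lin A (R *\<^sub>R uparam p) ^ (2*M) * NN (R *\<^sub>R uparam p) powi (- int M) =
     (c * (A$1$1 * a + A$2$2 * (a' * e)) + s * (A$2$1 * b + (- A$1$2) * (b' * e))) ^ (2*M) * e powi (- int M)"
    using assms by (simp add: NN_scaleR_uparam abbr power_mult_distrib power_int_mult_distrib power_int_minus power_mult)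
  also have "\<dots> = (\<Sum>i\<le>2*M. (of_nat ((2*M) choose i) * (c * (A$1$1 * a + A$2$2 * (a' * e))) ^ i *
      (s * (A$2$1 * b + (- A$1$2) * (b' * e))) ^ (2*M-i)) * e powi (- int M))"
    unfolding binomial_ring sum_distrib_right ..
  also have "\<dots> = (\<Sum>i\<le>2*M. \<Sum>j\<le>i. \<Sum>k\<le>2*M-i. 
      (of_nat ((2*M) choose i) * of_nat (i choose j) * of_nat ((2*M-i) choose k) *
        A$1$1^j * A$2$2^(i-j) * A$2$1^k * (- A$1$2)^(2*M-i-k)) *
      (c ^ i * s ^ (2*M-i) * (a ^ j * a' ^ (i-j)) * (b ^ k * b' ^ (2*M-i-k)) * (e ^ (i-j) * e ^ (2*M-i-k) * e powi (- int M))))"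
    unfolding power_mult_distrib binomial_ring sum_distrib_left sum_distrib_right
    by (rule sum.cong[OF refl], subst sum.swap, (rule sum.cong[OF refl])+) (simp add: mult_ac)
  also have "\<dots> = (\<Sum>i\<le>2*M. \<Sum>j\<le>i. \<Sum>k\<le>2*M-i. 
      (of_nat ((2*M) choose i) * of_nat (i choose j) * of_nat ((2*M-i) choose k) *
        A$1$1^j * A$2$2^(i-j) * A$2$1^k * (- A$1$2)^(2*M-i-k)) *
      trig_monom i (2*M-i) (2 * int j - int i) (2 * int k - int (2*M-i)) (int M - int j - int k) p)"
  proof (intro sum.cong refl arg_cong2[where f = "(*)"])
    fix i j k assume ijk: "i \<in> {..2*M}" "j \<in> {..i}" "k \<in> {..2*M-i}"
    have 1: "cis x ^ j * cis (- x) ^ (i - j) = cis (of_int (2 * int j - int i) * x)" if "j \<le> i" for i j x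
      using that by (simp add: Complex.DeMoivre cis_mult algebra_simps of_nat_diff)
    have 3: "a ^ j * a' ^ (i-j) = cis (of_int (2 * int j - int i) * p$2)"
      unfolding abbr using 1[of j i] ijk by blast
    have 4: "b ^ k * b' ^ (2*M-i-k) = cis (of_int (2 * int k - int (2*M-i)) * p$3)"
      unfolding abbr using 1[of k "2*M-i"] ijk by blast
    have 2: "e ^ (i-j) * e ^ (2*M-i-k) * e powi (- int M) = cis (of_int (int M - int j - int k) * p$4)"
      using ijk unfolding abbr cis_powi Complex.DeMoivre cis_mult by (simp add: of_nat_diff algebra_simps)
    show "c ^ i * s ^ (2*M-i) * (a ^ j * a' ^ (i-j)) * (b ^ k * b' ^ (2*M-i-k)) * (e ^ (i-j) * e ^ (2*M-i-k) * e powi (- int M))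
       = trig_monom i (2*M-i) (2 * int j - int i) (2 * int k - int (2*M-i)) (int M - int j - int k) p"
      unfolding 2 3 4 trig_monom_def abbr(1,2) by simp
  qed
  finally show ?thesis .
qed

text \<open>Only terms with equal powers of w_11 and w_22, and equal powers of w_12 and w_21, have
  zero frequencies. Their Beta values turn the product of three binomial coefficients into M choose
  j times the Catalan number, and what remains is the binomial expansion of (det A)^M.\<close>

lemma avg_lin_power:
  assumes "R > 0"
  shows "avg (\<lambda>p. lin A (R *\<^sub>R uparam p) ^ (2*M) * NN (R *\<^sub>R uparam p) powi (- int M))
    = fact (2*M) / (fact M * fact (M+1)) * NN A ^ M"
proof -
  define G where "G i j k = of_nat ((2*M) choose i) * of_nat (i choose j) * of_nat ((2*M-i) choose k) *
        A$1$1^j * A$2$2^(i-j) * A$2$1^k * (- A$1$2)^(2*M-i-k)" for i j k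
  \<comment> \<open>The values of the averages. The two conditions force j + k = M, so the third
    frequency is then zero as well.\<close>
  define V :: "nat \<Rightarrow> nat \<Rightarrow> nat \<Rightarrow> complex" where 
    "V i j k = (if i = 2*j \<and> 2*M - i = 2*k then fact j * fact k / fact (j+k+1) else 0)" for i j k
  have "avg (\<lambda>p. lin A (R *\<^sub>R uparam p) ^ (2*M) * NN (R *\<^sub>R uparam p) powi (- int M))
    = (\<Sum>i\<le>2*M. \<Sum>j\<le>i. \<Sum>k\<le>2*M-i. G i j k *
      avg (trig_monom i (2*M-i) (2 * int j - int i) (2 * int k - int (2*M-i)) (int M - int j - int k)))"
    unfolding lin_power_expand[OF assms] G_def[symmetric]
    by (simp add: avg_sum avg_cmult continuous_on_sum continuous_on_mult continuous_on_const continuous_trig_monom)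
  also have "\<dots> = (\<Sum>i\<le>2*M. \<Sum>j\<le>i. \<Sum>k\<le>2*M-i. G i j k * V i j k)"
  proof (intro sum.cong refl arg_cong2[where f = "(*)"])
    fix i j k assume ijk: "i \<in> {..2*M}" "j \<in> {..i}" "k \<in> {..2*M-i}"
    show "avg (trig_monom i (2*M-i) (2 * int j - int i) (2 * int k - int (2*M-i)) (int M - int j - int k)) = V i j k"
    proof (cases "i = 2*j \<and> 2*M - i = 2*k")
      case True
      have z: "2 * int j - int i = 0" "2 * int k - int (2*M-i) = 0" "int M - int j - int k = 0"
        using True ijk by auto
      show ?thesis unfolding z V_def if_P[OF True] unfolding conjunct1[OF True] conjunct2[OF True, unfolded conjunct1[OF True]]
          by (rule avg_trig_monom_even)
    next
      case False
      then have "2 * int j - int i \<noteq> 0 \<or> 2 * int k - int (2*M-i) \<noteq> 0" by linarith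
      with False show ?thesis by (auto simp: V_def avg_trig_monom)
    qed
  qed
  also have "\<dots> = (\<Sum>(i,j,k)\<in>(SIGMA i:{..2*M}. SIGMA j:{..i}. {..2*M-i}). G i j k * V i j k)"
    by (simp add: sum.Sigma)
  also have "\<dots> = (\<Sum>(i,j,k)\<in>(\<lambda>j. (2*j, j, M-j)) ` {..M}. G i j k * V i j k)"
  proof (rule sum.mono_neutral_right)
    show "\<forall>t\<in>(SIGMA i:{..2*M}. SIGMA j:{..i}. {..2*M-i}) - (\<lambda>j. (2*j, j, M-j)) ` {..M}.
        (case t of (i,j,k) \<Rightarrow> G i j k * V i j k) = 0"
    proof safe
      fix i j k assume "i \<le> 2*M" "j \<le> i" "k \<le> 2*M - i" "(i, j, k) \<notin> (\<lambda>j. (2*j, j, M-j)) ` {..M}"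
      then have "\<not> (i = 2*j \<and> 2*M - i = 2*k)" by (auto simp: image_iff)
      then show "G i j k * V i j k = 0" unfolding V_def by auto
    qed
  qed auto
  also have "\<dots> = (\<Sum>j\<le>M. G (2*j) j (M-j) * V (2*j) j (M-j))"
    by (subst sum.reindex) (auto simp: inj_on_def)
  also have "\<dots> = (\<Sum>j\<le>M. fact (2*M) / (fact M * fact (M+1)) * (of_nat (M choose j) * (A$1$1 * A$2$2)^j * (- (A$1$2 * A$2$1))^(M-j)))"
  proof (rule sum.cong[OF refl])
    fix j assume "j \<in> {..M}"
    then have j: "j \<le> M" by simp
    define k where "k = M - j"
    have M: "M = j + k" and d: "2*M - 2*j = 2*k" "2*k - k = k" "2*j-j = j" using j by (auto simp: k_def)
    have f: "(fact n :: complex) \<noteq> 0" for n by simp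
    have e1: "of_nat ((2*M) choose (2*j)) * (fact (2*j) * fact (2*k)) = (fact (2*M) :: complex)"
      using j d(1) by (simp add: binomial_fact)
    have e2: "of_nat ((2*l) choose l) * (fact l * fact l) = (fact (2*l) :: complex)" for l
      by (simp add: binomial_fact)
    have e3: "of_nat (M choose j) * (fact j * fact k) = (fact M :: complex)"
      using j by (simp add: binomial_fact k_def)
    have X: "of_nat ((2*M) choose (2*j)) * of_nat ((2*j) choose j) * of_nat ((2*k) choose k) * (fact j * fact k) * (fact j * fact k) = (fact (2*M) :: complex)"
      using e1 unfolding e2[of j, symmetric] e2[of k, symmetric] by (simp only: mult_ac)
    have "of_nat ((2*M) choose (2*j)) * of_nat ((2*j) choose j) * of_nat ((2*k) choose k) * (fact j * fact k) * (fact M * fact (M+1))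
       = fact (2*M) * of_nat (M choose j) * (fact (M+1) :: complex)"
      unfolding X[symmetric] e3[symmetric] by (simp only: mult_ac)
    then have c: "of_nat ((2*M) choose (2*j)) * of_nat ((2*j) choose j) * of_nat ((2*k) choose k) * (fact j * fact k / fact (M+1)) 
       = fact (2*M) / (fact M * fact (M+1)) * (of_nat (M choose j) :: complex)"
      using f[of M] f[of "M+1"] by (simp add: divide_simps mult_ac del: fact_Suc One_nat_def add_Suc_right Suc_eq_plus1_left)
    have GV: "G (2*j) j (M-j) * V (2*j) j (M-j) = (of_nat ((2*M) choose (2*j)) * of_nat ((2*j) choose j) * of_nat ((2*k) choose k) * (fact j * fact k / fact (M+1))) *
       ((A$1$1 * A$2$2)^j * (- (A$1$2 * A$2$1))^k)"
      using M by (simp add: G_def V_def k_def[symmetric] d power_mult_distrib power_minus[of "_ * _"] power_minus[of "A$1$2"])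
    show "G (2*j) j (M-j) * V (2*j) j (M-j) = fact (2*M) / (fact M * fact (M+1)) * (of_nat (M choose j) * (A$1$1 * A$2$2)^j * (- (A$1$2 * A$2$1))^(M-j))"
      unfolding GV c unfolding k_def by (simp only: mult_ac)
  qed
  also have "\<dots> = fact (2*M) / (fact M * fact (M+1)) * NN A ^ M"
    unfolding sum_distrib_left[symmetric] binomial_ring[symmetric] NN_def by simp
  finally show ?thesis .
qed

text \<open>Two polynomials in s agree at every s, hence coefficientwise. In this way the moments of
  a pencil \<open>s * X p + Y p\<close> determine the mixed moments of X and Y.\<close>

lemma avg_binomial_coeff:
  assumes X: "continuous_on UNIV X" and Y: "continuous_on UNIV Y" and G: "continuous_on UNIV G"
    and eq: "\<And>s. avg (\<lambda>p. (s * X p + Y p) ^ n * G p) = (\<Sum>i\<le>n. c i * s ^ i)"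
    and i: "i \<le> n"
  shows "of_nat (n choose i) * avg (\<lambda>p. X p ^ i * Y p ^ (n - i) * G p) = c i"
proof -
  have "(\<Sum>i\<le>n. c i * s ^ i) = (\<Sum>i\<le>n. (of_nat (n choose i) * avg (\<lambda>p. X p ^ i * Y p ^ (n - i) * G p)) * s ^ i)" for s
  proof -
    have "(\<Sum>i\<le>n. c i * s ^ i) = avg (\<lambda>p. \<Sum>i\<le>n. (of_nat (n choose i) * s ^ i) * (X p ^ i * Y p ^ (n - i) * G p))"
      unfolding eq[symmetric] binomial_ring sum_distrib_right power_mult_distrib
      by (rule arg_cong[where f = avg]) (simp add: mult_ac)
    also have "\<dots> = (\<Sum>i\<le>n. (of_nat (n choose i) * s ^ i) * avg (\<lambda>p. X p ^ i * Y p ^ (n - i) * G p))"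
      by (subst avg_sum) (auto simp: avg_cmult intro!: continuous_intros X Y G)
    finally show ?thesis by (simp add: mult_ac)
  qed
  then have "\<forall>i\<le>n. c i = of_nat (n choose i) * avg (\<lambda>p. X p ^ i * Y p ^ (n - i) * G p)"
    by (intro polyfun_eq_coeffs[THEN iffD1]) blast
  with i show ?thesis by simp
qed

lemma avg_binomial_coeff_0:
  assumes "continuous_on UNIV X" "continuous_on UNIV Y" "continuous_on UNIV G"
    and "\<And>s. avg (\<lambda>p. (s * X p + Y p) ^ n * G p) = 0"
    and "i \<le> n"
  shows "avg (\<lambda>p. X p ^ i * Y p ^ (n - i) * G p) = 0"
  using avg_binomial_coeff[OF assms(1-3), of n "\<lambda>_. 0" i] assms(4,5) by simp

text \<open>The row vector (s, 1) W. Its two entries are the linear forms in the contour integral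
  for t^l_{nm}, with s as the generating variable.\<close>

definition frow :: "complex \<Rightarrow> mat2 \<Rightarrow> 2 \<Rightarrow> complex" where
  "frow s W j = s * W$1$j + W$2$j"

definition polar :: "mat2 \<Rightarrow> mat2 \<Rightarrow> complex" where
  "polar W Z = W$1$1 * Z$2$2 + W$2$2 * Z$1$1 - W$1$2 * Z$2$1 - W$2$1 * Z$1$2"

lemma NN_diff: "NN (W - Z) = NN W - polar W Z + NN Z"
  by (simp add: NN_def polar_def algebra_simps)

lemma trigpoly_frow: "trigpoly 1 (\<lambda>p. frow s (R *\<^sub>R uparam p) j)"
  unfolding frow_def by (intro trigpoly.add trigpoly_cmult trigpoly_scaleR_uparam)

lemma polar_eq_lin: "polar W Z = lin (vector [vector [Z$2$2, - Z$2$1], vector [- Z$1$2, Z$1$1]]) W"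
  by (simp add: polar_def lin_def)

lemma trigpoly_polar: "trigpoly 1 (\<lambda>p. polar (R *\<^sub>R uparam p) Z)"
  unfolding polar_eq_lin by (rule trigpoly_lin)

lemmas trigpoly_continuous_intros = trigpoly_frow[THEN trigpoly_continuous] trigpoly_polar[THEN trigpoly_continuous]
  trigpoly_NN_powi[THEN trigpoly_continuous]

text \<open>The coefficient of t in the determinant is the form (s, 1) Z (y, 1)^T, that is, the very
  form being averaged, evaluated at Z instead of W. This is the source of the reproducing
  property.\<close>

lemma avg_rank1_polar:
  assumes "R > 0"
  shows "avg (\<lambda>p. (t * (y * frow s (R *\<^sub>R uparam p) 1 + frow s (R *\<^sub>R uparam p) 2) + polar (R *\<^sub>R uparam p) Z) ^ (2*M)
      * NN (R *\<^sub>R uparam p) powi (- int M))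
    = fact (2*M) / (fact M * fact (M+1)) * (t * (y * frow s Z 1 + frow s Z 2) + NN Z) ^ M"
proof -
  \<comment> \<open>The cofactor matrix of Z plus t times the outer product of (s, 1) and (y,
    1).\<close>
  define A :: mat2 where "A = vector [vector [t * s * y + Z$2$2, t * s - Z$2$1], vector [t * y - Z$1$2, t + Z$1$1]]"
  have "t * (y * frow s W 1 + frow s W 2) + polar W Z = lin A W" for W
    by (simp add: A_def lin_def frow_def polar_def algebra_simps)
  moreover have "t * (y * frow s Z 1 + frow s Z 2) + NN Z = NN A"
    by (simp add: A_def NN_def frow_def polar_def algebra_simps)
  ultimately show ?thesis using avg_lin_power[OF assms] by simp
qed

text \<open>The Catalan number of M times the quotient of M choose n by 2M choose n. The zero branch
  n > M is the source of all vanishing statements.\<close>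

definition polar_const :: "nat \<Rightarrow> nat \<Rightarrow> complex" where
  "polar_const M n = (if n \<le> M then fact (2*M-n) / (fact (M+1) * fact (M-n)) else 0)"

lemma avg_rank1_power_polar:
  assumes "R > 0" "n \<le> 2*M"
  shows "avg (\<lambda>p. (y * frow s (R *\<^sub>R uparam p) 1 + frow s (R *\<^sub>R uparam p) 2) ^ n * polar (R *\<^sub>R uparam p) Z ^ (2*M-n)
      * NN (R *\<^sub>R uparam p) powi (- int M))
    = polar_const M n * (y * frow s Z 1 + frow s Z 2) ^ n * NN Z ^ (M-n)" (is "avg ?f = _ * ?x ^ n * _")
proof -
  define C where "C = (fact (2*M) / (fact M * fact (M+1)) :: complex)"
  define x where "x = ?x"
  let ?c = "\<lambda>i. C * of_nat (M choose i) * x ^ i * NN Z ^ (M-i)"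
  have cont: "continuous_on UNIV (\<lambda>p. y * frow s (R *\<^sub>R uparam p) 1 + frow s (R *\<^sub>R uparam p) 2)"
    "continuous_on UNIV (\<lambda>p. polar (R *\<^sub>R uparam p) Z)"
    "continuous_on UNIV (\<lambda>p. NN (R *\<^sub>R uparam p) powi (- int M))"
    by (intro continuous_intros trigpoly_continuous_intros)+
  have 1: "of_nat ((2*M) choose n) * avg ?f = ?c n"
  proof (rule avg_binomial_coeff[OF cont, where c = ?c])
    fix t
    have "avg (\<lambda>p. (t * (y * frow s (R *\<^sub>R uparam p) 1 + frow s (R *\<^sub>R uparam p) 2) + polar (R *\<^sub>R uparam p) Z) ^ (2*M)
      * NN (R *\<^sub>R uparam p) powi (- int M)) = C * (t * x + NN Z) ^ M"
      unfolding avg_rank1_polar[OF assms(1)] C_def x_def ..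
    also have "\<dots> = (\<Sum>i\<le>M. ?c i * t ^ i)"
      unfolding binomial_ring sum_distrib_left power_mult_distrib by (simp only: mult_ac)
    \<comment> \<open>The right-hand side has degree only M in t; padding it with zero coefficients
      up to 2M yields the vanishing for n > M.\<close>
    also have "\<dots> = (\<Sum>i\<le>2*M. ?c i * t ^ i)"
      by (rule sum.mono_neutral_left) auto
    finally show "avg (\<lambda>p. (t * (y * frow s (R *\<^sub>R uparam p) 1 + frow s (R *\<^sub>R uparam p) 2) + polar (R *\<^sub>R uparam p) Z) ^ (2*M)
      * NN (R *\<^sub>R uparam p) powi (- int M)) = (\<Sum>i\<le>2*M. ?c i * t ^ i)" .
  qed (use assms in simp)
  have F: "(fact n * fact (2*M-n)) * of_nat ((2*M) choose n) = (fact (2*M) :: complex)"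
    using assms by (simp add: binomial_fact)
  have "fact (2*M) * avg ?f = (fact n * fact (2*M-n)) * ?c n"
    unfolding 1[symmetric] F[symmetric] by (simp only: mult.assoc)
  also have "\<dots> = fact (2*M) * (polar_const M n * x ^ n * NN Z ^ (M-n))"
  proof (cases "n \<le> M")
    case True
    have alg: "a * c * (e / (b * g) * (b / (a * d))) = e * (c / (g * d))" if "a \<noteq> 0" "b \<noteq> 0" for a b c d e g :: complex
      using that by simp
    have "fact n * fact (2*M-n) * (C * of_nat (M choose n)) = fact (2*M) * polar_const M n"
      unfolding C_def binomial_fact[OF True] polar_const_def if_P[OF True]
      by (rule alg) simp_all
    then show ?thesis by (simp only: mult.assoc[symmetric])
  qed (simp add: polar_const_def)
  finally show ?thesis by (simp add: x_def)
qed

text \<open>Comparing powers of y splits the n-th power of the form into the products that generate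
  the matrix coefficients.\<close>

lemma avg_frow_polar:
  assumes "R > 0" "n \<le> 2*M" "i \<le> n"
  shows "avg (\<lambda>p. frow s (R *\<^sub>R uparam p) 1 ^ i * frow s (R *\<^sub>R uparam p) 2 ^ (n - i) * (polar (R *\<^sub>R uparam p) Z ^ (2*M-n)
      * NN (R *\<^sub>R uparam p) powi (- int M)))
    = polar_const M n * NN Z ^ (M-n) * (frow s Z 1 ^ i * frow s Z 2 ^ (n - i))" (is "avg ?f = ?r")
proof -
  let ?c = "\<lambda>i. polar_const M n * NN Z ^ (M-n) * of_nat (n choose i) * (frow s Z 1 ^ i * frow s Z 2 ^ (n - i))"
  have cont: "continuous_on UNIV (\<lambda>p. frow s (R *\<^sub>R uparam p) 1)" "continuous_on UNIV (\<lambda>p. frow s (R *\<^sub>R uparam p) 2)"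
    "continuous_on UNIV (\<lambda>p. polar (R *\<^sub>R uparam p) Z ^ (2*M-n) * NN (R *\<^sub>R uparam p) powi (- int M))"
    by (intro continuous_intros trigpoly_continuous_intros)+
  have "of_nat (n choose i) * avg ?f = ?c i"
  proof (rule avg_binomial_coeff[OF cont, where c = ?c])
    fix y
    show "avg (\<lambda>p. (y * frow s (R *\<^sub>R uparam p) 1 + frow s (R *\<^sub>R uparam p) 2) ^ n * (polar (R *\<^sub>R uparam p) Z ^ (2*M-n)
      * NN (R *\<^sub>R uparam p) powi (- int M))) = (\<Sum>i\<le>n. ?c i * y ^ i)"
      unfolding mult.assoc[symmetric] avg_rank1_power_polar[OF assms(1,2)]
      unfolding binomial_ring sum_distrib_left sum_distrib_right power_mult_distrib
      by (simp add: mult_ac)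
  qed (use assms in simp)
  then have "of_nat (n choose i) * avg ?f = of_nat (n choose i) * ?r"
    by (simp add: mult_ac)
  then show ?thesis using assms(3) by (simp del: of_nat_mult)
qed

subsection \<open>The matrix coefficients\<close>

definition tpoly :: "nat \<Rightarrow> nat \<Rightarrow> mat2 \<Rightarrow> complex poly" where
  "tpoly n i Z = [:Z$2$1, Z$1$1:] ^ i * [:Z$2$2, Z$1$2:] ^ (n - i)"

lemma poly_tpoly: "poly (tpoly n i Z) s = frow s Z 1 ^ i * frow s Z 2 ^ (n - i)"
  by (simp add: tpoly_def frow_def algebra_simps)

lemma degree_tpoly: "i \<le> n \<Longrightarrow> degree (tpoly n i Z) \<le> n"
proof -
  assume "i \<le> n"
  have "degree (tpoly n i Z) \<le> degree ([:Z$2$1, Z$1$1:] ^ i) + degree ([:Z$2$2, Z$1$2:] ^ (n - i))"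
    unfolding tpoly_def by (rule degree_mult_le)
  also have "\<dots> \<le> degree [:Z$2$1, Z$1$1:] * i + degree [:Z$2$2, Z$1$2:] * (n - i)"
    by (intro add_mono degree_power_le)
  also have "\<dots> \<le> 1 * i + 1 * (n - i)"
    by (intro add_mono mult_right_mono) auto
  finally show ?thesis using \<open>i \<le> n\<close> by simp
qed

text \<open>On the unit circle, multiplication by s^(-j) and averaging select the coefficient of
  s^j. From here on matrix coefficients are handled by polynomial algebra in s.\<close>

lemma tlnm_eq_coeff: "tlnm n i j Z = coeff (tpoly n i Z) j"
proof -
  let ?P = "tpoly n i Z"
  have "integral {0..2*pi} (\<lambda>\<theta>. (cis \<theta> * Z$1$1 + Z$2$1) ^ i * (cis \<theta> * Z$1$2 + Z$2$2) ^ (n - i) * (cis \<theta>) powi (- int j))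
     = integral {0..2*pi} (\<lambda>\<theta>. \<Sum>k\<le>degree ?P. coeff ?P k * cis (of_int (int k - int j) * \<theta>))"
  proof (rule arg_cong[where f = "integral _"], rule ext)
    fix \<theta>
    have "(cis \<theta> * Z$1$1 + Z$2$1) ^ i * (cis \<theta> * Z$1$2 + Z$2$2) ^ (n - i) * (cis \<theta>) powi (- int j) = poly ?P (cis \<theta>) * cis \<theta> powi (- int j)"
      by (simp add: poly_tpoly frow_def)
    also have "\<dots> = (\<Sum>k\<le>degree ?P. coeff ?P k * cis (of_int (int k - int j) * \<theta>))"
      unfolding poly_altdef cis_powi sum_distrib_right Complex.DeMoivre mult.assoc cis_mult
      by (simp add: algebra_simps)
    finally show "(cis \<theta> * Z$1$1 + Z$2$1) ^ i * (cis \<theta> * Z$1$2 + Z$2$2) ^ (n - i) * (cis \<theta>) powi (- int j)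
       = (\<Sum>k\<le>degree ?P. coeff ?P k * cis (of_int (int k - int j) * \<theta>))" .
  qed
  also have "\<dots> = (\<Sum>k\<le>degree ?P. coeff ?P k * integral {0..2*pi} (\<lambda>\<theta>. cis (of_int (int k - int j) * \<theta>)))"
    by (subst integral_sum) (auto intro!: integrable_continuous_interval continuous_intros simp: cis_conv_exp)
  also have "\<dots> = (\<Sum>k\<le>degree ?P. if k = j then coeff ?P j * of_real (2*pi) else 0)"
    unfolding integral_cis_int by (intro sum.cong) auto
  also have "\<dots> = coeff ?P j * of_real (2*pi)"
    by (cases "j \<le> degree ?P") (auto simp: coeff_eq_0)
  finally show ?thesis unfolding tlnm_def by simp
qed

lemma sum_tlnm:
  assumes "i \<le> n"
  shows "(\<Sum>j\<le>n. tlnm n i j Z * s ^ j) = frow s Z 1 ^ i * frow s Z 2 ^ (n - i)"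
  unfolding poly_tpoly[symmetric] tlnm_eq_coeff
  using poly_as_sum_of_monoms'[OF degree_tpoly[OF assms, of Z]]
  by (metis (no_types, lifting) poly_monom poly_sum sum.cong)

lemma coeff_linear_mult:
  "coeff ([:a, b:] * q) j = a * coeff q j + b * (if j = 0 then 0 else coeff q (j - 1))"
  by (cases j) simp_all

lemma trigpoly_coeff_linear_power:
  assumes "trigpoly 1 a" "trigpoly 1 b" "\<And>j. trigpoly m (\<lambda>p. coeff (q p) j)"
  shows "trigpoly (int n + m) (\<lambda>p. coeff ([:a p, b p:] ^ n * q p) j)"
proof (induction n arbitrary: j)
  case (Suc n)
  have "trigpoly (1 + (int n + m)) (\<lambda>p. a p * coeff ([:a p, b p:] ^ n * q p) j
     + b p * (if j = 0 then 0 else coeff ([:a p, b p:] ^ n * q p) (j - 1)))"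
    by (cases "j = 0"; simp; intro trigpoly.add trigpoly_mult assms(1,2) Suc)
  moreover have "coeff ([:a p, b p:] ^ Suc n * q p) j = a p * coeff ([:a p, b p:] ^ n * q p) j
     + b p * (if j = 0 then 0 else coeff ([:a p, b p:] ^ n * q p) (j - 1))" for p
    unfolding power_Suc mult.assoc by (rule coeff_linear_mult)
  ultimately show ?case by (simp add: add_ac)
qed (use assms in simp)

lemma trigpoly_tlnm: 
  assumes "i \<le> n" shows "trigpoly (int n) (\<lambda>p. tlnm n i j (R *\<^sub>R uparam p))"
proof -
  have "trigpoly 0 (\<lambda>p. coeff 1 j :: complex)" for j by (rule trigpoly_const)
  from trigpoly_coeff_linear_power[OF trigpoly_scaleR_uparam trigpoly_scaleR_uparam this]
  have "trigpoly (int (n-i)) (\<lambda>p. coeff ([:(R *\<^sub>R uparam p)$2$2, (R *\<^sub>R uparam p)$1$2:] ^ (n-i)) j)" for j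
    by simp
  from trigpoly_coeff_linear_power[OF trigpoly_scaleR_uparam trigpoly_scaleR_uparam this, of i]
  show ?thesis unfolding tlnm_eq_coeff tpoly_def
    using assms by (simp add: of_nat_diff del: vector_scaleR_component)
qed

lemmas tlnm_continuous = trigpoly_tlnm[THEN trigpoly_continuous]

text \<open>The last comparison of coefficients is in s, of which the factor \<open>?G\<close> is
  independent. Averaging against this factor sends t to a multiple of t(Z) N(Z)^(M-n), and to 0 if n
  > M.\<close>

lemma avg_tlnm_polar:
  assumes "R > 0" "n \<le> 2*M" "i \<le> n" "j \<le> n"
  shows "avg (\<lambda>p. tlnm n i j (R *\<^sub>R uparam p) * (polar (R *\<^sub>R uparam p) Z ^ (2*M-n) * NN (R *\<^sub>R uparam p) powi (- int M)))
    = polar_const M n * NN Z ^ (M-n) * tlnm n i j Z"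
proof -
  let ?G = "\<lambda>p. polar (R *\<^sub>R uparam p) Z ^ (2*M-n) * NN (R *\<^sub>R uparam p) powi (- int M)"
  have "(\<Sum>j\<le>n. avg (\<lambda>p. tlnm n i j (R *\<^sub>R uparam p) * ?G p) * s ^ j) 
      = (\<Sum>j\<le>n. (polar_const M n * NN Z ^ (M-n) * tlnm n i j Z) * s ^ j)" for s
  proof -
    have "(\<Sum>j\<le>n. avg (\<lambda>p. tlnm n i j (R *\<^sub>R uparam p) * ?G p) * s ^ j)
      = avg (\<lambda>p. \<Sum>j\<le>n. s ^ j * (tlnm n i j (R *\<^sub>R uparam p) * ?G p))"
      by (subst avg_sum) (use assms in \<open>auto simp: avg_cmult mult_ac intro!: continuous_intros trigpoly_continuous_intros tlnm_continuous\<close>)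
    also have "\<dots> = avg (\<lambda>p. frow s (R *\<^sub>R uparam p) 1 ^ i * frow s (R *\<^sub>R uparam p) 2 ^ (n - i) * ?G p)"
      unfolding sum_tlnm[OF assms(3), symmetric] sum_distrib_right by (simp add: mult_ac)
    also have "\<dots> = (\<Sum>j\<le>n. (polar_const M n * NN Z ^ (M-n) * tlnm n i j Z) * s ^ j)"
      unfolding avg_frow_polar[OF assms(1-3)] unfolding sum_tlnm[OF assms(3), symmetric] sum_distrib_left
      by (simp add: mult_ac)
    finally show ?thesis .
  qed
  then have "\<forall>j\<le>n. avg (\<lambda>p. tlnm n i j (R *\<^sub>R uparam p) * ?G p) = polar_const M n * NN Z ^ (M-n) * tlnm n i j Z"
    by (intro polyfun_eq_coeffs[THEN iffD1]) blast
  with assms(4) show ?thesis by blast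
qed

lemma polar_linear: "polar W (\<chi> i j. s * Z1$i$j + Z2$i$j) = s * polar W Z1 + polar W Z2" 
  by (simp add: polar_def algebra_simps)

text \<open>Unless the total degree is zero, the circle action suffices. Otherwise k = - M with 2M =
  a + b + n, and a + b < n says M < n, where \<open>polar_const\<close> vanishes. Linearity of B(W,
  Z) in Z, applied to s Z_1 + Z_2, gives the mixed powers.\<close>

lemma avg_tlnm_polar2_eq_0:
  assumes "R > 0" "i \<le> n" "j \<le> n" "a + b < n"
  shows "avg (\<lambda>p. polar (R *\<^sub>R uparam p) Z1 ^ a * polar (R *\<^sub>R uparam p) Z2 ^ b * 
     (tlnm n i j (R *\<^sub>R uparam p) * NN (R *\<^sub>R uparam p) powi k)) = 0" (is "avg ?f = 0")
proof (cases "int a + int b + int n + 2 * k = 0")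
  case False
  have T: "trigpoly (int a * 1 + int b * 1 + (int n + 2 * k)) ?f"
    by (intro trigpoly_mult trigpoly_power trigpoly_polar trigpoly_tlnm trigpoly_NN_powi assms)
  show ?thesis by (rule trigpoly_avg_eq_0[OF T]) (use False in linarith)
next
  case True
  define M where "M = nat (- k)"
  have M: "k = - int M" "n \<le> 2 * M" "2 * M - n = a + b" "\<not> n \<le> M" 
    using True assms(4) unfolding M_def by linarith+
  have ba: "b = a + b - a" by simp
  have "avg (\<lambda>p. polar (R *\<^sub>R uparam p) Z1 ^ a * polar (R *\<^sub>R uparam p) Z2 ^ (a + b - a) * 
     (tlnm n i j (R *\<^sub>R uparam p) * NN (R *\<^sub>R uparam p) powi k)) = 0"
  proof (rule avg_binomial_coeff_0)
    fix s
    define Z where "Z = (\<chi> i j. s * Z1$i$j + Z2$i$j)"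
    have "avg (\<lambda>p. tlnm n i j (R *\<^sub>R uparam p) * (polar (R *\<^sub>R uparam p) Z ^ (2*M-n) * NN (R *\<^sub>R uparam p) powi (- int M))) = 0"
      unfolding avg_tlnm_polar[OF assms(1) M(2) assms(2,3)] using M by (simp add: polar_const_def)
    then show "avg (\<lambda>p. (s * polar (R *\<^sub>R uparam p) Z1 + polar (R *\<^sub>R uparam p) Z2) ^ (a + b) * 
     (tlnm n i j (R *\<^sub>R uparam p) * NN (R *\<^sub>R uparam p) powi k)) = 0"
      unfolding M Z_def polar_linear by (simp only: mult_ac)
  qed (intro continuous_intros trigpoly_continuous_intros tlnm_continuous assms le_add1)+
  then show ?thesis by simp
qed

subsection \<open>Complete homogeneous symmetric polynomials of two variables\<close>

text \<open>\<open>hsym n b c\<close> is the complete homogeneous symmetric polynomial of degree \<open>n\<close> in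
  two variables with sum \<open>b\<close> and product \<open>c\<close>, that is, the character of the
  \<open>n\<close>-th symmetric power of a matrix with trace \<open>b\<close> and determinant \<open>c\<close>.\<close>

fun hsym :: "nat \<Rightarrow> complex \<Rightarrow> complex \<Rightarrow> complex" where
  "hsym 0 b c = 1"
| "hsym (Suc 0) b c = b"
| "hsym (Suc (Suc n)) b c = b * hsym (Suc n) b c - c * hsym n b c"

lemma hsym_homogeneous: "hsym n (t * b) (t ^ 2 * c) = t ^ n * hsym n b c"
  by (induction n b c rule: hsym.induct) (simp_all add: algebra_simps power2_eq_square)

text \<open>The recursion of the sum of all x^i y^(n-i). It involves no division by x - y, so a
  double root is no special case.\<close>

lemma hsym_Suc_roots: "hsym (Suc n) (x + y) (x * y) = x * hsym n (x + y) (x * y) + y ^ Suc n"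
  by (induction n) (simp_all add: algebra_simps)

lemma norm_hsym_le:
  assumes "norm x \<le> r" "norm y \<le> r"
  shows "norm (hsym n (x + y) (x * y)) \<le> of_nat (Suc n) * r ^ n"
proof (induction n)
  case (Suc n)
  have r: "r \<ge> 0" using assms norm_ge_zero order_trans by blast
  have "norm (hsym (Suc n) (x + y) (x * y)) \<le> norm x * norm (hsym n (x + y) (x * y)) + norm y ^ Suc n"
    unfolding hsym_Suc_roots by (metis norm_mult norm_power norm_triangle_ineq)
  also have "\<dots> \<le> r * (of_nat (Suc n) * r ^ n) + r ^ Suc n"
    by (intro add_mono mult_mono power_mono assms Suc) (use r in auto)
  finally show ?case by (simp add: algebra_simps)
qed simp

text \<open>\<open>hterm b c n j\<close> is the coefficient of \<open>s\<^sup>n\<close> in \<open>(b s - c s\<^sup>2)\<^bsup>n - j\<^esup>\<close>; it is \<open>0\<close> for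
  \<open>2 j > n\<close>, where the subtraction in the exponent truncates.\<close>

definition hterm :: "complex \<Rightarrow> complex \<Rightarrow> nat \<Rightarrow> nat \<Rightarrow> complex" where
  "hterm b c n j = of_nat ((n - j) choose j) * (b ^ (n - 2*j) * (- c) ^ j)"

lemma hterm_0: "hterm b c n 0 = b ^ n"
  by (simp add: hterm_def)

lemma hterm_eq_0: "n < 2 * j \<Longrightarrow> hterm b c n j = 0"
  by (simp add: hterm_def binomial_eq_0)

text \<open>For Suc j > n - j the truncated exponents of the two sides differ by one, but there the
  binomial coefficient is zero.\<close>

lemma hterm_step:
  fixes b c :: complex
  assumes "j \<le> n"
  shows "b * (of_nat ((n - j) choose Suc j) * (b ^ (Suc n - 2 * Suc j) * (- c) ^ Suc j)) = 
    of_nat ((n - j) choose Suc j) * (b ^ (n - 2 * j) * (- c) ^ Suc j)"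
proof (cases "Suc j \<le> n - j")
  case True
  then have "n - 2 * j = Suc (Suc n - 2 * Suc j)" by arith
  then show ?thesis by simp
qed (simp add: binomial_eq_0)

text \<open>Pascal's rule for n - j + 1 choose j + 1.\<close>

lemma hterm_Suc_Suc:
  assumes "j \<le> n"
  shows "hterm b c (Suc (Suc n)) (Suc j) = b * hterm b c (Suc n) (Suc j) - c * hterm b c n j"
proof -
  have "hterm b c (Suc (Suc n)) (Suc j) = of_nat ((n - j) choose Suc j) * (b ^ (n - 2 * j) * (- c) ^ Suc j)
     - c * hterm b c n j"
    using assms by (simp add: hterm_def Suc_diff_le algebra_simps)
  also have "of_nat ((n - j) choose Suc j) * (b ^ (n - 2 * j) * (- c) ^ Suc j) = b * hterm b c (Suc n) (Suc j)"
    unfolding hterm_def diff_Suc_Suc by (rule hterm_step[OF assms, symmetric])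
  finally show ?thesis .
qed

lemma hsym_eq_sum: "hsym n b c = (\<Sum>j\<le>n. hterm b c n j)"
proof (induction n b c rule: hsym.induct)
  case (3 n b c)
  have "(\<Sum>j\<le>Suc (Suc n). hterm b c (Suc (Suc n)) j) = b ^ Suc (Suc n) + (\<Sum>j\<le>n. hterm b c (Suc (Suc n)) (Suc j)) "
    unfolding sum.atMost_Suc_shift[of _ "Suc n"] by (simp add: hterm_0 hterm_eq_0)
  also have "(\<Sum>j\<le>n. hterm b c (Suc (Suc n)) (Suc j)) = b * (\<Sum>j\<le>n. hterm b c (Suc n) (Suc j)) - c * (\<Sum>j\<le>n. hterm b c n j)"
    unfolding sum_distrib_left sum_subtractf[symmetric] by (rule sum.cong[OF refl]) (simp add: hterm_Suc_Suc)
  also have "(\<Sum>j\<le>n. hterm b c (Suc n) (Suc j)) = (\<Sum>j\<le>Suc n. hterm b c (Suc n) j) - b ^ Suc n"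
    unfolding sum.atMost_Suc_shift[of _ n] by (simp add: hterm_0)
  finally show ?case using 3 by (simp add: algebra_simps)
qed (simp_all add: hterm_def)

text \<open>The generating series of the convolution is (1 - b s + c s^2)^(-2). Multiplying it by 1
  - b s + c s^2 leaves the series of \<open>hsym\<close>, which is the inhomogeneous term.\<close>

lemma hsym_convolution_rec:
  "(\<Sum>p\<le>Suc (Suc n). hsym p b c * hsym (Suc (Suc n) - p) b c) = 
   b * (\<Sum>p\<le>Suc n. hsym p b c * hsym (Suc n - p) b c) - c * (\<Sum>p\<le>n. hsym p b c * hsym (n - p) b c) + hsym (Suc (Suc n)) b c"
proof -
  have "(\<Sum>p\<le>n. hsym p b c * hsym (Suc (Suc n) - p) b c) = 
     (\<Sum>p\<le>n. b * (hsym p b c * hsym (Suc n - p) b c) - c * (hsym p b c * hsym (n - p) b c))"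
    by (rule sum.cong[OF refl]) (simp add: Suc_diff_le algebra_simps)
  then show ?thesis by (simp add: sum_subtractf sum_distrib_left algebra_simps)
qed

text \<open>With u = b s - c s^2 the series of \<open>hsym\<close> is 1 / (1 - u), and its square is
  the sum of (m + 1) u^m. Since \<open>hterm b c n j\<close> belongs to u^(n-j), its weight is n - j
  + 1.\<close>

lemma hsym_convolution:
  "(\<Sum>p\<le>n. hsym p b c * hsym (n - p) b c) = (\<Sum>j\<le>n. of_nat (Suc (n - j)) * hterm b c n j)"
proof (induction n rule: less_induct)
  case (less n)
  consider "n = 0" | "n = 1" | m where "n = Suc (Suc m)"
    by (metis One_nat_def not0_implies_Suc)
  then show ?case
  proof cases
    case (3 m)
    let ?g = "\<lambda>n j. of_nat (Suc (n - j)) * hterm b c n j"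
    have "(\<Sum>j\<le>Suc (Suc m). ?g (Suc (Suc m)) j) = ?g (Suc (Suc m)) 0 + (\<Sum>j\<le>m. ?g (Suc (Suc m)) (Suc j)) "
      unfolding sum.atMost_Suc_shift[of _ "Suc m"] by (simp add: hterm_eq_0)
    also have "(\<Sum>j\<le>m. ?g (Suc (Suc m)) (Suc j)) = b * (\<Sum>j\<le>m. ?g (Suc m) (Suc j)) - c * (\<Sum>j\<le>m. ?g m j)
        + (\<Sum>j\<le>m. hterm b c (Suc (Suc m)) (Suc j))"
      unfolding sum_distrib_left sum_subtractf[symmetric] sum.distrib[symmetric]
      by (rule sum.cong[OF refl]) (simp add: hterm_Suc_Suc Suc_diff_le algebra_simps)
    also have "(\<Sum>j\<le>m. ?g (Suc m) (Suc j)) = (\<Sum>j\<le>Suc m. ?g (Suc m) j) - ?g (Suc m) 0"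
      unfolding sum.atMost_Suc_shift[of _ m] by simp
    also have "(\<Sum>j\<le>m. hterm b c (Suc (Suc m)) (Suc j)) = hsym (Suc (Suc m)) b c - hterm b c (Suc (Suc m)) 0"
      unfolding hsym_eq_sum sum.atMost_Suc_shift[of _ "Suc m"] by (simp add: hterm_eq_0)
    finally show ?thesis
      unfolding 3 hsym_convolution_rec using less[of "Suc m"] less[of m] 3
      by (simp add: hterm_0 algebra_simps)
  qed (simp_all add: hterm_def)
qed

lemma sum_alternating_binomial_Suc:
  fixes f :: "nat \<Rightarrow> complex"
  shows "(\<Sum>l\<le>Suc k. (-1) ^ l * of_nat (Suc k choose l) * f l) = 
    (\<Sum>l\<le>k. (-1) ^ l * of_nat (k choose l) * f l) - (\<Sum>l\<le>k. (-1) ^ l * of_nat (k choose l) * f (Suc l))"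
proof -
  have "(\<Sum>l\<le>Suc k. (-1) ^ l * of_nat (Suc k choose l) * f l) = 
     f 0 + (\<Sum>l\<le>k. (-1) ^ Suc l * of_nat (k choose Suc l) * f (Suc l)) - (\<Sum>l\<le>k. (-1) ^ l * of_nat (k choose l) * f (Suc l))"
    unfolding sum.atMost_Suc_shift[of _ k] by (simp add: algebra_simps sum_subtractf sum_negf)
  also have "f 0 + (\<Sum>l\<le>k. (-1) ^ Suc l * of_nat (k choose Suc l) * f (Suc l)) = (\<Sum>l\<le>Suc k. (-1) ^ l * of_nat (k choose l) * f l)"
    unfolding sum.atMost_Suc_shift[of _ k] by simp
  finally show ?thesis by simp
qed

text \<open>A k-fold backward difference in X; each step lowers both entries of the binomial
  coefficient by one. It is used with m = k, where the value is 1.\<close>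

lemma sum_alternating_binomial_choose:
  assumes "k \<le> X" "k \<le> m"
  shows "(\<Sum>l\<le>k. (-1) ^ l * of_nat (k choose l) * of_nat ((X - l) choose m)) = (of_nat ((X - k) choose (m - k)) :: complex)"
  using assms
proof (induction k arbitrary: X)
  case (Suc k)
  have 1: "(\<Sum>l\<le>k. (-1) ^ l * of_nat (k choose l) * of_nat ((X - l) choose m)) = (of_nat ((X - k) choose (m - k)) :: complex)"
    using Suc by simp
  have 2: "(\<Sum>l\<le>k. (-1) ^ l * of_nat (k choose l) * of_nat ((X - Suc l) choose m)) = (of_nat ((X - 1 - k) choose (m - k)) :: complex)"
    using Suc.IH[of "X - 1"] Suc.prems by simp
  have "X - k = Suc (X - Suc k)" "m - k = Suc (m - Suc k)" using Suc.prems by simp_all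
  then show ?case unfolding sum_alternating_binomial_Suc 1 2 by simp
qed simp

subsection \<open>The homogeneous kernels\<close>

text \<open>Division by N(W) or N(Z) is left out, so the kernel is polynomial and symmetric in W and
  Z and serves both expansions.\<close>

definition kern :: "nat \<Rightarrow> mat2 \<Rightarrow> mat2 \<Rightarrow> complex" where
  "kern n W Z = hsym n (polar W Z) (NN W * NN Z)"

lemma trigpoly_hsym:
  "trigpoly 1 f \<Longrightarrow> trigpoly 2 g \<Longrightarrow> trigpoly (int n) (\<lambda>p. hsym n (f p) (g p))"
proof (induction n "0::complex" "0::complex" rule: hsym.induct)
  case 1 then show ?case by (simp add: trigpoly_const)
next
  case 2 then show ?case by simp
next
  case (3 n)
  have "trigpoly (1 + int (Suc n)) (\<lambda>p. f p * hsym (Suc n) (f p) (g p))"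
    "trigpoly (2 + int n) (\<lambda>p. g p * hsym n (f p) (g p))"
    using 3 by (intro trigpoly_mult; simp)+
  then have "trigpoly (int (Suc (Suc n))) (\<lambda>p. f p * hsym (Suc n) (f p) (g p))" 
     "trigpoly (int (Suc (Suc n))) (\<lambda>p. (-1) * (g p * hsym n (f p) (g p)))"
    using trigpoly_cmult[of _ _ "-1"] by (simp_all only: add_ac int_Suc of_nat_Suc one_add_one[symmetric])
  from trigpoly.add[OF this] show ?case by simp
qed

lemma trigpoly_NN: "trigpoly 2 (\<lambda>p. NN (R *\<^sub>R uparam p))"
  using trigpoly_NN_powi[of 1 R] by simp

lemma trigpoly_kern: "trigpoly (int n) (\<lambda>p. kern n (R *\<^sub>R uparam p) Z)"
proof -
  have "trigpoly 2 (\<lambda>p. NN Z * NN (R *\<^sub>R uparam p))" 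
    by (intro trigpoly_cmult trigpoly_NN)
  then show ?thesis unfolding kern_def by (intro trigpoly_hsym trigpoly_polar) (simp add: mult.commute)
qed

lemma kern_eq_sum:
  "kern n W Z = (\<Sum>j\<le>n. (of_nat ((n - j) choose j) * (- NN Z) ^ j) * (polar W Z ^ (n - 2*j) * NN W ^ j))"
  unfolding kern_def hsym_eq_sum hterm_def
proof (rule sum.cong[OF refl])
  fix j
  have "(- (NN W * NN Z)) ^ j = (- NN Z) ^ j * NN W ^ j"
    unfolding power_mult_distrib[symmetric] by (simp add: mult.commute)
  then show "of_nat ((n - j) choose j) * (polar W Z ^ (n - 2*j) * (- (NN W * NN Z)) ^ j) =
    (of_nat ((n - j) choose j) * (- NN Z) ^ j) * (polar W Z ^ (n - 2*j) * NN W ^ j)"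
    by (simp only: mult_ac)
qed

text \<open>Expanding the kernels replaces pairs of factors B by powers of N(W), which merge with
  N(W)^k. The number of factors B never grows, so it stays below n.\<close>

lemma avg_tlnm_kern2_eq_0:
  assumes "R > 0" "i \<le> n" "j \<le> n" "a + b < n"
  shows "avg (\<lambda>p. tlnm n i j (R *\<^sub>R uparam p) * NN (R *\<^sub>R uparam p) powi k *
     (kern a (R *\<^sub>R uparam p) Z1 * kern b (R *\<^sub>R uparam p) Z2)) = 0"
proof -
  let ?c = "\<lambda>n Z j. of_nat ((n - j) choose j) * (- NN Z) ^ j"
  define g where "g l m p = polar (R *\<^sub>R uparam p) Z1 ^ (a - 2*l) * polar (R *\<^sub>R uparam p) Z2 ^ (b - 2*m) * 
      (tlnm n i j (R *\<^sub>R uparam p) * NN (R *\<^sub>R uparam p) powi (int (l + m) + k))" for l m p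
  have c: "continuous_on UNIV (g l m)" for l m
    unfolding g_def by (intro continuous_intros trigpoly_continuous_intros tlnm_continuous assms)
  have g0: "avg (g l m) = 0" for l m
    unfolding g_def by (rule avg_tlnm_polar2_eq_0) (use assms in auto)
  have E: "tlnm n i j (R *\<^sub>R uparam p) * NN (R *\<^sub>R uparam p) powi k *
     (kern a (R *\<^sub>R uparam p) Z1 * kern b (R *\<^sub>R uparam p) Z2) = (\<Sum>l\<le>a. \<Sum>m\<le>b. (?c a Z1 l * ?c b Z2 m) * g l m p)" for p
    unfolding kern_eq_sum sum_product unfolding sum_distrib_left g_def
    using NN_scaleR_uparam_nonzero[OF assms(1)]
    by (intro sum.cong refl) (simp add: power_int_add power_add mult_ac)
  show ?thesis
    unfolding E by (simp add: avg_sum avg_cmult c g0 continuous_on_sum continuous_on_mult continuous_on_const)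
qed

text \<open>On the diagonal the convolution collapses to single powers of B(W, Z). Terms with l > k
  contain fewer than n factors B and vanish; each other term is t(Z) N(Z)^k times a summand of an
  alternating binomial sum with value 1.\<close>

lemma avg_tlnm_kern_diagonal:
  assumes "R > 0" "i \<le> n" "j \<le> n"
    and d_def: "d = n + 2 * k"
  shows "avg (\<lambda>p. tlnm n i j (R *\<^sub>R uparam p) * NN (R *\<^sub>R uparam p) powi (- int (n + k)) *
     (\<Sum>q\<le>d. kern q (R *\<^sub>R uparam p) Z * kern (d - q) (R *\<^sub>R uparam p) Z)) = tlnm n i j Z * NN Z ^ k"
proof -
  let ?c = "\<lambda>l. of_nat (Suc (d - l) * ((d - l) choose l)) * (- NN Z) ^ l"
  define g where "g l p = tlnm n i j (R *\<^sub>R uparam p) * 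
      (polar (R *\<^sub>R uparam p) Z ^ (d - 2*l) * NN (R *\<^sub>R uparam p) powi (int l - int (n + k)))" for l p
  have c: "continuous_on UNIV (g l)" for l
    unfolding g_def by (intro continuous_intros trigpoly_continuous_intros tlnm_continuous assms)
  have E: "tlnm n i j (R *\<^sub>R uparam p) * NN (R *\<^sub>R uparam p) powi (- int (n + k)) *
     (\<Sum>q\<le>d. kern q (R *\<^sub>R uparam p) Z * kern (d - q) (R *\<^sub>R uparam p) Z) = (\<Sum>l\<le>d. ?c l * g l p)" for p
    unfolding kern_def hsym_convolution unfolding sum_distrib_left
  proof (rule sum.cong[OF refl])
    fix l
    let ?W = "R *\<^sub>R uparam p"
    have 1: "(- (NN ?W * NN Z)) ^ l = (- NN Z) ^ l * NN ?W ^ l"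
      unfolding power_mult_distrib[symmetric] by (simp add: mult.commute)
    have 2: "NN ?W powi (int l - int (n + k)) = NN ?W ^ l * NN ?W powi (- int (n + k))"
      using power_int_add[of "NN ?W" "int l" "- int (n + k)"] NN_scaleR_uparam_nonzero[OF assms(1), of p]
      unfolding diff_conv_add_uminus power_int_of_nat by blast
    show "tlnm n i j ?W * NN ?W powi (- int (n + k)) * (of_nat (Suc (d - l)) * hterm (polar ?W Z) (NN ?W * NN Z) d l) = ?c l * g l p"
      unfolding hterm_def g_def 1 2 of_nat_mult by (simp only: mult_ac)
  qed
  have "avg (\<lambda>p. tlnm n i j (R *\<^sub>R uparam p) * NN (R *\<^sub>R uparam p) powi (- int (n + k)) *
     (\<Sum>q\<le>d. kern q (R *\<^sub>R uparam p) Z * kern (d - q) (R *\<^sub>R uparam p) Z)) = (\<Sum>l\<le>d. ?c l * avg (g l))"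
    unfolding E by (simp add: avg_sum avg_cmult c continuous_on_mult continuous_on_const)
  also have "\<dots> = (\<Sum>l\<le>k. ?c l * avg (g l))"
  proof (rule sum.mono_neutral_right)
    show "\<forall>l\<in>{..d} - {..k}. ?c l * avg (g l) = 0"
    proof
      fix l assume l: "l \<in> {..d} - {..k}"
      \<comment> \<open>For 2 * l > d the exponent truncates to 0, which is not below n when n = 0;
        in that range the binomial coefficient is zero instead.\<close>
      show "?c l * avg (g l) = 0"
      proof (cases "2 * l \<le> d")
        case True
        then have "d - 2 * l + 0 < n" using l by (auto simp: d_def)
        from avg_tlnm_polar2_eq_0[OF assms(1-3) this, of Z Z "int l - int (n + k)"]
        have "avg (g l) = 0" by (simp add: g_def[abs_def] mult_ac)
        then show ?thesis by simp
      qed (simp add: binomial_eq_0)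
    qed
  qed (auto simp: d_def)
  also have "\<dots> = (\<Sum>l\<le>k. (tlnm n i j Z * NN Z ^ k) * ((-1) ^ l * of_nat (k choose l) * of_nat ((Suc d - l) choose k)))"
  proof (rule sum.cong[OF refl])
    fix l assume "l \<in> {..k}"
    then have l: "l \<le> k" by simp
    define M where "M = n + k - l"
    have M: "int l - int (n + k) = - int M" "n \<le> 2 * M" "2 * M - n = d - 2 * l" "M - n = k - l" "n \<le> M"
      using l by (auto simp: M_def d_def)
    have a: "avg (g l) = polar_const M n * NN Z ^ (k - l) * tlnm n i j Z"
      using avg_tlnm_polar[OF assms(1) M(2) assms(2,3), of Z] unfolding M(3,4) g_def M(1) .
    have e1: "(-1) ^ l * NN Z ^ k = (- NN Z) ^ l * NN Z ^ (k - l)"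
      using l by (simp add: power_minus[of "NN Z"] power_add[symmetric])
    \<comment> \<open>The factorial of d - 2l = 2M - n cancels, and k! is inserted to form the two
      binomial coefficients of the finite difference.\<close>
    have e2: "of_nat (Suc (d - l) * ((d - l) choose l)) * polar_const M n = of_nat (k choose l) * of_nat ((Suc d - l) choose k)"
    proof -
      have f: "(fact m :: complex) \<noteq> 0" for m by simp
      have 1: "of_nat ((d - l) choose l) = (fact (d - l) / (fact l * fact (d - 2 * l)) :: complex)"
        using l by (subst binomial_fact) (auto simp: d_def mult_2)
      have 2: "of_nat (k choose l) = (fact k / (fact l * fact (k - l)) :: complex)"
        using l by (rule binomial_fact)
      have 3: "of_nat ((Suc d - l) choose k) = (fact (Suc (d - l)) / (fact k * fact (M + 1)) :: complex)"
      proof -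
        have e: "Suc d - l = Suc (d - l)" "Suc (d - l) - k = M + 1" "k \<le> Suc (d - l)"
          using l by (auto simp: d_def M_def)
        show ?thesis unfolding e(1) binomial_fact[OF e(3)] e(2) ..
      qed
      have 4: "of_nat (Suc (d - l)) * fact (d - l) = (fact (Suc (d - l)) :: complex)" by simp
      have alg: "s * (e / (x * y)) * (y / (m * z)) = K / (x * z) * ((s * e) / (K * m))" 
        if "y \<noteq> 0" "K \<noteq> 0" for s e x y m z K :: complex using that by simp
      show ?thesis unfolding of_nat_mult 1 2 3 polar_const_def if_P[OF M(5)] M(3,4) 4[symmetric]
        by (rule alg) (rule f)+
    qed
    have "?c l * avg (g l) = (of_nat (Suc (d - l) * ((d - l) choose l)) * polar_const M n) * ((- NN Z) ^ l * NN Z ^ (k - l)) * tlnm n i j Z"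
      unfolding a by (simp only: mult_ac)
    then show "?c l * avg (g l) = (tlnm n i j Z * NN Z ^ k) * ((-1) ^ l * of_nat (k choose l) * of_nat ((Suc d - l) choose k))"
      unfolding e1[symmetric] e2 by (simp only: mult_ac)
  qed
  also have "\<dots> = tlnm n i j Z * NN Z ^ k"
    unfolding sum_distrib_left[symmetric] 
    by (subst sum_alternating_binomial_choose) (auto simp: d_def)
  finally show ?thesis .
qed

subsection \<open>Expansion of the kernels in matrix coefficients\<close>

lemma coeff_linear_power_above: "m > n \<Longrightarrow> coeff ([:a, b:] ^ n) m = 0" for a b :: complex
proof (induction n arbitrary: m)
  case (Suc n)
  then show ?case by (simp add: coeff_linear_mult del: mult_pCons_left)
qed simp

lemma coeff_linear_power_top: "coeff ([:a, b:] ^ n) n = b ^ n" for a b :: complex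
  by (induction n) (simp_all add: coeff_linear_mult coeff_linear_power_above del: mult_pCons_left)

lemma tlnm_diag_top: "tlnm n n n X = X$1$1 ^ n"
  by (simp add: tlnm_eq_coeff tpoly_def coeff_linear_power_top)

lemma tlnm_diag_bot: "tlnm n 0 0 X = X$2$2 ^ n"
  by (simp add: tlnm_eq_coeff tpoly_def coeff_0_power)

text \<open>For \<open>u = X\<^sub>2\<^sub>1 + X\<^sub>1\<^sub>1 s\<close> and \<open>v = X\<^sub>2\<^sub>2 + X\<^sub>1\<^sub>2 s\<close> one has
  \<open>(u - X\<^sub>1\<^sub>1 s) (v - X\<^sub>2\<^sub>2) = X\<^sub>1\<^sub>2 X\<^sub>2\<^sub>1 s\<close>, which turns into the recursion of \<^const>\<open>hsym\<close>.\<close>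

lemma tlnm_diag_step:
  assumes "j \<le> n"
  shows "tlnm (Suc (Suc n)) (Suc j) (Suc j) X = X$1$1 * tlnm (Suc n) j j X + X$2$2 * tlnm (Suc n) (Suc j) (Suc j) X
      - NN X * tlnm n j j X"
proof -
  define u where "u = [:X$2$1, X$1$1:]"
  define v where "v = [:X$2$2, X$1$2:]"
  define k where "k = n - j"
  have k: "Suc (Suc n) - Suc j = Suc k" "Suc n - j = Suc k" "Suc n - Suc j = k" "n - j = k"
    using assms by (auto simp: k_def)
  have uv: "u * v = pCons 0 (smult (X$1$1) v) + smult (X$2$2) u - pCons 0 [:NN X:]"
    by (simp add: u_def v_def NN_def algebra_simps)
  have "u ^ Suc j * v ^ Suc k = (u ^ j * v ^ k) * (u * v)" by (simp add: mult_ac)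
  also have "\<dots> = pCons 0 (smult (X$1$1) (u ^ j * v ^ Suc k)) + smult (X$2$2) (u ^ Suc j * v ^ k) - pCons 0 (smult (NN X) (u ^ j * v ^ k))"
    unfolding uv by (simp add: algebra_simps)
  finally show ?thesis
    unfolding tlnm_eq_coeff tpoly_def u_def[symmetric] v_def[symmetric] k by simp
qed

text \<open>The diagonal matrix coefficients add up to the trace on the n-th symmetric power, which
  obeys the same two-step recursion as \<open>hsym\<close>.\<close>

lemma sum_tlnm_diag: "(\<Sum>j\<le>n. tlnm n j j X) = hsym n (X$1$1 + X$2$2) (NN X)"
proof (induction n "X$1$1 + X$2$2" "NN X" rule: hsym.induct)
  case 1
  show ?case by (simp add: tlnm_diag_bot)
next
  case 2
  show ?case using tlnm_diag_bot[of 1 X] tlnm_diag_top[of 1 X] by simp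
next
  case (3 n)
  \<comment> \<open>The two extreme diagonal coefficients are split off because the step formula
    covers only the interior ones.\<close>
  have "(\<Sum>j\<le>Suc (Suc n). tlnm (Suc (Suc n)) j j X) = X$2$2 ^ Suc (Suc n) + X$1$1 ^ Suc (Suc n)
    + (\<Sum>j\<le>n. tlnm (Suc (Suc n)) (Suc j) (Suc j) X)"
    unfolding sum.atMost_Suc_shift[of _ "Suc n"] by (simp add: tlnm_diag_bot tlnm_diag_top)
  also have "(\<Sum>j\<le>n. tlnm (Suc (Suc n)) (Suc j) (Suc j) X) = 
     X$1$1 * (\<Sum>j\<le>n. tlnm (Suc n) j j X) + X$2$2 * (\<Sum>j\<le>n. tlnm (Suc n) (Suc j) (Suc j) X) - NN X * (\<Sum>j\<le>n. tlnm n j j X)"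
    unfolding sum_distrib_left sum_subtractf[symmetric] sum.distrib[symmetric]
    by (rule sum.cong[OF refl]) (simp add: tlnm_diag_step)
  also have "(\<Sum>j\<le>n. tlnm (Suc n) j j X) = (\<Sum>j\<le>Suc n. tlnm (Suc n) j j X) - X$1$1 ^ Suc n"
    by (simp add: tlnm_diag_top)
  also have "(\<Sum>j\<le>n. tlnm (Suc n) (Suc j) (Suc j) X) = (\<Sum>j\<le>Suc n. tlnm (Suc n) j j X) - X$2$2 ^ Suc n"
    unfolding sum.atMost_Suc_shift[of _ n] by (simp add: tlnm_diag_bot)
  finally show ?case unfolding 3 hsym.simps by (simp add: algebra_simps)
qed

definition tmult_coeff :: "nat \<Rightarrow> nat \<Rightarrow> nat \<Rightarrow> nat \<Rightarrow> mat2 \<Rightarrow> complex" where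
  "tmult_coeff n j a b Y = of_nat (j choose a) * of_nat ((n - j) choose b) *
     (Y$1$1 ^ a * Y$2$1 ^ (j - a) * Y$1$2 ^ b * Y$2$2 ^ (n - j - b))"

text \<open>Since (s, 1) Z Y = ((s, 1) Z) Y, the linear forms of Z Y are combinations of those of Z.
  Collecting terms with equal a + b would give matrix coefficients of Y; a finite sum whose
  dependence on Z is through matrix coefficients is enough.\<close>

lemma tlnm_mult:
  assumes "j \<le> n"
  shows "tlnm n j k (Z ** Y) = (\<Sum>a\<le>j. \<Sum>b\<le>n - j. tmult_coeff n j a b Y * tlnm n (a + b) k Z)"
proof -
  define u where "u = [:Z$2$1, Z$1$1:]"
  define v where "v = [:Z$2$2, Z$1$2:]"
  have "[:(Z ** Y)$2$1, (Z ** Y)$1$1:] = smult (Y$1$1) u + smult (Y$2$1) v"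
    "[:(Z ** Y)$2$2, (Z ** Y)$1$2:] = smult (Y$1$2) u + smult (Y$2$2) v"
    by (simp_all add: matrix_matrix_mult_def sum_2 u_def v_def mult.commute)
  then have "tpoly n j (Z ** Y) = (smult (Y$1$1) u + smult (Y$2$1) v) ^ j * (smult (Y$1$2) u + smult (Y$2$2) v) ^ (n - j)"
    by (simp add: tpoly_def)
  also have "\<dots> = (\<Sum>a\<le>j. \<Sum>b\<le>n - j. smult (tmult_coeff n j a b Y) (u ^ (a + b) * v ^ (n - (a + b))))"
    unfolding binomial_ring sum_product
  proof (intro sum.cong refl)
    fix a b assume "a \<in> {..j}" "b \<in> {..n - j}"
    then have e: "n - (a + b) = (j - a) + (n - j - b)" using assms by auto
    show "of_nat (j choose a) * smult (Y$1$1) u ^ a * smult (Y$2$1) v ^ (j - a) *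
      (of_nat ((n - j) choose b) * smult (Y$1$2) u ^ b * smult (Y$2$2) v ^ (n - j - b)) =
      smult (tmult_coeff n j a b Y) (u ^ (a + b) * v ^ (n - (a + b)))"
      unfolding e power_add smult_power of_nat_poly tmult_coeff_def
      by (simp add: mult_ac)
  qed
  finally show ?thesis
    unfolding tlnm_eq_coeff by (simp add: coeff_sum tpoly_def u_def v_def)
qed

definition adj2 :: "mat2 \<Rightarrow> mat2" where
  "adj2 W = vector [vector [W$2$2, - W$1$2], vector [- W$2$1, W$1$1]]"

text \<open>Z adj(W) has trace B(W, Z) and determinant N(W) N(Z); multiplicativity of the symmetric
  power then separates the variables.\<close>

lemma kern_expansion:
  "kern n W Z = (\<Sum>j\<le>n. \<Sum>a\<le>j. \<Sum>b\<le>n - j. tmult_coeff n j a b (adj2 W) * tlnm n (a + b) j Z)"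
proof -
  have "kern n W Z = hsym n ((Z ** adj2 W)$1$1 + (Z ** adj2 W)$2$2) (NN (Z ** adj2 W))"
    unfolding kern_def
    by (rule arg_cong2[where f = "hsym n"]) 
      (simp_all add: matrix_matrix_mult_def sum_2 adj2_def polar_def NN_def algebra_simps)
  then show ?thesis by (simp add: sum_tlnm_diag[symmetric] tlnm_mult)
qed

lemma continuous_tmult_coeff: "continuous_on UNIV (\<lambda>p. tmult_coeff n j a b (adj2 (R *\<^sub>R uparam p)))"
proof -
  have "tmult_coeff n j a b (adj2 W) = of_nat (j choose a) * of_nat ((n - j) choose b) *
     (W$2$2 ^ a * (- W$2$1) ^ (j - a) * (- W$1$2) ^ b * W$1$1 ^ (n - j - b))" for W
    by (simp add: tmult_coeff_def adj2_def)
  then show ?thesis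
    by (simp del: vector_scaleR_component) 
      (intro continuous_intros trigpoly_continuous[OF trigpoly_scaleR_uparam])
qed

subsection \<open>Convergence of the expansion\<close>

text \<open>The squared length of u^* Z, that is, the Hermitian form of Z Z^* at u.\<close>

definition rowq :: "mat2 \<Rightarrow> complex^2 \<Rightarrow> real" where
  "rowq Z u = (cmod (cnj (u$1) * Z$1$1 + cnj (u$2) * Z$2$1))^2 + (cmod (cnj (u$1) * Z$1$2 + cnj (u$2) * Z$2$2))^2"

lemma rowq_eq: "Re (\<Sum>i\<in>UNIV. \<Sum>j\<in>UNIV. cnj (u$i) * (Z ** cadj Z)$i$j * u$j) = rowq Z u"
proof -
  have "(\<Sum>i\<in>UNIV. \<Sum>j\<in>UNIV. cnj (u$i) * (Z ** cadj Z)$i$j * u$j) = of_real (rowq Z u)"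
    unfolding rowq_def of_real_add complex_norm_square
    by (simp add: matrix_matrix_mult_def cadj_def sum_2 algebra_simps)
  then show ?thesis by (metis Re_complex_of_real)
qed

lemma norm_vec2_sq: "(norm u)^2 = (cmod (u$1))^2 + (cmod (u$2))^2" for u :: "complex^2"
  by (simp add: norm_vec_def L2_set_def sum_2)

lemma mat_quadratic_form:
  "Re (\<Sum>i\<in>UNIV. \<Sum>j\<in>UNIV. cnj (u$i) * (mat (of_real c) :: mat2)$i$j * u$j) = c * (norm u)^2"
proof -
  have "(\<Sum>i\<in>UNIV. \<Sum>j\<in>UNIV. cnj (u$i) * (mat (of_real c) :: mat2)$i$j * u$j) = of_real (c * (norm u)^2)"
    unfolding norm_vec2_sq of_real_mult of_real_add complex_norm_square
    by (simp add: mat_def sum_2 algebra_simps)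
  then show ?thesis by (metis Re_complex_of_real)
qed

lemma Dplus_iff: "Z \<in> Dplus R \<longleftrightarrow> (\<forall>u. u \<noteq> 0 \<longrightarrow> rowq Z u < R^2 * (norm u)^2)"
proof -
  have "Re (\<Sum>i\<in>UNIV. \<Sum>j\<in>UNIV. cnj (u$i) * (mat (of_real (R^2)) - Z ** cadj Z)$i$j * u$j) = R^2 * (norm u)^2 - rowq Z u" for u
    unfolding rowq_eq[symmetric] mat_quadratic_form[symmetric]
    by (simp add: sum_2 algebra_simps)
  then show ?thesis by (simp add: Dplus_def posdef2_def)
qed

lemma Dminus_iff: "Z \<in> Dminus R \<longleftrightarrow> (\<forall>u. u \<noteq> 0 \<longrightarrow> R^2 * (norm u)^2 < rowq Z u)"
proof -
  have "Re (\<Sum>i\<in>UNIV. \<Sum>j\<in>UNIV. cnj (u$i) * (Z ** cadj Z - mat (of_real (R^2)))$i$j * u$j) = rowq Z u - R^2 * (norm u)^2" for u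
    unfolding rowq_eq[symmetric] mat_quadratic_form[symmetric]
    by (simp add: sum_2 algebra_simps)
  then show ?thesis by (simp add: Dminus_def posdef2_def)
qed

lemma rowq_scaleR: "rowq Z (c *\<^sub>R u) = c^2 * rowq Z u"
proof -
  have e: "cnj ((c *\<^sub>R u) $ 1) * x + cnj ((c *\<^sub>R u) $ 2) * y = of_real c * (cnj (u $ 1) * x + cnj (u $ 2) * y)" for x y
    by (simp add: scaleR_conv_of_real[where 'a = complex] algebra_simps)
  show ?thesis
    unfolding rowq_def e unfolding norm_mult norm_of_real power_mult_distrib power2_abs unfolding distrib_left ..
qed

lemma rowq_normalize: "rowq Z u = (norm u)^2 * rowq Z ((1 / norm u) *\<^sub>R u)" if "u \<noteq> 0"
  using that by (simp add: rowq_scaleR power_divide)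

lemma continuous_rowq: "continuous_on A (rowq Z)"
  unfolding rowq_def by (intro continuous_intros)

lemma sphere_vec2_ne: "sphere 0 1 \<noteq> ({} :: (complex^2) set)"
  using vector_choose_size[of 1, where 'a = "complex^2"] by auto

text \<open>The form attains its maximum on the compact unit sphere, so the strict inequality holds
  with a margin: the constant is the largest singular value of Z divided by R.\<close>

lemma Dplus_uniform:
  assumes "Z \<in> Dplus R" "R > 0"
  shows "\<exists>\<rho>\<ge>0. \<rho> < 1 \<and> (\<forall>u. rowq Z u \<le> \<rho>^2 * (R^2 * (norm u)^2))"
proof -
  obtain v where v: "v \<in> sphere 0 1" "\<And>u. u \<in> sphere 0 1 \<Longrightarrow> rowq Z u \<le> rowq Z v"
    using continuous_attains_sup[OF compact_sphere sphere_vec2_ne continuous_rowq] by metis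
  have q: "0 \<le> rowq Z v" by (simp add: rowq_def)
  have v1: "norm v = 1" "v \<noteq> 0" using v(1) by auto
  then have "rowq Z v < R^2" using assms(1) unfolding Dplus_iff by (metis mult_1_right power_one)
  define \<rho> where "\<rho> = sqrt (rowq Z v) / R"
  have \<rho>2: "\<rho>^2 * R^2 = rowq Z v" using q assms(2) by (simp add: \<rho>_def power_divide)
  show ?thesis
  proof (intro exI[of _ \<rho>] conjI allI)
    show "0 \<le> \<rho>" using q assms(2) by (simp add: \<rho>_def)
    show "\<rho> < 1" using \<open>rowq Z v < R^2\<close> assms(2) by (simp add: \<rho>_def real_less_lsqrt)
    show "rowq Z u \<le> \<rho>^2 * (R^2 * (norm u)^2)" for u
    proof (cases "u = 0")
      case False
      then have "rowq Z ((1 / norm u) *\<^sub>R u) \<le> rowq Z v" by (intro v) auto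
      then show ?thesis 
        unfolding rowq_normalize[OF False] mult.assoc[symmetric] \<rho>2 by (metis mult.commute mult_left_mono zero_le_power2)
    qed (simp add: rowq_def)
  qed
qed

text \<open>Here the minimum is used: the constant is R divided by the smallest singular value of
  Z.\<close>

lemma Dminus_uniform:
  assumes "Z \<in> Dminus R" "R > 0"
  shows "\<exists>\<rho>\<ge>0. \<rho> < 1 \<and> (\<forall>u. R^2 * (norm u)^2 \<le> \<rho>^2 * rowq Z u)"
proof -
  obtain v where v: "v \<in> sphere 0 1" "\<And>u. u \<in> sphere 0 1 \<Longrightarrow> rowq Z v \<le> rowq Z u"
    using continuous_attains_inf[OF compact_sphere sphere_vec2_ne continuous_rowq] by metis
  have v1: "norm v = 1" "v \<noteq> 0" using v(1) by auto
  then have q: "R^2 < rowq Z v" using assms(1) unfolding Dminus_iff by (metis mult_1_right power_one)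
  then have q0: "rowq Z v > 0" using assms(2) by (metis order_less_trans zero_less_power)
  define \<rho> where "\<rho> = R / sqrt (rowq Z v)"
  have \<rho>2: "\<rho>^2 * rowq Z v = R^2" using q0 by (simp add: \<rho>_def power_divide)
  show ?thesis
  proof (intro exI[of _ \<rho>] conjI allI)
    show "0 \<le> \<rho>" using q0 assms(2) by (simp add: \<rho>_def)
    show "\<rho> < 1" using q q0 assms(2) by (simp add: \<rho>_def real_less_rsqrt)
    show "R^2 * (norm u)^2 \<le> \<rho>^2 * rowq Z u" for u
    proof (cases "u = 0")
      case False
      then have "rowq Z v \<le> rowq Z ((1 / norm u) *\<^sub>R u)" by (intro v) auto
      then have "\<rho>^2 * ((norm u)^2 * rowq Z v) \<le> \<rho>^2 * ((norm u)^2 * rowq Z ((1 / norm u) *\<^sub>R u))"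
        by (intro mult_left_mono) auto
      then show ?thesis 
        unfolding rowq_normalize[OF False, symmetric] \<rho>2[symmetric] by (simp only: mult_ac)
    qed (simp add: rowq_def)
  qed
qed

lemma rowq_scaleR_uparam: "rowq (R *\<^sub>R uparam p) u = R^2 * (norm u)^2"
proof -
  define a b e where abbr: "a = of_real (cos (p$1)) * cis (p$2)" "b = of_real (sin (p$1)) * cis (p$3)" "e = cis (p$4)"
  have ab: "a * cnj a + b * cnj b = 1"
    using of_real_sin_cos_1[of "p$1"] by (simp add: abbr cis_cnj mult_ac cis_mult)
  have ee: "e * cnj e = 1" by (simp add: abbr cis_cnj cis_mult)
  have W: "(R *\<^sub>R uparam p)$1$1 = of_real R * a" "(R *\<^sub>R uparam p)$1$2 = of_real R * (- (e * cnj b))"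
    "(R *\<^sub>R uparam p)$2$1 = of_real R * b" "(R *\<^sub>R uparam p)$2$2 = of_real R * (e * cnj a)"
    unfolding scaleR_uparam_nth abbr by (simp_all add: cis_cnj mult_ac)
  let ?u = "u$1" and ?v = "u$2"
  have "complex_of_real (rowq (R *\<^sub>R uparam p) u) = of_real (R^2) * 
     ((cnj ?u * a + cnj ?v * b) * (?u * cnj a + ?v * cnj b) + (e * cnj e) * ((cnj ?v * cnj a - cnj ?u * cnj b) * (?v * a - ?u * b)))"
    unfolding rowq_def of_real_add complex_norm_square W
    by (simp add: algebra_simps power2_eq_square)
  also have "\<dots> = of_real (R^2) * ((a * cnj a + b * cnj b) * (cnj ?u * ?u + cnj ?v * ?v))"
    unfolding ee by (simp add: algebra_simps)
  also have "\<dots> = of_real (R^2 * (norm u)^2)"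
    unfolding norm_vec2_sq of_real_mult of_real_add complex_norm_square ab
    by (simp add: algebra_simps)
  finally show ?thesis by (metis of_real_eq_iff)
qed

lemma NN_eq_0_left_kernel:
  assumes "NN A = 0"
  obtains u :: "complex^2" where "u \<noteq> 0" "cnj (u$1) * A$1$1 + cnj (u$2) * A$2$1 = 0" 
    "cnj (u$1) * A$1$2 + cnj (u$2) * A$2$2 = 0"
proof -
  have A: "A$1$1 * A$2$2 = A$1$2 * A$2$1" using assms by (simp add: NN_def)
  consider "A$1$1 \<noteq> 0 \<or> A$2$1 \<noteq> 0" | "A$1$2 \<noteq> 0 \<or> A$2$2 \<noteq> 0" | "A$1$1 = 0" "A$2$1 = 0" "A$1$2 = 0" "A$2$2 = 0"
    by blast
  then show thesis
  proof cases
    case 1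
    show ?thesis
      by (rule that[of "vector [cnj (A$2$1), - cnj (A$1$1)]"]) 
        (use 1 A in \<open>auto simp: vec_eq_iff forall_2 mult_ac\<close>)
  next
    case 2
    show ?thesis
      by (rule that[of "vector [cnj (A$2$2), - cnj (A$1$2)]"]) 
        (use 2 A in \<open>auto simp: vec_eq_iff forall_2 mult_ac\<close>)
  next
    case 3
    show ?thesis
      by (rule that[of "vector [1, 0]"]) (use 3 in \<open>auto simp: vec_eq_iff forall_2\<close>)
  qed
qed

text \<open>The hypothesis is det(Z - z W) = 0, and a left kernel vector u satisfies u^* Z = z u^*
  W.\<close>

lemma NN_pencil_eq_0:
  assumes "z^2 * NN W - z * polar W Z + NN Z = 0"
  obtains u :: "complex^2" where "u \<noteq> 0" "rowq Z u = (cmod z)^2 * rowq W u"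
proof -
  define A :: mat2 where "A = (\<chi> i j. Z$i$j - z * W$i$j)"
  have "NN A = 0" using assms by (simp add: A_def NN_def polar_def algebra_simps power2_eq_square)
  then obtain u :: "complex^2" where u: "u \<noteq> 0" "cnj (u$1) * A$1$1 + cnj (u$2) * A$2$1 = 0" 
    "cnj (u$1) * A$1$2 + cnj (u$2) * A$2$2 = 0" by (rule NN_eq_0_left_kernel)
  have "cnj (u$1) * Z$1$j + cnj (u$2) * Z$2$j = z * (cnj (u$1) * W$1$j + cnj (u$2) * W$2$j)" if "j = 1 \<or> j = 2" for j
    using that u by (auto simp: A_def algebra_simps)
  then have "rowq Z u = (cmod z)^2 * rowq W u"
    unfolding rowq_def by (simp only: norm_mult power_mult_distrib distrib_left[of "_^2"] simp_thms)
  with u(1) show thesis by (rule that)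
qed

section \<open>The series for 1 / N(W - Z)\<close>

lemma polar_commute: "polar W Z = polar Z W"
  by (simp add: polar_def algebra_simps)

lemma complex_quadratic_roots:
  obtains x y :: complex where "x + y = b" "x * y = c" 
proof
  let ?r = "csqrt (b^2 - 4 * c)"
  show "(b + ?r) / 2 + (b - ?r) / 2 = b" by (simp add: field_simps)
  have "((b + ?r) / 2) * ((b - ?r) / 2) = (b^2 - ?r^2) / 4" by (simp add: algebra_simps power2_eq_square)
  then show "((b + ?r) / 2) * ((b - ?r) / 2) = c" by simp
qed

lemma summable_Suc_power: "0 \<le> r \<Longrightarrow> r < 1 \<Longrightarrow> summable (\<lambda>n. of_nat (Suc n) * r ^ n)" for r :: real
  using geometric_deriv_sums[of r] by (auto simp: sums_iff)

text \<open>Here b and c are the sum and product of two roots of size at most r, which gives the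
  bound. Once the series converges, the recursion forces S (1 - b + c) = 1; this also shows that the
  denominator is nonzero.\<close>

lemma hsym_bound_sums:
  assumes "\<And>z. z^2 - b * z + c = 0 \<Longrightarrow> cmod z \<le> r" "r < 1"
  shows "norm (hsym n b c) \<le> of_nat (Suc n) * r ^ n"
    and "1 - b + c \<noteq> 0"
    and "(\<lambda>n. hsym n b c) sums inverse (1 - b + c)"
proof -
  obtain x y where xy: "x + y = b" "x * y = c" by (rule complex_quadratic_roots)
  have x: "cmod x \<le> r" and y: "cmod y \<le> r"
    by (rule assms(1); simp add: xy[symmetric] algebra_simps power2_eq_square)+
  have r: "0 \<le> r" using x norm_ge_zero order_trans by blast
  have bound: "norm (hsym n b c) \<le> of_nat (Suc n) * r ^ n" for n
    using norm_hsym_le[OF x y] by (simp add: xy)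
  then show "norm (hsym n b c) \<le> of_nat (Suc n) * r ^ n" .
  have s: "summable (\<lambda>n. hsym n b c)"
    by (rule summable_comparison_test'[OF summable_Suc_power[OF r assms(2)]]) (use bound in auto)
  define S where "S = (\<Sum>n. hsym n b c)"
  have s1: "summable (\<lambda>n. hsym (Suc n) b c)" using s by (subst summable_Suc_iff)
  have S1: "(\<Sum>n. hsym (Suc n) b c) = S - 1"
    using suminf_split_head[OF s] by (simp add: S_def)
  have S2: "(\<Sum>n. hsym (Suc (Suc n)) b c) = S - 1 - b"
    using suminf_split_head[OF s1] by (simp add: S1)
  have "(\<Sum>n. hsym (Suc (Suc n)) b c) = b * (S - 1) - c * S"
    using s s1 by (simp add: suminf_diff[symmetric] suminf_mult summable_mult S1 S_def[symmetric])
  then have *: "S * (1 - b + c) = 1" unfolding S2 by (simp add: algebra_simps)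
  then show "1 - b + c \<noteq> 0" by auto
  with * have "S = inverse (1 - b + c)" by (simp add: field_simps)
  then show "(\<lambda>n. hsym n b c) sums inverse (1 - b + c)" using s by (simp add: S_def sums_iff)
qed

text \<open>Dividing N(W) - B(W, Z) + N(Z) by either N(W) or N(Z) gives 1 - b + c with the same
  formulas for b and c in terms of \<open>\<nu>\<close>, so both expansions are instances.\<close>

lemma kern_bound_sums:
  assumes "\<nu> \<noteq> 0" "\<nu> = NN W \<or> \<nu> = NN Z" "r < 1"
    and "\<And>z. \<nu> * z^2 - polar W Z * z + NN W * NN Z / \<nu> = 0 \<Longrightarrow> cmod z \<le> r"
  shows "norm (inverse \<nu> ^ n * kern n W Z) \<le> of_nat (Suc n) * r ^ n"
    and "NN (W - Z) \<noteq> 0"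
    and "(\<lambda>n. inverse \<nu> ^ n * kern n W Z) sums (\<nu> / NN (W - Z))"
proof -
  let ?b = "inverse \<nu> * polar W Z" and ?c = "inverse \<nu> ^ 2 * (NN W * NN Z)"
  have k: "hsym n ?b ?c = inverse \<nu> ^ n * kern n W Z" for n
    unfolding kern_def hsym_homogeneous ..
  have roots: "cmod z \<le> r" if "z^2 - ?b * z + ?c = 0" for z
  proof (rule assms(4))
    have "\<nu> * z^2 - polar W Z * z + NN W * NN Z / \<nu> = \<nu> * (z^2 - ?b * z + ?c)"
      using assms(1) by (simp add: field_simps power2_eq_square)
    then show "\<nu> * z^2 - polar W Z * z + NN W * NN Z / \<nu> = 0" using that by simp
  qed
  have e: "1 - ?b + ?c = NN (W - Z) / \<nu>"
    using assms(1,2) unfolding NN_diff by (auto simp: field_simps power2_eq_square)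
  show "norm (inverse \<nu> ^ n * kern n W Z) \<le> of_nat (Suc n) * r ^ n"
    unfolding k[symmetric] by (rule hsym_bound_sums(1)[OF roots assms(3)])
  have "1 - ?b + ?c \<noteq> 0"
    by (rule hsym_bound_sums(2)[OF roots assms(3)])
  then show "NN (W - Z) \<noteq> 0"
    unfolding e by auto
  have "(\<lambda>n. hsym n ?b ?c) sums inverse (1 - ?b + ?c)"
    by (rule hsym_bound_sums(3)[OF roots assms(3)])
  then show "(\<lambda>n. inverse \<nu> ^ n * kern n W Z) sums (\<nu> / NN (W - Z))"
    unfolding k e by simp
qed

text \<open>The choice \<open>\<nu> = NN W\<close> makes the relevant roots those of N(Z - z W). The
  form of W W^* is R^2 times the squared norm, so one bound r serves all W.\<close>

lemma Dplus_expansion: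
  assumes "Z \<in> Dplus R" "R > 0"
  shows "\<exists>r\<ge>0. r < 1
    \<and> (\<forall>p n. norm (inverse (NN (R *\<^sub>R uparam p)) ^ n * kern n (R *\<^sub>R uparam p) Z) \<le> of_nat (Suc n) * r ^ n)
    \<and> (\<forall>p. NN (R *\<^sub>R uparam p - Z) \<noteq> 0)
    \<and> (\<forall>p. (\<lambda>n. inverse (NN (R *\<^sub>R uparam p)) ^ n * kern n (R *\<^sub>R uparam p) Z) sums (NN (R *\<^sub>R uparam p) / NN (R *\<^sub>R uparam p - Z)))"
proof -
  obtain r where r: "0 \<le> r" "r < 1" "\<And>u. rowq Z u \<le> r^2 * (R^2 * (norm u)^2)"
    using Dplus_uniform[OF assms] by blast
  have nz: "NN (R *\<^sub>R uparam p) \<noteq> 0" for p by (rule NN_scaleR_uparam_nonzero[OF assms(2)])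
  have root: "cmod z \<le> r" if "NN (R *\<^sub>R uparam p) * z^2 - polar (R *\<^sub>R uparam p) Z * z + NN (R *\<^sub>R uparam p) * NN Z / NN (R *\<^sub>R uparam p) = 0" for z p
  proof -
    have "z^2 * NN (R *\<^sub>R uparam p) - z * polar (R *\<^sub>R uparam p) Z + NN Z = 0"
      using that nz[of p] by (simp add: mult.commute)
    then obtain u :: "complex^2" where u: "u \<noteq> 0" "rowq Z u = (cmod z)^2 * rowq (R *\<^sub>R uparam p) u" by (rule NN_pencil_eq_0)
    have "(cmod z)^2 * (R^2 * (norm u)^2) \<le> r^2 * (R^2 * (norm u)^2)"
      using r(3)[of u] u(2) by (simp add: rowq_scaleR_uparam)
    then have "(cmod z)^2 \<le> r^2" using u(1) assms(2) by simp
    then show ?thesis using r(1) by (rule power2_le_imp_le)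
  qed
  have "norm (inverse (NN (R *\<^sub>R uparam p)) ^ n * kern n (R *\<^sub>R uparam p) Z) \<le> of_nat (Suc n) * r ^ n" 
    "NN (R *\<^sub>R uparam p - Z) \<noteq> 0"
    "(\<lambda>n. inverse (NN (R *\<^sub>R uparam p)) ^ n * kern n (R *\<^sub>R uparam p) Z) sums (NN (R *\<^sub>R uparam p) / NN (R *\<^sub>R uparam p - Z))" for p n
    by (rule kern_bound_sums[OF nz disjI1[OF refl] r(2)], erule root)+
  with r(1,2) show ?thesis by blast 
qed

lemma Dminus_NN_nonzero:
  assumes "Z \<in> Dminus R" "R > 0"
  shows "NN Z \<noteq> 0"
proof
  assume "NN Z = 0"
  then obtain u :: "complex^2" where u: "u \<noteq> 0" "cnj (u$1) * Z$1$1 + cnj (u$2) * Z$2$1 = 0" 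
    "cnj (u$1) * Z$1$2 + cnj (u$2) * Z$2$2 = 0" by (rule NN_eq_0_left_kernel)
  then have "rowq Z u = 0" by (simp add: rowq_def)
  moreover have "R^2 * (norm u)^2 < rowq Z u" using assms(1) u(1) by (simp add: Dminus_iff)
  moreover have "0 \<le> R^2 * (norm u)^2" by simp
  ultimately show False by linarith
qed

text \<open>The choice \<open>\<nu> = NN Z\<close> exchanges the roles: the roots are those of N(W -
  z Z).\<close>

lemma Dminus_expansion:
  assumes "Z \<in> Dminus R" "R > 0"
  shows "\<exists>r\<ge>0. r < 1
    \<and> (\<forall>p n. norm (inverse (NN Z) ^ n * kern n (R *\<^sub>R uparam p) Z) \<le> of_nat (Suc n) * r ^ n)
    \<and> (\<forall>p. NN (R *\<^sub>R uparam p - Z) \<noteq> 0)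
    \<and> (\<forall>p. (\<lambda>n. inverse (NN Z) ^ n * kern n (R *\<^sub>R uparam p) Z) sums (NN Z / NN (R *\<^sub>R uparam p - Z)))"
proof -
  obtain r where r: "0 \<le> r" "r < 1" "\<And>u. R^2 * (norm u)^2 \<le> r^2 * rowq Z u"
    using Dminus_uniform[OF assms] by blast
  have nz: "NN Z \<noteq> 0" by (rule Dminus_NN_nonzero[OF assms])
  have root: "cmod z \<le> r" if "NN Z * z^2 - polar (R *\<^sub>R uparam p) Z * z + NN (R *\<^sub>R uparam p) * NN Z / NN Z = 0" for z p
  proof -
    have "z^2 * NN Z - z * polar Z (R *\<^sub>R uparam p) + NN (R *\<^sub>R uparam p) = 0"
      using that nz by (simp add: mult.commute polar_commute)
    then obtain u :: "complex^2" where u: "u \<noteq> 0" "rowq (R *\<^sub>R uparam p) u = (cmod z)^2 * rowq Z u" by (rule NN_pencil_eq_0)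
    have "R^2 * (norm u)^2 < rowq Z u" using assms(1) u(1) by (simp add: Dminus_iff)
    moreover have "0 \<le> R^2 * (norm u)^2" by simp
    ultimately have "rowq Z u > 0" by linarith
    moreover have "(cmod z)^2 * rowq Z u \<le> r^2 * rowq Z u"
      using r(3)[of u] u(2) by (simp add: rowq_scaleR_uparam)
    ultimately have "(cmod z)^2 \<le> r^2" by simp
    then show ?thesis using r(1) by (rule power2_le_imp_le)
  qed
  have "norm (inverse (NN Z) ^ n * kern n (R *\<^sub>R uparam p) Z) \<le> of_nat (Suc n) * r ^ n" 
    "NN (R *\<^sub>R uparam p - Z) \<noteq> 0"
    "(\<lambda>n. inverse (NN Z) ^ n * kern n (R *\<^sub>R uparam p) Z) sums (NN Z / NN (R *\<^sub>R uparam p - Z))" for p n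
    by (rule kern_bound_sums[OF nz disjI2[OF refl] r(2)], erule root)+
  with r(1,2) show ?thesis by blast
qed

text \<open>The Weierstrass test gives uniform convergence on the parameter box, which supplies both
  the integrability of the limit and the exchange of sum and integral.\<close>

lemma avg_sums:
  assumes cont: "\<And>n. continuous_on UNIV (g n)" and bound: "\<And>n p. norm (g n p) \<le> M n"
    and "summable M" and sums: "\<And>p. (\<lambda>n. g n p) sums G p"
  shows "(\<lambda>n. avg (g n)) sums avg G"
proof -
  let ?w = "\<lambda>p::real^4. complex_of_real (sin (p$1) * cos (p$1))"
  let ?B = "cbox pbox_lo pbox_hi"
  have w: "norm (?w p) \<le> 1" for p
    unfolding norm_of_real abs_mult by (rule mult_le_one) simp_all
  have s: "(\<lambda>n. g n p * ?w p) sums (G p * ?w p)" for p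
    by (rule sums_mult2[OF sums])
  have c: "continuous_on A (\<lambda>p. g n p * ?w p)" for n A
    by (intro continuous_intros continuous_on_subset[OF cont]) auto
  have "uniform_limit ?B (\<lambda>n p. \<Sum>i<n. g i p * ?w p) (\<lambda>p. \<Sum>i. g i p * ?w p) sequentially"
  proof (rule Weierstrass_m_test[OF _ \<open>summable M\<close>])
    fix n p
    have "norm (g n p * ?w p) \<le> M n * 1"
      unfolding norm_mult[of "g n p"] 
      by (intro mult_mono bound w norm_ge_zero order_trans[OF norm_ge_zero bound])
    then show "norm (g n p * ?w p) \<le> M n" by simp
  qed
  then have "uniform_limit ?B (\<lambda>n p. \<Sum>i<n. g i p * ?w p) (\<lambda>p. G p * ?w p) sequentially"
    using s by (simp add: sums_iff)
  then obtain I J where IJ: "\<And>n. ((\<lambda>p. \<Sum>i<n. g i p * ?w p) has_integral I n) ?B"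
     "((\<lambda>p. G p * ?w p) has_integral J) ?B" "I \<longlonglongrightarrow> J"
    by (rule uniform_limit_integral_cbox) (auto intro!: continuous_on_sum c simp del: of_real_mult)
  have "I n = (\<Sum>i<n. integral ?B (\<lambda>p. g i p * ?w p))" for n
    using IJ(1)[of n] by (subst integral_sum[symmetric]) (auto intro!: integrable_continuous c simp: has_integral_iff simp del: of_real_mult)
  then have I: "I = (\<lambda>n. \<Sum>i<n. integral ?B (\<lambda>p. g i p * ?w p))"
    by (rule ext)
  have "(\<lambda>n. integral ?B (\<lambda>p. g n p * ?w p)) sums integral ?B (\<lambda>p. G p * ?w p)"
    using IJ(3) unfolding sums_def I integral_unique[OF IJ(2)] .
  then show ?thesis unfolding avg_def by (rule sums_divide)
qed

lemma trigpoly_bounded: "trigpoly m f \<Longrightarrow> \<exists>B. \<forall>p. norm (f p) \<le> B"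
proof (induction rule: trigpoly.induct)
  case (monom m n k c i j)
  have "norm (trig_monom i j m n k p) \<le> 1" for p
  proof -
    have "\<bar>cos (p$1)\<bar> ^ i \<le> 1" "\<bar>sin (p$1)\<bar> ^ j \<le> 1" by (intro power_le_one; simp)+
    then have "\<bar>cos (p$1)\<bar> ^ i * \<bar>sin (p$1)\<bar> ^ j \<le> 1" by (intro mult_le_one) auto
    then show ?thesis
      unfolding trig_monom_def norm_mult norm_of_real abs_mult power_abs norm_cis by simp
  qed
  then have "norm (c * trig_monom i j m n k p) \<le> norm c" for p
    unfolding norm_mult by (rule mult_left_le) simp
  then show ?case by blast
next
  case (add m f g)
  then obtain A B where "\<forall>p. norm (f p) \<le> A" "\<forall>p. norm (g p) \<le> B" by blast
  then have "norm (f p + g p) \<le> A + B" for p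
    by (intro norm_triangle_mono) auto
  then show ?case by blast
qed

text \<open>The double series is grouped by d = p + q because these groups are homogeneous under the
  circle action. The Cauchy product of the two majorants is a summable majorant.\<close>

lemma avg_Cauchy_product_sums:
  assumes h: "continuous_on UNIV h" "\<And>p. norm (h p) \<le> B"
    and r1: "0 \<le> r1" "r1 < (1::real)" and r2: "0 \<le> r2" "r2 < (1::real)"
    and a1: "\<And>n. continuous_on UNIV (a1 n)" "\<And>n p. norm (a1 n p) \<le> of_nat (Suc n) * r1 ^ n" "\<And>p. (\<lambda>n. a1 n p) sums S1 p"
    and a2: "\<And>n. continuous_on UNIV (a2 n)" "\<And>n p. norm (a2 n p) \<le> of_nat (Suc n) * r2 ^ n" "\<And>p. (\<lambda>n. a2 n p) sums S2 p"
  shows "(\<lambda>d. avg (\<lambda>p. h p * (\<Sum>q\<le>d. a1 q p * a2 (d - q) p))) sums avg (\<lambda>p. h p * (S1 p * S2 p))"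
proof (rule avg_sums)
  let ?M1 = "\<lambda>n. of_nat (Suc n) * r1 ^ n" and ?M2 = "\<lambda>n. of_nat (Suc n) * r2 ^ n"
  show "continuous_on UNIV (\<lambda>p. h p * (\<Sum>q\<le>d. a1 q p * a2 (d - q) p))" for d
    by (intro continuous_intros h a1 a2)
  show "norm (h p * (\<Sum>q\<le>d. a1 q p * a2 (d - q) p)) \<le> B * (\<Sum>q\<le>d. ?M1 q * ?M2 (d - q))" for d p
    unfolding norm_mult[of "h p"]
  proof (intro mult_mono h sum_norm_le norm_ge_zero)
    show "0 \<le> B" by (rule order_trans[OF norm_ge_zero h(2)])
    show "norm (a1 q p * a2 (d - q) p) \<le> ?M1 q * ?M2 (d - q)" for q
      unfolding norm_mult by (intro mult_mono a1 a2 norm_ge_zero) (use r1 in simp)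
  qed
  have s: "summable ?M1" "summable ?M2"
    by (rule summable_Suc_power[OF r1], rule summable_Suc_power[OF r2])
  have "summable (\<lambda>n. norm (?M1 n))" "summable (\<lambda>n. norm (?M2 n))"
    using s r1 r2 by (simp_all add: abs_mult)
  then show "summable (\<lambda>d. B * (\<Sum>q\<le>d. ?M1 q * ?M2 (d - q)))"
    by (intro summable_mult summable_Cauchy_product)
  show "(\<lambda>d. h p * (\<Sum>q\<le>d. a1 q p * a2 (d - q) p)) sums (h p * (S1 p * S2 p))" for p
  proof (rule sums_mult)
    have "summable (\<lambda>n. norm (a1 n p))" "summable (\<lambda>n. norm (a2 n p))"
      using a1(2) a2(2) by (auto intro: summable_comparison_test'[OF s(1)] summable_comparison_test'[OF s(2)])
    from Cauchy_product_sums[OF this] show "(\<lambda>d. \<Sum>q\<le>d. a1 q p * a2 (d - q) p) sums (S1 p * S2 p)"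
      using a1(3)[of p] a2(3)[of p] by (simp add: sums_iff)
  qed
qed

text \<open>The d-th group has degree m - d: m from f, - 2d from N(W)^(-d) and d from the kernels.
  Hence only d = m contributes.\<close>

lemma IR_Dplus:
  assumes "R > 0" "Z1 \<in> Dplus R" "Z2 \<in> Dplus R" and f: "trigpoly m (\<lambda>p. f (R *\<^sub>R uparam p))"
  shows "IR R f Z1 Z2 = (if 0 \<le> m then avg (\<lambda>p. f (R *\<^sub>R uparam p) * NN (R *\<^sub>R uparam p) powi (- m) *
     (\<Sum>q\<le>nat m. kern q (R *\<^sub>R uparam p) Z1 * kern (nat m - q) (R *\<^sub>R uparam p) Z2)) else 0)" (is "_ = ?rhs")
proof -
  define W where "W = (\<lambda>p. R *\<^sub>R uparam p)"
  have nz: "NN (W p) \<noteq> 0" for p unfolding W_def by (rule NN_scaleR_uparam_nonzero[OF assms(1)])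
  obtain B where B: "\<And>p. norm (f (W p)) \<le> B" using trigpoly_bounded[OF f] unfolding W_def by blast
  obtain r1 where r1: "0 \<le> r1" "r1 < 1"
    "\<And>p n. norm (inverse (NN (W p)) ^ n * kern n (W p) Z1) \<le> of_nat (Suc n) * r1 ^ n"
    "\<And>p. (\<lambda>n. inverse (NN (W p)) ^ n * kern n (W p) Z1) sums (NN (W p) / NN (W p - Z1))"
    using Dplus_expansion[OF assms(2,1)] unfolding W_def by blast
  obtain r2 where r2: "0 \<le> r2" "r2 < 1"
    "\<And>p n. norm (inverse (NN (W p)) ^ n * kern n (W p) Z2) \<le> of_nat (Suc n) * r2 ^ n"
    "\<And>p. (\<lambda>n. inverse (NN (W p)) ^ n * kern n (W p) Z2) sums (NN (W p) / NN (W p - Z2))"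
    using Dplus_expansion[OF assms(3,1)] unfolding W_def by blast
  have cN: "continuous_on UNIV (\<lambda>p. NN (W p))" unfolding W_def by (rule trigpoly_continuous[OF trigpoly_NN])
  have ck: "continuous_on UNIV (\<lambda>p. inverse (NN (W p)) ^ n * kern n (W p) Z)" for n Z
    using nz by (intro continuous_intros cN) (auto simp: W_def trigpoly_continuous[OF trigpoly_kern])
  let ?g = "\<lambda>d p. f (W p) * NN (W p) powi (- int d) * (\<Sum>q\<le>d. kern q (W p) Z1 * kern (d - q) (W p) Z2)"
  have g: "f (W p) * (\<Sum>q\<le>d. (inverse (NN (W p)) ^ q * kern q (W p) Z1) * (inverse (NN (W p)) ^ (d - q) * kern (d - q) (W p) Z2)) = ?g d p" for d p
  proof -
    have e: "(inverse (NN (W p)) ^ q * kern q (W p) Z1) * (inverse (NN (W p)) ^ (d - q) * kern (d - q) (W p) Z2) 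
       = NN (W p) powi (- int d) * (kern q (W p) Z1 * kern (d - q) (W p) Z2)" if "q \<le> d" for q
    proof -
      have "NN (W p) powi (- int d) = inverse (NN (W p)) ^ q * inverse (NN (W p)) ^ (d - q)"
        unfolding power_add[symmetric] using that by (simp add: power_int_minus power_inverse)
      then show ?thesis by (simp only: mult_ac)
    qed
    have S: "(\<Sum>q\<le>d. (inverse (NN (W p)) ^ q * kern q (W p) Z1) * (inverse (NN (W p)) ^ (d - q) * kern (d - q) (W p) Z2))
      = (\<Sum>q\<le>d. NN (W p) powi (- int d) * (kern q (W p) Z1 * kern (d - q) (W p) Z2))"
      by (rule sum.cong[OF refl], rule e) simp
    show ?thesis unfolding S sum_distrib_left[symmetric] by (rule mult.assoc[symmetric])
  qed
  have "(\<lambda>d. avg (?g d)) sums avg (\<lambda>p. f (W p) * (NN (W p) / NN (W p - Z1) * (NN (W p) / NN (W p - Z2))))"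
    unfolding g[symmetric]
    by (rule avg_Cauchy_product_sums[OF _ B r1(1,2) r2(1,2) ck r1(3,4) ck r2(3,4)]) 
      (use trigpoly_continuous[OF f] in \<open>simp add: W_def\<close>)
  moreover have "avg (\<lambda>p. f (W p) * (NN (W p) / NN (W p - Z1) * (NN (W p) / NN (W p - Z2)))) = IR R f Z1 Z2"
    unfolding IR_eq_avg[OF assms(1)] Let_def W_def by (simp add: power2_eq_square)
  ultimately have S: "(\<lambda>d. avg (?g d)) sums IR R f Z1 Z2" by simp
  have g0: "avg (?g d) = 0" if "int d \<noteq> m" for d
  proof -
    have "trigpoly (m + 2 * (- int d) + int d) (?g d)"
      unfolding W_def
    proof (intro trigpoly_mult trigpoly_sum finite_atMost f trigpoly_NN_powi)
      fix q assume "q \<in> {..d}"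
      then have d: "int d = int q + int (d - q)" by simp
      show "trigpoly (int d) (\<lambda>p. kern q (R *\<^sub>R uparam p) Z1 * kern (d - q) (R *\<^sub>R uparam p) Z2)"
        unfolding d by (intro trigpoly_mult trigpoly_kern)
    qed
    then show ?thesis by (rule trigpoly_avg_eq_0) (use that in simp)
  qed
  show ?thesis
  proof (cases "0 \<le> m")
    case True
    have "avg (?g d) = (if d = nat m then avg (?g (nat m)) else 0)" for d
      using g0[of d] True by auto
    then have "(\<lambda>d. avg (?g d)) = (\<lambda>d. if d = nat m then avg (?g (nat m)) else 0)"
      by (rule ext)
    then have "(\<lambda>d. avg (?g d)) sums avg (?g (nat m))"
      using sums_single[of "nat m" "\<lambda>_. avg (?g (nat m))"] by (simp only:)
    from sums_unique2[OF S this] show ?thesis using True by (simp add: W_def)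
  next
    case False
    then have "avg (?g d) = 0" for d using g0[of d] by simp
    then have "(\<lambda>d. avg (?g d)) sums 0" by simp
    from sums_unique2[OF S this] show ?thesis using False by simp
  qed
qed

text \<open>No powers of 1 / N(W) occur in this expansion, so the d-th group has degree m + 4 + d,
  with 4 coming from N(W)^2. Hence only d = - m - 4 contributes.\<close>

lemma IR_Dminus:
  assumes "R > 0" "Z1 \<in> Dminus R" "Z2 \<in> Dminus R" and f: "trigpoly m (\<lambda>p. f (R *\<^sub>R uparam p))"
  shows "IR R f Z1 Z2 = (if m \<le> - 4 then avg (\<lambda>p. f (R *\<^sub>R uparam p) * NN (R *\<^sub>R uparam p) ^ 2 *
     (\<Sum>q\<le>nat (- m - 4). (inverse (NN Z1) ^ Suc q * kern q (R *\<^sub>R uparam p) Z1) * 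
       (inverse (NN Z2) ^ Suc (nat (- m - 4) - q) * kern (nat (- m - 4) - q) (R *\<^sub>R uparam p) Z2))) else 0)" (is "_ = ?rhs")
proof -
  define W where "W = (\<lambda>p. R *\<^sub>R uparam p)"
  have nz: "NN Z1 \<noteq> 0" "NN Z2 \<noteq> 0" using Dminus_NN_nonzero assms by blast+
  have tf: "trigpoly (m + int 2 * 2) (\<lambda>p. f (W p) * NN (W p) ^ 2)"
    unfolding W_def by (intro trigpoly_mult f trigpoly_power trigpoly_NN)
  obtain B where B: "\<And>p. norm (f (W p) * NN (W p) ^ 2) \<le> B" using trigpoly_bounded[OF tf] by blast
  define h where "h p = inverse (NN Z1) * inverse (NN Z2) * (f (W p) * NN (W p) ^ 2)" for p
  have h: "continuous_on UNIV h" "\<And>p. norm (h p) \<le> norm (inverse (NN Z1) * inverse (NN Z2)) * B"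
    unfolding h_def using trigpoly_continuous[OF trigpoly_cmult[OF tf]] apply blast
    unfolding norm_mult[of "_ * _" "_ * _ ^ 2"] by (intro mult_left_mono B norm_ge_zero)
  obtain r1 where r1: "0 \<le> r1" "r1 < 1"
    "\<And>p n. norm (inverse (NN Z1) ^ n * kern n (W p) Z1) \<le> of_nat (Suc n) * r1 ^ n"
    "\<And>p. (\<lambda>n. inverse (NN Z1) ^ n * kern n (W p) Z1) sums (NN Z1 / NN (W p - Z1))"
    using Dminus_expansion[OF assms(2,1)] unfolding W_def by blast
  obtain r2 where r2: "0 \<le> r2" "r2 < 1"
    "\<And>p n. norm (inverse (NN Z2) ^ n * kern n (W p) Z2) \<le> of_nat (Suc n) * r2 ^ n"
    "\<And>p. (\<lambda>n. inverse (NN Z2) ^ n * kern n (W p) Z2) sums (NN Z2 / NN (W p - Z2))"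
    using Dminus_expansion[OF assms(3,1)] unfolding W_def by blast
  have ck: "continuous_on UNIV (\<lambda>p. inverse (NN Z) ^ n * kern n (W p) Z)" for n Z
    by (intro continuous_intros) (auto simp: W_def trigpoly_continuous[OF trigpoly_kern])
  let ?g = "\<lambda>d p. f (W p) * NN (W p) ^ 2 * (\<Sum>q\<le>d. (inverse (NN Z1) ^ Suc q * kern q (W p) Z1) * (inverse (NN Z2) ^ Suc (d - q) * kern (d - q) (W p) Z2))"
  have g: "h p * (\<Sum>q\<le>d. (inverse (NN Z1) ^ q * kern q (W p) Z1) * (inverse (NN Z2) ^ (d - q) * kern (d - q) (W p) Z2)) = ?g d p" for d p
    unfolding h_def power_Suc sum_distrib_left by (intro sum.cong refl) (simp only: mult_ac)
  have q: "h p * (NN Z1 / NN (W p - Z1) * (NN Z2 / NN (W p - Z2))) = f (W p) * NN (W p) ^ 2 / (NN (W p - Z1) * NN (W p - Z2))" for p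
  proof -
    have "h p * (NN Z1 / NN (W p - Z1) * (NN Z2 / NN (W p - Z2))) = (inverse (NN Z1) * NN Z1) * (inverse (NN Z2) * NN Z2) *
       (f (W p) * NN (W p) ^ 2 / (NN (W p - Z1) * NN (W p - Z2)))"
      by (simp add: h_def divide_inverse mult_ac)
    then show ?thesis using nz by simp
  qed
  have "(\<lambda>d. avg (?g d)) sums avg (\<lambda>p. h p * (NN Z1 / NN (W p - Z1) * (NN Z2 / NN (W p - Z2))))"
    unfolding g[symmetric]
    by (rule avg_Cauchy_product_sums[OF h r1(1,2) r2(1,2) ck r1(3,4) ck r2(3,4)])
  moreover have "avg (\<lambda>p. h p * (NN Z1 / NN (W p - Z1) * (NN Z2 / NN (W p - Z2)))) = IR R f Z1 Z2"
    unfolding q IR_eq_avg[OF assms(1)] Let_def unfolding W_def ..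
  ultimately have S: "(\<lambda>d. avg (?g d)) sums IR R f Z1 Z2" by simp
  have g0: "avg (?g d) = 0" if "int d \<noteq> - m - 4" for d
  proof -
    have "trigpoly (m + int 2 * 2 + int d) (?g d)"
    proof (intro trigpoly_mult[OF tf] trigpoly_sum finite_atMost)
      fix q assume "q \<in> {..d}"
      then have d: "int d = int q + int (d - q)" by simp
      show "trigpoly (int d) (\<lambda>p. (inverse (NN Z1) ^ Suc q * kern q (W p) Z1) * (inverse (NN Z2) ^ Suc (d - q) * kern (d - q) (W p) Z2))"
        unfolding W_def d by (intro trigpoly_mult trigpoly_cmult trigpoly_kern)
    qed
    then show ?thesis by (rule trigpoly_avg_eq_0) (use that in simp)
  qed
  show ?thesis
  proof (cases "m \<le> - 4")
    case True
    have "avg (?g d) = (if d = nat (- m - 4) then avg (?g (nat (- m - 4))) else 0)" for d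
      using g0[of d] True by auto
    then have "(\<lambda>d. avg (?g d)) = (\<lambda>d. if d = nat (- m - 4) then avg (?g (nat (- m - 4))) else 0)"
      by (rule ext)
    then have "(\<lambda>d. avg (?g d)) sums avg (?g (nat (- m - 4)))"
      using sums_single[of "nat (- m - 4)" "\<lambda>_. avg (?g (nat (- m - 4)))"] by (simp only:)
    from sums_unique2[OF S this] show ?thesis using True by (simp add: W_def)
  next
    case False
    then have "avg (?g d) = 0" for d using g0[of d] by simp
    then have "(\<lambda>d. avg (?g d)) sums 0" by simp
    from sums_unique2[OF S this] show ?thesis using False by simp
  qed
qed

subsection \<open>Linearity in the function\<close>

lemma IR_diff_nonzero:
  assumes "R > 0" "Z \<in> Dplus R \<union> Dminus R"
  shows "NN (R *\<^sub>R uparam p - Z) \<noteq> 0"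
  using assms Dplus_expansion Dminus_expansion by blast

lemma continuous_NN_diff: "continuous_on UNIV (\<lambda>p. NN (R *\<^sub>R uparam p - Z))"
  unfolding NN_diff by (intro continuous_on_add continuous_on_diff continuous_on_const trigpoly_continuous[OF trigpoly_NN] trigpoly_continuous[OF trigpoly_polar])

lemma IR_sum:
  assumes "R > 0" "Z1 \<in> Dplus R \<union> Dminus R" "Z2 \<in> Dplus R \<union> Dminus R" "finite F"
    and cont: "\<And>g. g \<in> F \<Longrightarrow> continuous_on UNIV (\<lambda>p. g (R *\<^sub>R uparam p))"
  shows "IR R (\<lambda>Z. \<Sum>g\<in>F. c g * g Z) Z1 Z2 = (\<Sum>g\<in>F. c g * IR R g Z1 Z2)"
proof -
  let ?k = "\<lambda>p. NN (R *\<^sub>R uparam p) ^ 2 / (NN (R *\<^sub>R uparam p - Z1) * NN (R *\<^sub>R uparam p - Z2))"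
  have k: "continuous_on UNIV ?k"
    by (intro continuous_intros continuous_NN_diff trigpoly_continuous[OF trigpoly_NN])
      (use IR_diff_nonzero[OF assms(1,2)] IR_diff_nonzero[OF assms(1,3)] in auto)
  have IR: "IR R f Z1 Z2 = avg (\<lambda>p. f (R *\<^sub>R uparam p) * ?k p)" for f
    unfolding IR_eq_avg[OF assms(1)] Let_def by simp
  show ?thesis
    unfolding IR sum_distrib_right mult.assoc
    unfolding avg_cmult[symmetric]
    by (rule avg_sum[OF assms(4)]) (intro continuous_on_mult continuous_on_const cont k)
qed

lemma IR_add:
  assumes "R > 0" "Z1 \<in> Dplus R \<union> Dminus R" "Z2 \<in> Dplus R \<union> Dminus R"
    and "continuous_on UNIV (\<lambda>p. f (R *\<^sub>R uparam p))" "continuous_on UNIV (\<lambda>p. g (R *\<^sub>R uparam p))"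
  shows "IR R (\<lambda>Z. f Z + g Z) Z1 Z2 = IR R f Z1 Z2 + IR R g Z1 Z2"
proof -
  let ?k = "\<lambda>p. NN (R *\<^sub>R uparam p) ^ 2 / (NN (R *\<^sub>R uparam p - Z1) * NN (R *\<^sub>R uparam p - Z2))"
  have k: "continuous_on UNIV ?k"
    by (intro continuous_intros continuous_NN_diff trigpoly_continuous[OF trigpoly_NN])
      (use IR_diff_nonzero[OF assms(1,2)] IR_diff_nonzero[OF assms(1,3)] in auto)
  have IR: "IR R f Z1 Z2 = avg (\<lambda>p. f (R *\<^sub>R uparam p) * ?k p)" for f
    unfolding IR_eq_avg[OF assms(1)] Let_def by simp
  show ?thesis
    unfolding IR distrib_right by (intro avg_add continuous_on_mult assms k)
qed

subsection \<open>Finite sums of products\<close>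

definition tensor_on :: "(mat2 \<Rightarrow> complex) set \<Rightarrow> mat2 set \<Rightarrow> (mat2 \<Rightarrow> mat2 \<Rightarrow> complex) \<Rightarrow> bool" where
  "tensor_on H D K \<longleftrightarrow> (\<exists>n \<phi> \<psi>. (\<forall>i<n. \<phi> i \<in> H \<and> \<psi> i \<in> H) \<and>
     (\<forall>Z1\<in>D. \<forall>Z2\<in>D. K Z1 Z2 = (\<Sum>i<(n::nat). \<phi> i Z1 * \<psi> i Z2)))"

lemma tensor_on_cong:
  assumes "\<And>Z1 Z2. Z1 \<in> D \<Longrightarrow> Z2 \<in> D \<Longrightarrow> K Z1 Z2 = L Z1 Z2" "tensor_on H D L"
  shows "tensor_on H D K"
proof -
  from assms(2) obtain n \<phi> \<psi> where "\<forall>i<n. \<phi> i \<in> H \<and> \<psi> i \<in> H" 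
     "\<forall>Z1\<in>D. \<forall>Z2\<in>D. L Z1 Z2 = (\<Sum>i<(n::nat). \<phi> i Z1 * \<psi> i Z2)"
    unfolding tensor_on_def by blast
  with assms(1) show ?thesis unfolding tensor_on_def by (intro exI[of _ n] exI[of _ \<phi>] exI[of _ \<psi>]) simp
qed

lemma tensor_on_0: "tensor_on H D (\<lambda>Z1 Z2. 0)"
  unfolding tensor_on_def by (rule exI[of _ 0]) simp

lemma tensor_on_prod: "\<phi> \<in> H \<Longrightarrow> \<psi> \<in> H \<Longrightarrow> tensor_on H D (\<lambda>Z1 Z2. \<phi> Z1 * \<psi> Z2)"
  unfolding tensor_on_def by (rule exI[of _ 1], rule exI[of _ "\<lambda>_. \<phi>"], rule exI[of _ "\<lambda>_. \<psi>"]) simp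

lemma sum_lessThan_append:
  fixes a :: "nat \<Rightarrow> complex"
  shows "(\<Sum>i<n + m. if i < n then a i else b (i - n)) = (\<Sum>i<n. a i) + (\<Sum>i<m. b i)"
  by (induction m) auto

lemma tensor_on_add:
  assumes "tensor_on H D K" "tensor_on H D L"
  shows "tensor_on H D (\<lambda>Z1 Z2. K Z1 Z2 + L Z1 Z2)"
proof -
  from assms(1) obtain n \<phi> \<psi> where 1: "\<forall>i<n. \<phi> i \<in> H \<and> \<psi> i \<in> H" 
     "\<forall>Z1\<in>D. \<forall>Z2\<in>D. K Z1 Z2 = (\<Sum>i<(n::nat). \<phi> i Z1 * \<psi> i Z2)"
    unfolding tensor_on_def by blast
  from assms(2) obtain m \<phi>' \<psi>' where 2: "\<forall>i<m. \<phi>' i \<in> H \<and> \<psi>' i \<in> H" 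
     "\<forall>Z1\<in>D. \<forall>Z2\<in>D. L Z1 Z2 = (\<Sum>i<(m::nat). \<phi>' i Z1 * \<psi>' i Z2)"
    unfolding tensor_on_def by blast
  define f where "f i = (if i < n then \<phi> i else \<phi>' (i - n))" for i
  define g where "g i = (if i < n then \<psi> i else \<psi>' (i - n))" for i
  have "\<forall>i<n + m. f i \<in> H \<and> g i \<in> H"
    using 1(1) 2(1) by (auto simp: f_def g_def)
  moreover have "K Z1 Z2 + L Z1 Z2 = (\<Sum>i<n + m. f i Z1 * g i Z2)" if "Z1 \<in> D" "Z2 \<in> D" for Z1 Z2
  proof -
    have "f i Z1 * g i Z2 = (if i < n then \<phi> i Z1 * \<psi> i Z2 else \<phi>' (i - n) Z1 * \<psi>' (i - n) Z2)" for i
      by (simp add: f_def g_def)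
    then show ?thesis 
      using 1(2) 2(2) that sum_lessThan_append[of n "\<lambda>i. \<phi> i Z1 * \<psi> i Z2" "\<lambda>i. \<phi>' i Z1 * \<psi>' i Z2" m] by simp
  qed
  ultimately show ?thesis unfolding tensor_on_def by blast
qed

lemma tensor_on_sum:
  assumes "finite A" "\<And>a. a \<in> A \<Longrightarrow> tensor_on H D (K a)"
  shows "tensor_on H D (\<lambda>Z1 Z2. \<Sum>a\<in>A. K a Z1 Z2)"
  using assms
proof (induction A rule: finite_induct)
  case empty
  show ?case by (simp add: tensor_on_0)
next
  case (insert a A)
  have "tensor_on H D (\<lambda>Z1 Z2. K a Z1 Z2 + (\<Sum>a\<in>A. K a Z1 Z2))"
    by (rule tensor_on_add) (use insert in auto)
  with insert(1,2) show ?case by simp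
qed

lemma cspan_generator: 
  assumes "f \<in> S" shows "f \<in> cspan S"
  unfolding cspan_def using assms by (auto intro!: exI[of _ "{f}"] exI[of _ "\<lambda>_. 1"])

lemma cspan_cmult:
  assumes "f \<in> cspan S" shows "(\<lambda>Z. c * f Z) \<in> cspan S"
proof -
  from assms obtain F d where F: "finite F" "F \<subseteq> S" "f = (\<lambda>Z. \<Sum>g\<in>F. d g * g Z)"
    unfolding cspan_def by blast
  have "(\<lambda>Z. c * f Z) = (\<lambda>Z. \<Sum>g\<in>F. (c * d g) * g Z)"
    unfolding F(3) sum_distrib_left mult.assoc ..
  with F(1,2) show ?thesis
    unfolding cspan_def by (intro CollectI exI[of _ F] exI[of _ "\<lambda>g. c * d g"] conjI)
qed

lemma tensor_on_cmult:
  assumes "tensor_on (cspan S) D K"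
  shows "tensor_on (cspan S) D (\<lambda>Z1 Z2. c * K Z1 Z2)"
proof -
  from assms obtain n \<phi> \<psi> where 1: "\<forall>i<n. \<phi> i \<in> cspan S \<and> \<psi> i \<in> cspan S" 
     "\<forall>Z1\<in>D. \<forall>Z2\<in>D. K Z1 Z2 = (\<Sum>i<(n::nat). \<phi> i Z1 * \<psi> i Z2)"
    unfolding tensor_on_def by blast
  have "\<forall>i<n. (\<lambda>Z. c * \<phi> i Z) \<in> cspan S \<and> \<psi> i \<in> cspan S"
    using 1(1) cspan_cmult by blast
  moreover have "\<forall>Z1\<in>D. \<forall>Z2\<in>D. c * K Z1 Z2 = (\<Sum>i<n. c * \<phi> i Z1 * \<psi> i Z2)"
    using 1(2) by (simp add: sum_distrib_left mult.assoc)
  ultimately show ?thesis unfolding tensor_on_def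
    by (intro exI[of _ n] exI[of _ "\<lambda>i Z. c * \<phi> i Z"] exI[of _ \<psi>] conjI)
qed

text \<open>The functions of Z_1 and Z_2 do not depend on the integration variable, so averaging
  only produces the scalar coefficients of a finite sum.\<close>

lemma tensor_on_avg:
  fixes \<phi> \<psi> :: "'i \<Rightarrow> mat2 \<Rightarrow> complex"
  assumes "finite I" "finite J" and h: "continuous_on UNIV h"
    and c: "\<And>i. i \<in> I \<Longrightarrow> continuous_on UNIV (c i)" "\<And>i. i \<in> I \<Longrightarrow> \<phi> i \<in> cspan S"
    and e: "\<And>j. j \<in> J \<Longrightarrow> continuous_on UNIV (e j)" "\<And>j. j \<in> J \<Longrightarrow> \<psi> j \<in> cspan S"
  shows "tensor_on (cspan S) D (\<lambda>Z1 Z2. avg (\<lambda>p. h p * ((\<Sum>i\<in>I. c i p * \<phi> i Z1) * (\<Sum>j\<in>J. e j p * \<psi> j Z2))))"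
proof (rule tensor_on_cong)
  show "tensor_on (cspan S) D (\<lambda>Z1 Z2. \<Sum>i\<in>I. \<Sum>j\<in>J. avg (\<lambda>p. h p * (c i p * e j p)) * (\<phi> i Z1 * \<psi> j Z2))"
    by (intro tensor_on_sum tensor_on_cmult tensor_on_prod assms)
  fix Z1 Z2
  have "h p * ((\<Sum>i\<in>I. c i p * \<phi> i Z1) * (\<Sum>j\<in>J. e j p * \<psi> j Z2)) = 
     (\<Sum>i\<in>I. \<Sum>j\<in>J. (\<phi> i Z1 * \<psi> j Z2) * (h p * (c i p * e j p)))" for p
    unfolding sum_product unfolding sum_distrib_left by (simp only: mult_ac)
  then have "avg (\<lambda>p. h p * ((\<Sum>i\<in>I. c i p * \<phi> i Z1) * (\<Sum>j\<in>J. e j p * \<psi> j Z2))) = 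
      avg (\<lambda>p. \<Sum>i\<in>I. \<Sum>j\<in>J. (\<phi> i Z1 * \<psi> j Z2) * (h p * (c i p * e j p)))" by simp
  also have "\<dots> = (\<Sum>i\<in>I. avg (\<lambda>p. \<Sum>j\<in>J. (\<phi> i Z1 * \<psi> j Z2) * (h p * (c i p * e j p))))"
    by (rule avg_sum[OF assms(1)]) (intro continuous_on_sum continuous_on_mult continuous_on_const h c e)
  also have "\<dots> = (\<Sum>i\<in>I. \<Sum>j\<in>J. avg (\<lambda>p. (\<phi> i Z1 * \<psi> j Z2) * (h p * (c i p * e j p))))"
    by (intro sum.cong refl avg_sum[OF assms(2)] continuous_on_mult continuous_on_const h c e)
  also have "\<dots> = (\<Sum>i\<in>I. \<Sum>j\<in>J. avg (\<lambda>p. h p * (c i p * e j p)) * (\<phi> i Z1 * \<psi> j Z2))"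
    unfolding avg_cmult by (simp only: mult.commute)
  finally show "avg (\<lambda>p. h p * ((\<Sum>i\<in>I. c i p * \<phi> i Z1) * (\<Sum>j\<in>J. e j p * \<psi> j Z2))) = 
     (\<Sum>i\<in>I. \<Sum>j\<in>J. avg (\<lambda>p. h p * (c i p * e j p)) * (\<phi> i Z1 * \<psi> j Z2))" .
qed

definition kern_index :: "nat \<Rightarrow> (nat \<times> nat \<times> nat) set" where
  "kern_index n = (SIGMA j:{..n}. {..j} \<times> {..n - j})"

lemma finite_kern_index: "finite (kern_index n)"
  by (simp add: kern_index_def)

lemma kern_expansion_index:
  "kern n W Z = (\<Sum>t\<in>kern_index n. tmult_coeff n (fst t) (fst (snd t)) (snd (snd t)) (adj2 W) * 
     tlnm n (fst (snd t) + snd (snd t)) (fst t) Z)"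
  unfolding kern_expansion kern_index_def
  by (simp add: sum.cartesian_product sum.Sigma split_def)

lemma tlnm_kern_index_Hplus:
  assumes "t \<in> kern_index n"
  shows "tlnm n (fst (snd t) + snd (snd t)) (fst t) \<in> Hplus"
  unfolding Hplus_def using assms
  by (intro cspan_generator CollectI) (unfold kern_index_def, clarsimp, intro exI conjI, rule refl, linarith+)

lemma tlnm_kern_index_Hminus:
  assumes "t \<in> kern_index n"
  shows "(\<lambda>Z. tlnm n (fst (snd t) + snd (snd t)) (fst t) Z * NN Z powi (- (int n + 1))) \<in> Hminus"
  unfolding Hminus_def using assms
  by (intro cspan_generator CollectI) (unfold kern_index_def, clarsimp, intro exI conjI, rule refl, linarith+)

lemma tensor_on_avg_kern_Hplus:
  assumes "continuous_on UNIV h"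
  shows "tensor_on Hplus D (\<lambda>Z1 Z2. avg (\<lambda>p. h p * (kern m (R *\<^sub>R uparam p) Z1 * kern n (R *\<^sub>R uparam p) Z2)))"
  unfolding kern_expansion_index Hplus_def
  by (rule tensor_on_avg) 
    (auto intro: assms finite_kern_index continuous_tmult_coeff tlnm_kern_index_Hplus[unfolded Hplus_def])

text \<open>The exponent \<open>Suc n\<close> consists of n from the scaling of the kernel and 1
  from the prefactor 1 / N(Z). It is the 2l + 1 in the definition of H^-.\<close>

lemma tensor_on_avg_kern_Hminus:
  assumes "continuous_on UNIV h"
  shows "tensor_on Hminus D (\<lambda>Z1 Z2. avg (\<lambda>p. h p * ((inverse (NN Z1) ^ Suc m * kern m (R *\<^sub>R uparam p) Z1) * 
     (inverse (NN Z2) ^ Suc n * kern n (R *\<^sub>R uparam p) Z2))))"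
proof -
  have E: "inverse (NN Z) ^ Suc n * kern n W Z = (\<Sum>t\<in>kern_index n. tmult_coeff n (fst t) (fst (snd t)) (snd (snd t)) (adj2 W) * 
     (tlnm n (fst (snd t) + snd (snd t)) (fst t) Z * NN Z powi (- (int n + 1))))" for n W Z
  proof -
    have "NN Z powi (- (int n + 1)) = inverse (NN Z) ^ Suc n"
    proof -
      have "int n + 1 = int (Suc n)" by simp
      then show ?thesis by (simp only: power_int_minus power_int_of_nat power_inverse)
    qed
    then show ?thesis unfolding kern_expansion_index sum_distrib_left by (simp only: mult_ac)
  qed
  show ?thesis unfolding E Hminus_def
    by (rule tensor_on_avg) 
      (rule assms finite_kern_index continuous_tmult_coeff | erule tlnm_kern_index_Hminus[unfolded Hminus_def])+
qed

subsection \<open>The operator on matrix coefficients\<close>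

lemma trigpoly_tlnm_NN:
  assumes "i \<le> n"
  shows "trigpoly (int n + 2 * k) (\<lambda>p. tlnm n i j (R *\<^sub>R uparam p) * NN (R *\<^sub>R uparam p) powi k)"
  by (intro trigpoly_mult trigpoly_tlnm assms trigpoly_NN_powi)

lemma trigpoly_Zh_monomial:
  "trigpoly (int a * 1 + int b * 1 + int c * 1 + int d * 1 + 2 * k) (\<lambda>p. (R *\<^sub>R uparam p)$1$1 ^ a * (R *\<^sub>R uparam p)$1$2 ^ b * 
     (R *\<^sub>R uparam p)$2$1 ^ c * (R *\<^sub>R uparam p)$2$2 ^ d * NN (R *\<^sub>R uparam p) powi k)"
  by (intro trigpoly_mult trigpoly_power trigpoly_scaleR_uparam trigpoly_NN_powi)

lemma IR_tlnm_Dplus_eq_0: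
  assumes "R > 0" "Z1 \<in> Dplus R" "Z2 \<in> Dplus R" "i \<le> n" "j \<le> n" "k < 0"
  shows "IR R (\<lambda>Z. tlnm n i j Z * NN Z powi k) Z1 Z2 = 0"
proof (cases "0 \<le> int n + 2 * k")
  case True
  define m where "m = nat (int n + 2 * k)"
  have m: "int n + 2 * k = int m" using True by (simp add: m_def)
  let ?h = "\<lambda>q p. tlnm n i j (R *\<^sub>R uparam p) * NN (R *\<^sub>R uparam p) powi (k - int m) * 
     (kern q (R *\<^sub>R uparam p) Z1 * kern (m - q) (R *\<^sub>R uparam p) Z2)"
  have e: "NN (R *\<^sub>R uparam p) powi (k - int m) = NN (R *\<^sub>R uparam p) powi k * NN (R *\<^sub>R uparam p) powi (- int m)" for p
    using NN_scaleR_uparam_nonzero[OF assms(1)] by (subst power_int_add[symmetric]) auto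
  have "IR R (\<lambda>Z. tlnm n i j Z * NN Z powi k) Z1 Z2 = avg (\<lambda>p. \<Sum>q\<le>m. ?h q p)"
    unfolding IR_Dplus[OF assms(1-3) trigpoly_tlnm_NN[OF assms(4)]] if_P[OF True]
    unfolding m nat_int e unfolding sum_distrib_left by (simp only: mult_ac)
  also have "\<dots> = (\<Sum>q\<le>m. avg (?h q))"
    by (rule avg_sum) (auto intro!: continuous_on_mult tlnm_continuous assms
      trigpoly_continuous[OF trigpoly_NN_powi] trigpoly_continuous[OF trigpoly_kern])
  also have "\<dots> = 0"
  proof (intro sum.neutral ballI)
    fix q assume "q \<in> {..m}"
    then have "q + (m - q) < n" using m assms(6) by auto
    then show "avg (?h q) = 0" by (rule avg_tlnm_kern2_eq_0[OF assms(1,4,5)])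
  qed
  finally show ?thesis .
next
  case False
  then show ?thesis unfolding IR_Dplus[OF assms(1-3) trigpoly_tlnm_NN[OF assms(4)]] by simp
qed

lemma IR_tlnm_Dplus_diagonal:
  assumes "R > 0" "Z \<in> Dplus R" "i \<le> n" "j \<le> n" "0 \<le> k"
  shows "IR R (\<lambda>Z. tlnm n i j Z * NN Z powi k) Z Z = tlnm n i j Z * NN Z powi k"
proof -
  define l where "l = nat k"
  have k: "k = int l" using assms(5) by (simp add: l_def)
  define m where "m = n + 2 * l"
  have m: "int n + 2 * k = int m" by (simp add: m_def k)
  \<comment> \<open>The total power of N(W) is k - (n + 2k) = - (n + k), the exponent in the
    diagonal formula.\<close>
  have e: "NN (R *\<^sub>R uparam p) powi k * NN (R *\<^sub>R uparam p) powi (- int m) = NN (R *\<^sub>R uparam p) powi (- int (n + l))" for p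
    using NN_scaleR_uparam_nonzero[OF assms(1)] 
    by (subst power_int_add[symmetric]) (auto simp: k m_def algebra_simps)
  have "IR R (\<lambda>Z. tlnm n i j Z * NN Z powi k) Z Z = avg (\<lambda>p. tlnm n i j (R *\<^sub>R uparam p) * NN (R *\<^sub>R uparam p) powi (- int (n + l)) *
     (\<Sum>q\<le>m. kern q (R *\<^sub>R uparam p) Z * kern (m - q) (R *\<^sub>R uparam p) Z))"
    unfolding IR_Dplus[OF assms(1,2,2) trigpoly_tlnm_NN[OF assms(3)]] m e[symmetric] by (simp add: mult.assoc)
  also have "\<dots> = tlnm n i j Z * NN Z ^ l"
    by (rule avg_tlnm_kern_diagonal[OF assms(1,3,4) m_def])
  finally show ?thesis by (simp add: k)
qed

lemma IR_tlnm_Dminus_eq_0: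
  assumes "R > 0" "Z1 \<in> Dminus R" "Z2 \<in> Dminus R" "i \<le> n" "j \<le> n" "- (int n + 1) \<le> k"
  shows "IR R (\<lambda>Z. tlnm n i j Z * NN Z powi k) Z1 Z2 = 0"
proof (cases "int n + 2 * k \<le> - 4")
  case True
  define m where "m = nat (- (int n + 2 * k) - 4)"
  have m: "- (int n + 2 * k) - 4 = int m" using True by (simp add: m_def)
  let ?h = "\<lambda>q p. tlnm n i j (R *\<^sub>R uparam p) * NN (R *\<^sub>R uparam p) powi (k + 2) * 
     (kern q (R *\<^sub>R uparam p) Z1 * kern (m - q) (R *\<^sub>R uparam p) Z2)"
  let ?c = "\<lambda>q. inverse (NN Z1) ^ Suc q * inverse (NN Z2) ^ Suc (m - q)"
  have e: "NN (R *\<^sub>R uparam p) powi (k + 2) = NN (R *\<^sub>R uparam p) powi k * NN (R *\<^sub>R uparam p) ^ 2" for p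
    using NN_scaleR_uparam_nonzero[OF assms(1)] by (subst power_int_add) auto
  have "IR R (\<lambda>Z. tlnm n i j Z * NN Z powi k) Z1 Z2 = avg (\<lambda>p. \<Sum>q\<le>m. ?c q * ?h q p)"
    unfolding IR_Dminus[OF assms(1-3) trigpoly_tlnm_NN[OF assms(4)]] if_P[OF True] m nat_int e
    unfolding sum_distrib_left by (simp only: mult_ac)
  also have "\<dots> = (\<Sum>q\<le>m. ?c q * avg (?h q))"
    unfolding avg_cmult[symmetric]
    by (rule avg_sum) (auto intro!: continuous_on_mult continuous_on_const tlnm_continuous assms
      trigpoly_continuous[OF trigpoly_NN_powi] trigpoly_continuous[OF trigpoly_kern])
  also have "\<dots> = 0"
  proof (intro sum.neutral ballI)
    fix q assume "q \<in> {..m}"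
    then have "q + (m - q) < n" using m assms(6) by auto
    then have "avg (?h q) = 0" by (rule avg_tlnm_kern2_eq_0[OF assms(1,4,5)])
    then show "?c q * avg (?h q) = 0" by simp
  qed
  finally show ?thesis .
next
  case False
  then show ?thesis unfolding IR_Dminus[OF assms(1-3) trigpoly_tlnm_NN[OF assms(4)]] by simp
qed

lemma IR_tlnm_Dminus_diagonal:
  assumes "R > 0" "Z \<in> Dminus R" "i \<le> n" "j \<le> n" "k \<le> - (int n + 2)"
  shows "IR R (\<lambda>Z. tlnm n i j Z * NN Z powi k) Z Z = tlnm n i j Z * NN Z powi k"
proof -
  \<comment> \<open>Chosen so that k + 2 = - (n + l): the diagonal formula of the inner case applies
    with l in place of k, and N(Z)^(-(m+2)) N(Z)^l = N(Z)^k.\<close>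
  define l where "l = nat (- k - int n - 2)"
  have k: "k = - int l - int n - 2" using assms(5) by (simp add: l_def)
  define m where "m = n + 2 * l"
  have m: "- (int n + 2 * k) - 4 = int m" by (simp add: m_def k)
  have le: "int n + 2 * k \<le> - 4" using m by linarith
  have nz: "NN Z \<noteq> 0" by (rule Dminus_NN_nonzero[OF assms(2,1)])
  have e: "NN (R *\<^sub>R uparam p) powi k * NN (R *\<^sub>R uparam p) ^ 2 = NN (R *\<^sub>R uparam p) powi (- int (n + l))" for p
  proof -
    have "- int (n + l) = k + 2" by (simp add: k)
    then show ?thesis using NN_scaleR_uparam_nonzero[OF assms(1)] by (simp only:) (subst power_int_add; simp)
  qed
  have c: "(inverse (NN Z) ^ Suc q * x) * (inverse (NN Z) ^ Suc (m - q) * y) = inverse (NN Z) ^ (m + 2) * (x * y)" if "q \<le> m" for q x y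
  proof -
    have "inverse (NN Z) ^ (m + 2) = inverse (NN Z) ^ Suc q * inverse (NN Z) ^ Suc (m - q)"
      unfolding power_add[symmetric] using that by simp
    then show ?thesis by (simp only: mult_ac)
  qed
  have "IR R (\<lambda>Z. tlnm n i j Z * NN Z powi k) Z Z = avg (\<lambda>p. inverse (NN Z) ^ (m + 2) * (tlnm n i j (R *\<^sub>R uparam p) * NN (R *\<^sub>R uparam p) powi (- int (n + l)) *
     (\<Sum>q\<le>m. kern q (R *\<^sub>R uparam p) Z * kern (m - q) (R *\<^sub>R uparam p) Z)))"
    unfolding IR_Dminus[OF assms(1,2,2) trigpoly_tlnm_NN[OF assms(3)]] if_P[OF le] m nat_int e[symmetric]
  proof (rule arg_cong[where f = avg], rule ext)
    fix p
    have "(\<Sum>q\<le>m. inverse (NN Z) ^ Suc q * kern q (R *\<^sub>R uparam p) Z * (inverse (NN Z) ^ Suc (m - q) * kern (m - q) (R *\<^sub>R uparam p) Z))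
      = (\<Sum>q\<le>m. inverse (NN Z) ^ (m + 2) * (kern q (R *\<^sub>R uparam p) Z * kern (m - q) (R *\<^sub>R uparam p) Z))"
      by (rule sum.cong[OF refl], rule c) simp
    then show "tlnm n i j (R *\<^sub>R uparam p) * NN (R *\<^sub>R uparam p) powi k * NN (R *\<^sub>R uparam p) ^ 2 *
      (\<Sum>q\<le>m. inverse (NN Z) ^ Suc q * kern q (R *\<^sub>R uparam p) Z * (inverse (NN Z) ^ Suc (m - q) * kern (m - q) (R *\<^sub>R uparam p) Z))
      = inverse (NN Z) ^ (m + 2) * (tlnm n i j (R *\<^sub>R uparam p) * (NN (R *\<^sub>R uparam p) powi k * NN (R *\<^sub>R uparam p) ^ 2) *
        (\<Sum>q\<le>m. kern q (R *\<^sub>R uparam p) Z * kern (m - q) (R *\<^sub>R uparam p) Z))"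
      unfolding sum_distrib_left[symmetric] by (simp only: mult_ac)
  qed
  also have "\<dots> = inverse (NN Z) ^ (m + 2) * (tlnm n i j Z * NN Z ^ l)"
    unfolding avg_cmult avg_tlnm_kern_diagonal[OF assms(1,3,4) m_def] ..
  also have "\<dots> = (inverse (NN Z) ^ (m + 2) * NN Z ^ l) * tlnm n i j Z"
    by (simp only: mult_ac)
  also have "inverse (NN Z) ^ (m + 2) * NN Z ^ l = NN Z powi k"
  proof -
    have "k = - int (m + 2) + int l" by (simp add: k m_def)
    then show ?thesis using nz by (simp only: power_int_add simp_thms power_int_minus power_int_of_nat power_inverse)
  qed
  finally show ?thesis by (simp only: mult.commute)
qed

section \<open>Passage from generators to their spans\<close>

lemma IR_cspan_eq:
  assumes R: "R > 0" and Z: "Z1 \<in> Dplus R \<union> Dminus R" "Z2 \<in> Dplus R \<union> Dminus R"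
    and f: "f \<in> cspan S" and cont: "\<And>g. g \<in> S \<Longrightarrow> continuous_on UNIV (\<lambda>p. g (R *\<^sub>R uparam p))"
  obtains F c where "finite F" "F \<subseteq> S" "f = (\<lambda>Z. \<Sum>g\<in>F. c g * g Z)" "IR R f Z1 Z2 = (\<Sum>g\<in>F. c g * IR R g Z1 Z2)"
proof -
  from f obtain F c where F: "finite F" "F \<subseteq> S" "f = (\<lambda>Z. \<Sum>g\<in>F. c g * g Z)"
    unfolding cspan_def by blast
  show thesis
    by (rule that[OF F]) (unfold F(3), rule IR_sum[OF R Z F(1)], use F(2) cont in blast)
qed

lemma continuous_cspan:
  assumes f: "f \<in> cspan S" and cont: "\<And>g. g \<in> S \<Longrightarrow> continuous_on UNIV (\<lambda>p. g (R *\<^sub>R uparam p))"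
  shows "continuous_on UNIV (\<lambda>p. f (R *\<^sub>R uparam p))"
proof -
  from f obtain F c where F: "finite F" "F \<subseteq> S" "f = (\<lambda>Z. \<Sum>g\<in>F. c g * g Z)"
    unfolding cspan_def by blast
  show ?thesis unfolding F(3) using F(2) cont by (intro continuous_on_sum continuous_on_mult continuous_on_const) blast
qed

lemma tensor_on_IR_cspan:
  assumes R: "R > 0" and D: "D \<subseteq> Dplus R \<union> Dminus R"
    and f: "f \<in> cspan S" and cont: "\<And>g. g \<in> S \<Longrightarrow> continuous_on UNIV (\<lambda>p. g (R *\<^sub>R uparam p))"
    and t: "\<And>g. g \<in> S \<Longrightarrow> tensor_on (cspan T) D (IR R g)"
  shows "tensor_on (cspan T) D (IR R f)"
proof -
  from f obtain F c where F: "finite F" "F \<subseteq> S" "f = (\<lambda>Z. \<Sum>g\<in>F. c g * g Z)"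
    unfolding cspan_def by blast
  show ?thesis
  proof (rule tensor_on_cong)
    fix Z1 Z2 assume "Z1 \<in> D" "Z2 \<in> D"
    then show "IR R f Z1 Z2 = (\<Sum>g\<in>F. c g * IR R g Z1 Z2)"
      unfolding F(3) using D F(2) cont by (intro IR_sum[OF R _ _ F(1)]) blast+
  next
    show "tensor_on (cspan T) D (\<lambda>Z1 Z2. \<Sum>g\<in>F. c g * IR R g Z1 Z2)"
      using F(2) t by (intro tensor_on_sum[OF F(1)] tensor_on_cmult) blast
  qed
qed

lemma tensor_on_IR_Dplus:
  assumes "R > 0" and f: "trigpoly m (\<lambda>p. f (R *\<^sub>R uparam p))"
  shows "tensor_on Hplus (Dplus R) (IR R f)"
proof (rule tensor_on_cong)
  let ?h = "\<lambda>p. f (R *\<^sub>R uparam p) * NN (R *\<^sub>R uparam p) powi (- m)"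
  let ?k = "\<lambda>q Z1 Z2. avg (\<lambda>p. ?h p * (kern q (R *\<^sub>R uparam p) Z1 * kern (nat m - q) (R *\<^sub>R uparam p) Z2))"
  have h: "continuous_on UNIV ?h"
    by (intro continuous_on_mult trigpoly_continuous[OF f] trigpoly_continuous[OF trigpoly_NN_powi])
  show "IR R f Z1 Z2 = (\<Sum>q\<in>(if 0 \<le> m then {..nat m} else {}). ?k q Z1 Z2)" if "Z1 \<in> Dplus R" "Z2 \<in> Dplus R" for Z1 Z2
  proof (cases "0 \<le> m")
    case True
    have "avg (\<lambda>p. \<Sum>q\<le>nat m. ?h p * (kern q (R *\<^sub>R uparam p) Z1 * kern (nat m - q) (R *\<^sub>R uparam p) Z2)) = (\<Sum>q\<le>nat m. ?k q Z1 Z2)"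
      by (intro avg_sum finite_atMost continuous_on_mult[OF h] continuous_on_mult trigpoly_continuous[OF trigpoly_kern])
    with True show ?thesis unfolding IR_Dplus[OF assms(1) that f] by (simp only: sum_distrib_left if_True)
  qed (simp add: IR_Dplus[OF assms(1) that f])
  show "tensor_on Hplus (Dplus R) (\<lambda>Z1 Z2. (\<Sum>q\<in>(if 0 \<le> m then {..nat m} else {}). ?k q Z1 Z2))"
    by (intro tensor_on_sum tensor_on_avg_kern_Hplus h) simp
qed

lemma tensor_on_IR_Dminus:
  assumes "R > 0" and f: "trigpoly m (\<lambda>p. f (R *\<^sub>R uparam p))"
  shows "tensor_on Hminus (Dminus R) (IR R f)"
proof (rule tensor_on_cong)
  let ?h = "\<lambda>p. f (R *\<^sub>R uparam p) * NN (R *\<^sub>R uparam p) ^ 2"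
  let ?d = "nat (- m - 4)"
  let ?t = "\<lambda>q Z1 Z2 p. ?h p * ((inverse (NN Z1) ^ Suc q * kern q (R *\<^sub>R uparam p) Z1) * (inverse (NN Z2) ^ Suc (?d - q) * kern (?d - q) (R *\<^sub>R uparam p) Z2))"
  have h: "continuous_on UNIV ?h"
    by (intro continuous_on_mult continuous_on_power trigpoly_continuous[OF f] trigpoly_continuous[OF trigpoly_NN])
  show "IR R f Z1 Z2 = (\<Sum>q\<in>(if m \<le> - 4 then {..?d} else {}). avg (?t q Z1 Z2))" if "Z1 \<in> Dminus R" "Z2 \<in> Dminus R" for Z1 Z2
  proof (cases "m \<le> - 4")
    case True
    have "avg (\<lambda>p. \<Sum>q\<le>?d. ?t q Z1 Z2 p) = (\<Sum>q\<le>?d. avg (?t q Z1 Z2))"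
      by (intro avg_sum finite_atMost continuous_on_mult[OF h] continuous_on_mult continuous_on_const trigpoly_continuous[OF trigpoly_kern])
    with True show ?thesis unfolding IR_Dminus[OF assms(1) that f] by (simp only: sum_distrib_left if_True)
  qed (simp add: IR_Dminus[OF assms(1) that f])
  show "tensor_on Hminus (Dminus R) (\<lambda>Z1 Z2. (\<Sum>q\<in>(if m \<le> - 4 then {..?d} else {}). avg (?t q Z1 Z2)))"
    by (intro tensor_on_sum tensor_on_avg_kern_Hminus h) simp
qed

abbreviation tN_span :: "(nat \<Rightarrow> int \<Rightarrow> bool) \<Rightarrow> (mat2 \<Rightarrow> complex) set" where
  "tN_span P \<equiv> cspan {(\<lambda>Z. tlnm l2 mm nn Z * NN Z powi k) | l2 mm nn k. mm \<le> l2 \<and> nn \<le> l2 \<and> P l2 k}"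

lemma continuous_tN_span: 
  assumes "f \<in> tN_span P" shows "continuous_on UNIV (\<lambda>p. f (R *\<^sub>R uparam p))"
  by (rule continuous_cspan[OF assms]) (auto intro: trigpoly_continuous[OF trigpoly_tlnm_NN])

text \<open>The scalar r unites two uses: r = 1 with equal arguments gives reproduction, and r = 0
  gives vanishing.\<close>

lemma IR_tN_span:
  assumes R: "R > 0" and Z: "Z1 \<in> Dplus R \<union> Dminus R" "Z2 \<in> Dplus R \<union> Dminus R" and f: "f \<in> tN_span P" 
    and IR: "\<And>n i j k. i \<le> n \<Longrightarrow> j \<le> n \<Longrightarrow> P n k \<Longrightarrow> IR R (\<lambda>Z. tlnm n i j Z * NN Z powi k) Z1 Z2 = r * (tlnm n i j Z1 * NN Z1 powi k)"
  shows "IR R f Z1 Z2 = r * f Z1"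
proof -
  let ?S = "{(\<lambda>Z. tlnm l2 mm nn Z * NN Z powi k) | l2 mm nn k. mm \<le> l2 \<and> nn \<le> l2 \<and> P l2 k}"
  obtain F c where F: "finite F" "F \<subseteq> ?S" "f = (\<lambda>Z. \<Sum>g\<in>F. c g * g Z)" "IR R f Z1 Z2 = (\<Sum>g\<in>F. c g * IR R g Z1 Z2)"
  proof (rule IR_cspan_eq[OF R Z f])
    show "continuous_on UNIV (\<lambda>p. g (R *\<^sub>R uparam p))" if "g \<in> ?S" for g
      using that by (auto intro: trigpoly_continuous[OF trigpoly_tlnm_NN])
  qed
  have "IR R g Z1 Z2 = r * g Z1" if "g \<in> F" for g
    using that F(2) IR by blast
  then have "IR R f Z1 Z2 = (\<Sum>g\<in>F. c g * (r * g Z1))"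
    unfolding F(4) by simp
  then show ?thesis
    unfolding F(3) sum_distrib_left by (simp only: mult.left_commute)
qed

theorem mainTheorem5:
  fixes R :: real
  assumes "R > 0"
  shows
   "(\<forall>f\<in>Zh. \<exists>n \<phi> \<psi>. (\<forall>i<n. \<phi> i \<in> Hplus \<and> \<psi> i \<in> Hplus) \<and>
        (\<forall>Z1\<in>Dplus R. \<forall>Z2\<in>Dplus R. IR R f Z1 Z2 = (\<Sum>i<(n::nat). \<phi> i Z1 * \<psi> i Z2)))
    \<and> (\<forall>f\<in>ZhPlus. \<forall>Z\<in>Dplus R. IR R f Z Z = f Z)
    \<and> (\<forall>f\<in>fsum ZhMinus ZhZero. \<forall>Z1\<in>Dplus R. \<forall>Z2\<in>Dplus R. IR R f Z1 Z2 = 0)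
    \<and> (\<forall>f\<in>Zh. \<exists>n \<phi> \<psi>. (\<forall>i<n. \<phi> i \<in> Hminus \<and> \<psi> i \<in> Hminus) \<and>
        (\<forall>Z1\<in>Dminus R. \<forall>Z2\<in>Dminus R. IR R f Z1 Z2 = (\<Sum>i<(n::nat). \<phi> i Z1 * \<psi> i Z2)))
    \<and> (\<forall>f\<in>ZhMinus. \<forall>Z\<in>Dminus R. IR R f Z Z = f Z)
    \<and> (\<forall>f\<in>fsum ZhZero ZhPlus. \<forall>Z1\<in>Dminus R. \<forall>Z2\<in>Dminus R. IR R f Z1 Z2 = 0)"
proof -
  note R = \<open>R > 0\<close>
  let ?Zh = "{(\<lambda>Z. Z$1$1 ^ a * Z$1$2 ^ b * Z$2$1 ^ c * Z$2$2 ^ d * NN Z powi k) | a b c d k. True}"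
  \<comment> \<open>Every monomial generating Zh is homogeneous for the circle action, so the tensor
    product claims are checked on monomials directly, without the decomposition of Zh.\<close>
  have tr: "\<exists>m. trigpoly m (\<lambda>p. g (R *\<^sub>R uparam p))" if "g \<in> ?Zh" for g
    using that trigpoly_Zh_monomial[of _ _ _ _ _ R] by blast
  have tc: "continuous_on UNIV (\<lambda>p. g (R *\<^sub>R uparam p))" if "g \<in> ?Zh" for g
    using tr[OF that] trigpoly_continuous by blast
  have 1: "tensor_on Hplus (Dplus R) (IR R f)" if "f \<in> Zh" for f
    unfolding Hplus_def
  proof (rule tensor_on_IR_cspan[OF R _ that[unfolded Zh_def] tc])
    show "tensor_on (cspan {tlnm l2 mm nn | l2 mm nn. mm \<le> l2 \<and> nn \<le> l2}) (Dplus R) (IR R g)" if "g \<in> ?Zh" for g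
      using tr[OF that] tensor_on_IR_Dplus[OF R] unfolding Hplus_def by blast
  qed auto
  have 4: "tensor_on Hminus (Dminus R) (IR R f)" if "f \<in> Zh" for f
    unfolding Hminus_def
  proof (rule tensor_on_IR_cspan[OF R _ that[unfolded Zh_def] tc])
    show "tensor_on (cspan {(\<lambda>Z. tlnm l2 mm nn Z * NN Z powi (- (int l2 + 1))) | l2 mm nn. mm \<le> l2 \<and> nn \<le> l2}) (Dminus R) (IR R g)" 
      if "g \<in> ?Zh" for g
      using tr[OF that] tensor_on_IR_Dminus[OF R] unfolding Hminus_def by blast
  qed auto
  have Zh: "ZhPlus = tN_span (\<lambda>n k. 0 \<le> k)" "ZhMinus = tN_span (\<lambda>n k. k \<le> - (int n + 2))"
    "ZhZero = tN_span (\<lambda>n k. - (int n + 1) \<le> k \<and> k \<le> -1)"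
    unfolding ZhPlus_def ZhMinus_def ZhZero_def by (rule refl)+
  have 2: "IR R f Z Z = f Z" if "f \<in> ZhPlus" "Z \<in> Dplus R" for f Z
  proof -
    have "IR R f Z Z = 1 * f Z"
      by (rule IR_tN_span[OF R _ _ that(1)[unfolded Zh]]) (use that(2) IR_tlnm_Dplus_diagonal[OF R] in auto)
    then show ?thesis by simp
  qed
  have 5: "IR R f Z Z = f Z" if "f \<in> ZhMinus" "Z \<in> Dminus R" for f Z
  proof -
    have "IR R f Z Z = 1 * f Z"
      by (rule IR_tN_span[OF R _ _ that(1)[unfolded Zh]]) (use that(2) IR_tlnm_Dminus_diagonal[OF R] in auto)
    then show ?thesis by simp
  qed
  have z: "IR R f Z1 Z2 = 0" if "Z1 \<in> Dplus R \<union> Dminus R" "Z2 \<in> Dplus R \<union> Dminus R" "f \<in> tN_span P"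
    "\<And>n i j k. i \<le> n \<Longrightarrow> j \<le> n \<Longrightarrow> P n k \<Longrightarrow> IR R (\<lambda>Z. tlnm n i j Z * NN Z powi k) Z1 Z2 = 0" for f Z1 Z2 P
    using IR_tN_span[OF R that(1-3), of 0] that(4) by simp
  have 3: "IR R f Z1 Z2 = 0" if f: "f \<in> fsum ZhMinus ZhZero" and Z: "Z1 \<in> Dplus R" "Z2 \<in> Dplus R" for f Z1 Z2
  proof -
    obtain g h where g: "g \<in> ZhMinus" and h: "h \<in> ZhZero" and f: "f = (\<lambda>Z. g Z + h Z)"
      using f unfolding fsum_def by blast
    have "IR R g Z1 Z2 = 0" 
      by (rule z[OF _ _ g[unfolded Zh]]) (use Z in \<open>auto intro!: IR_tlnm_Dplus_eq_0[OF R]\<close>)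
    moreover have "IR R h Z1 Z2 = 0" 
      by (rule z[OF _ _ h[unfolded Zh]]) (use Z in \<open>auto intro!: IR_tlnm_Dplus_eq_0[OF R]\<close>)
    moreover have "IR R f Z1 Z2 = IR R g Z1 Z2 + IR R h Z1 Z2"
      unfolding f using g h Z unfolding Zh by (intro IR_add[OF R] continuous_tN_span) auto
    ultimately show ?thesis by simp
  qed
  have 6: "IR R f Z1 Z2 = 0" if f: "f \<in> fsum ZhZero ZhPlus" and Z: "Z1 \<in> Dminus R" "Z2 \<in> Dminus R" for f Z1 Z2
  proof -
    obtain g h where g: "g \<in> ZhZero" and h: "h \<in> ZhPlus" and f: "f = (\<lambda>Z. g Z + h Z)"
      using f unfolding fsum_def by blast
    have "IR R g Z1 Z2 = 0" 
      by (rule z[OF _ _ g[unfolded Zh]]) (use Z in \<open>auto intro!: IR_tlnm_Dminus_eq_0[OF R]\<close>)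
    moreover have "IR R h Z1 Z2 = 0" 
      by (rule z[OF _ _ h[unfolded Zh]]) (use Z in \<open>auto intro!: IR_tlnm_Dminus_eq_0[OF R]\<close>)
    moreover have "IR R f Z1 Z2 = IR R g Z1 Z2 + IR R h Z1 Z2"
      unfolding f using g h Z unfolding Zh by (intro IR_add[OF R] continuous_tN_span) auto
    ultimately show ?thesis by simp
  qed
  show ?thesis
    using 1 2 3 4 5 6 unfolding tensor_on_def by blast
qed

end
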